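(* Let $d$ be a positive integer. Consider constants $a_1,a_2>0$ and $b_1,b_2\ge 0$, and a unit vector $\bm{u}\in\mathbb{R}^d$. Then $\mathcal{T}^{(3)}_{a_1,a_2,b_1,b_2,\bm{u}}[\mathcal{M}_\nu]$ with $\nu>1$, $\mathcal{T}^{(3)}_{a_1,a_2,b_1,b_2,\bm{u}}[\mathcal{C}_\delta]$ with $\delta>0$, and $\mathcal{T}^{(3)}_{a_1,a_2,b_1,b_2,\bm{u}}[\mathcal{H}_{\alpha,\beta,\gamma}]$ with $2\alpha>d+2$, $2(\beta-\alpha)(\gamma-\alpha)\ge\alpha$ and $2(\beta+\gamma)\ge 6\alpha+1$, are stationary covariance functions in $\mathbb{R}^d$.
   Context: A function $C:\mathbb{R}^d\to\mathbb{R}$ is a stationary covariance function in $\mathbb{R}^d$ if $(\bm{x},\bm{x}')\mapsto C(\bm{x}-\bm{x}')$ is the covariance function of a second-order zero-mean random field on $\mathbb{R}^d$, i.e. is (symmetric) positive semidefinite: $\sum_{i,j=1}^n v_iv_jC(\bm{x}_i-\bm{x}_j)\ge 0$ for all $n\in\mathbb{N}$, $v_1,\dots,v_n\in\mathbb{R}$, $\bm{x}_1,\dots,\bm{x}_n\in\mathbb{R}^d$. For $\varphi:[0,\infty)\to\mathbb{R}$, $$\mathcal{T}^{(3)}_{a_1,a_2,b_1,b_2,\bm{u}}[\varphi](\bm{h})=b_1\,\varphi(\sqrt{a_1}\,\|\bm{h}\|)-b_2\left[\cos^2(\theta(\bm{h},\bm{u}))\,\varphi''(\sqrt{a_2}\,\|\bm{h}\|)+\sin^2(\theta(\bm{h},\bm{u}))\,\frac{\varphi'(\sqrt{a_2}\,\|\bm{h}\|)}{\sqrt{a_2}\,\|\bm{h}\|}\right],\quad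 \bm{h}\in\mathbb{R}^d,$$ where $\|\cdot\|$ is the Euclidean norm and $\theta(\bm{h},\bm{u})$ is the angle between $\bm{h}$ and $\bm{u}$; at $\bm{h}=\bm{0}$ the bracket is understood by continuity, i.e. as $\varphi''(0)$. The Matérn model is $\mathcal{M}_\nu(t)=\frac{2^{1-\nu}}{\Gamma(\nu)}t^\nu\mathcal{K}_\nu(t)$ for $t\ge 0$ (with value $1$ at $t=0$ by continuity), $\mathcal{K}_\nu$ being the modified Bessel function of the second kind. The Cauchy model is $\mathcal{C}_\delta(t)=(t^2+1)^{-\delta}$, $t\ge 0$, with shape parameter $\delta>0$. The Gauss hypergeometric model is, for $t\ge 0$, $$\mathcal{H}_{\alpha,\beta,\gamma}(t)=(1-t^2)_+^{\beta-\alpha+\gamma-d/2-1}\;{}_2F_1\big(\beta-\alpha,\gamma-\alpha;\beta-\alpha+\gamma-d/2;(1-t^2)_+\big),$$ where ${}_2F_1$ is the Gauss hypergeometric function and $(\cdot)_+$ the positive part. *)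

theory Defs
  imports "HOL-Analysis.Analysis"
begin

definition stationary_covariance :: "('a::euclidean_space \<Rightarrow> real) \<Rightarrow> bool" where
  "stationary_covariance C \<longleftrightarrow>
     (\<forall>h. C (- h) = C h) \<and>
     (\<forall>(n::nat) (v::nat \<Rightarrow> real) (x::nat \<Rightarrow> 'a).
        (\<Sum>i<n. \<Sum>j<n. v i * v j * C (x i - x j)) \<ge> 0)"

text \<open>A function on \<open>[0,\<infinity>)\<close> is represented by a function on all reals whose values at negative
  arguments are irrelevant. Accordingly derivatives are taken within \<open>[0,\<infinity>)\<close>: the usual two-sided
  derivative at \<open>t > 0\<close> and the right derivative at \<open>t = 0\<close>.\<close>

definition deriv_nonneg :: "(real \<Rightarrow> real) \<Rightarrow> real \<Rightarrow> real" where
  "deriv_nonneg \<phi> t = vector_derivative \<phi> (at t within {0..})"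

definition vec_angle :: "'a::euclidean_space \<Rightarrow> 'a \<Rightarrow> real" where
  "vec_angle h u = arccos (inner h u / (norm h * norm u))"

text \<open>At \<open>h = 0\<close> the angle is meaningless and the bracket takes its limiting value \<open>\<phi>''(0)\<close>.\<close>

definition T3 ::
  "real \<Rightarrow> real \<Rightarrow> real \<Rightarrow> real \<Rightarrow> 'a::euclidean_space \<Rightarrow> (real \<Rightarrow> real) \<Rightarrow> 'a \<Rightarrow> real" where
  "T3 a1 a2 b1 b2 u \<phi> h =
     b1 * \<phi> (sqrt a1 * norm h) -
     b2 * (if h = 0 then deriv_nonneg (deriv_nonneg \<phi>) 0
           else (cos (vec_angle h u))\<^sup>2 * deriv_nonneg (deriv_nonneg \<phi>) (sqrt a2 * norm h) +
                (sin (vec_angle h u))\<^sup>2 *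
                  (deriv_nonneg \<phi> (sqrt a2 * norm h) / (sqrt a2 * norm h)))"

text \<open>The modified Bessel function of the second kind for real order and argument \<open>t > 0\<close>, through
  its integral \<open>\<integral>\<^sub>0\<^sup>\<infinity> exp(-t cosh s) cosh(\<nu>s) ds\<close> (Watson, 6.22; DLMF, 10.32.9), which covers
  integer and non-integer orders alike.\<close>

definition bessel_K :: "real \<Rightarrow> real \<Rightarrow> real" where
  "bessel_K \<nu> t = (LBINT s:{0..}. exp (- t * cosh s) * cosh (\<nu> * s))"

definition matern :: "real \<Rightarrow> real \<Rightarrow> real" where
  "matern \<nu> t =
     (if t = 0 then 1 else 2 powr (1 - \<nu>) / Gamma \<nu> * t powr \<nu> * bessel_K \<nu> t)"

definition cauchy_model :: "real \<Rightarrow> real \<Rightarrow> real" where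
  "cauchy_model \<delta> t = (t\<^sup>2 + 1) powr (- \<delta>)"

text \<open>\<open>\<^sub>2F\<^sub>1(a,b;c;z)\<close> as the sum of its Gauss series; only \<open>0 \<le> z \<le> 1\<close> occurs below. The endpoint
  \<open>z = 1\<close> lies on the circle of convergence, and the series converges there for \<open>c - a - b > 0\<close>.\<close>

definition hyp2F1 :: "real \<Rightarrow> real \<Rightarrow> real \<Rightarrow> real \<Rightarrow> real" where
  "hyp2F1 a b c z = eval_fps (fps_hypergeo [a, b] [c] 1) z"

definition gauss_hypergeometric_model ::
  "nat \<Rightarrow> real \<Rightarrow> real \<Rightarrow> real \<Rightarrow> real \<Rightarrow> real" where
  "gauss_hypergeometric_model d \<alpha> \<beta> \<gamma> t =
     max 0 (1 - t\<^sup>2) powr (\<beta> - \<alpha> + \<gamma> - real d / 2 - 1) *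
     hyp2F1 (\<beta> - \<alpha>) (\<gamma> - \<alpha>) (\<beta> - \<alpha> + \<gamma> - real d / 2) (max 0 (1 - t\<^sup>2))"

end

theory Submission
  imports Defs
begin

text \<open>
  Put \<open>\<Phi>(h) = \<phi>(sqrt a2 |h|)\<close>. Then \<open>a2\<close> times the bracket in \<open>T3\<close> is the second derivative of \<open>\<Phi>\<close>
  in the direction \<open>u\<close>. If \<open>\<Phi>\<close> is a covariance function, then so is
  \<open>2 \<Phi>(h) - \<Phi>(h + s u) - \<Phi>(h - s u)\<close>, the covariance function of the increments of the random field;
  dividing by \<open>s^2\<close> and letting \<open>s\<close> tend to 0 shows that minus the second derivative is one as well.
  This is \<open>T3_stationary_covariance\<close>, and it reduces each model to two tasks: \<open>\<phi>(|h|)\<close> is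
  positive semidefinite, and \<open>\<phi>(t) = g(t^2)\<close> with \<open>g\<close> differentiable up to 0 and twice
  differentiable beyond.

  The Cauchy and Matern models are mixtures of the Gaussian kernels \<open>exp(- w |h|^2)\<close>. For the
  Matern model the substitution \<open>w = (t/2) e^s\<close> in the hyperbolic integral of \<open>K_\<nu>\<close> exhibits the mixture
  (\<open>matern_eq\<close>), and smoothness is differentiation under the integral sign; \<open>\<nu> > 1\<close> is what makes
  the derivative of \<open>g\<close> finite at 0.

  Let \<open>x = \<beta> - \<alpha>\<close> and \<open>y = \<gamma> - \<alpha>\<close>. The hypergeometric model is a series in powers of \<open>(1 - |h|^2)_+\<close>
  with positive coefficients. Its moments follow from the Gaussian ones, because
  \<open>exp(- |h|^2)\<close> is a mixture of rescaled powers \<open>(s - |h|^2)_+^l\<close>; after summing the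
  series they involve \<open>2F1(x, y; C; 1)\<close>, for which a contiguous relation in \<open>C\<close> suffices. Thus the Fourier
  transform is a nonnegative multiple of \<open>1F2(\<alpha>; \<beta>, \<gamma>; - |\<xi>|^2 / 4)\<close>, and a continuous integrable
  function with nonnegative Fourier transform is positive semidefinite
  (\<open>stationary_covariance_Fourier\<close>, by smoothing with narrow Gaussians).

  There remains \<open>hyp1F2_nonneg\<close>. Following Gasper, \<open>1F2(\<alpha>; \<beta>, \<gamma>; - T/4)\<close> is expanded in
  the squares \<open>T^n 0F1(\<nu> + n + 1; - T/16)^2\<close>, which are squares of Bessel functions up to powers of \<open>T\<close>.
  With \<open>2 \<nu> = x + y + \<alpha> - 3/2\<close> the coefficients are positive multiples of balanced terminating \<open>4F3\<close> series
  \<open>S_n\<close>, that is, of Wilson polynomials, which satisfy a three-term recurrence in \<open>n\<close>. The combination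
  \<open>D_n = (n + \<beta>) (n + \<gamma>) S_{n+1} - (n + x - 1/2) (n + y - 1/2) S_n\<close> turns this recurrence into
  \<open>(n + 2 \<nu>) D_n = n D_{n-1} + 2 (n + \<nu>) (\<nu> + 1/2 - \<alpha>) S_n\<close>. Now \<open>\<nu> + 1/2 - \<alpha>\<close> is nonnegative exactly
  when \<open>2 (\<beta> + \<gamma>)\<close> is at least \<open>6 \<alpha> + 1\<close>, and \<open>S_1\<close> is nonnegative exactly when \<open>2 x y\<close> is at least \<open>\<alpha>\<close>;
  for \<open>n > 0\<close> the factors in front of \<open>S_n\<close> are positive. Hence all \<open>S_n\<close> are nonnegative by induction.
\<close>

section \<open>Stationary covariance functions\<close>

lemma exp_sums_real: "(\<lambda>n. t ^ n / fact n) sums exp (t::real)"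
  using exp_converges[of t] by (simp only: real_scaleR_def divide_inverse_commute[symmetric])

lemma stationary_covariance_even: "stationary_covariance C \<Longrightarrow> C (- h) = C h"
  by (simp add: stationary_covariance_def)

text \<open>Positive semidefiniteness in a form that allows any finite index set, so that sites can be doubled.\<close>

lemma stationary_covariance_finite_sum:
  assumes C: "stationary_covariance C" and I: "finite I"
  shows "(\<Sum>i\<in>I. \<Sum>j\<in>I. v i * v j * C (x i - x j)) \<ge> 0"
proof -
  obtain \<sigma> where \<sigma>: "bij_betw \<sigma> {..<card I} I"
    using ex_bij_betw_nat_finite[OF I] by (auto simp: atLeast0LessThan)
  have "(\<Sum>i\<in>I. \<Sum>j\<in>I. v i * v j * C (x i - x j))
      = (\<Sum>i<card I. \<Sum>j<card I. v (\<sigma> i) * v (\<sigma> j) * C (x (\<sigma> i) - x (\<sigma> j)))"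
    by (simp add: sum.reindex_bij_betw[OF \<sigma>, symmetric])
  also have "\<dots> \<ge> 0" using C unfolding stationary_covariance_def by (elim conjE allE[of _ "card I"] allE[of _ "v \<circ> \<sigma>"] allE[of _ "x \<circ> \<sigma>"]) simp
  finally show ?thesis .
qed

lemma stationary_covariance_add:
  assumes "stationary_covariance C" "stationary_covariance D" "c \<ge> 0" "d \<ge> 0"
  shows "stationary_covariance (\<lambda>h. c * C h + d * D h)"
  unfolding stationary_covariance_def
proof (intro conjI allI)
  show "c * C (- h) + d * D (- h) = c * C h + d * D h" for h
    using assms by (simp add: stationary_covariance_even)
  fix n :: nat and v :: "nat \<Rightarrow> real" and x :: "nat \<Rightarrow> 'a"
  have "(\<Sum>i<n. \<Sum>j<n. v i * v j * (c * C (x i - x j) + d * D (x i - x j)))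
     = c * (\<Sum>i<n. \<Sum>j<n. v i * v j * C (x i - x j)) + d * (\<Sum>i<n. \<Sum>j<n. v i * v j * D (x i - x j))"
    by (simp add: sum_distrib_left sum.distrib[symmetric] algebra_simps)
  also have "\<dots> \<ge> 0" using assms unfolding stationary_covariance_def by (intro add_nonneg_nonneg mult_nonneg_nonneg) auto
  finally show "(\<Sum>i<n. \<Sum>j<n. v i * v j * (c * C (x i - x j) + d * D (x i - x j))) \<ge> 0" .
qed

lemma stationary_covariance_cmult: "stationary_covariance C \<Longrightarrow> c \<ge> 0 \<Longrightarrow> stationary_covariance (\<lambda>h. c * C h)"
  using stationary_covariance_add[of C C c 0] by simp

lemma stationary_covariance_scale:
  assumes "stationary_covariance C"
  shows "stationary_covariance (\<lambda>h. C (s *\<^sub>R h))"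
  unfolding stationary_covariance_def
proof (intro conjI allI)
  show "C (s *\<^sub>R - h) = C (s *\<^sub>R h)" for h using stationary_covariance_even[OF assms] by simp
  show "(\<Sum>i<n. \<Sum>j<n. v i * v j * C (s *\<^sub>R (x i - x j))) \<ge> 0"
    for n :: nat and v :: "nat \<Rightarrow> real" and x :: "nat \<Rightarrow> 'a"
    using stationary_covariance_finite_sum[OF assms finite_lessThan[of n], of v "\<lambda>i. s *\<^sub>R x i"] by (simp add: scaleR_diff_right)
qed

lemma stationary_covariance_limit:
  assumes "\<And>k::nat. stationary_covariance (C k)" and lim: "\<And>h. (\<lambda>k. C k h) \<longlonglongrightarrow> D h"
  shows "stationary_covariance D"
  unfolding stationary_covariance_def
proof (intro conjI allI)
  fix h
  have "(\<lambda>k. C k (- h)) \<longlonglongrightarrow> D h" using lim[of h] assms(1) by (simp add: stationary_covariance_even)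
  then show "D (- h) = D h" using LIMSEQ_unique lim by blast
next
  fix n :: nat and v :: "nat \<Rightarrow> real" and x :: "nat \<Rightarrow> 'a"
  have "(\<lambda>k. \<Sum>i<n. \<Sum>j<n. v i * v j * C k (x i - x j)) \<longlonglongrightarrow> (\<Sum>i<n. \<Sum>j<n. v i * v j * D (x i - x j))"
    by (intro tendsto_intros lim)
  then show "(\<Sum>i<n. \<Sum>j<n. v i * v j * D (x i - x j)) \<ge> 0"
    by (rule LIMSEQ_le_const) (use assms(1) in \<open>auto simp: stationary_covariance_def\<close>)
qed

lemma stationary_covariance_mixture:
  fixes K :: "'w \<Rightarrow> 'a::euclidean_space \<Rightarrow> real"
  assumes K: "\<And>w. w \<in> space M \<Longrightarrow> stationary_covariance (K w)"
    and int: "\<And>h. integrable M (\<lambda>w. K w h)"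
  shows "stationary_covariance (\<lambda>h. \<integral>w. K w h \<partial>M)"
  unfolding stationary_covariance_def
proof (intro conjI allI)
  show "(\<integral>w. K w (- h) \<partial>M) = (\<integral>w. K w h \<partial>M)" for h
    by (intro Bochner_Integration.integral_cong refl stationary_covariance_even K)
  fix n :: nat and v :: "nat \<Rightarrow> real" and x :: "nat \<Rightarrow> 'a"
  have "(\<Sum>i<n. \<Sum>j<n. v i * v j * (\<integral>w. K w (x i - x j) \<partial>M))
    = (\<integral>w. (\<Sum>i<n. \<Sum>j<n. v i * v j * K w (x i - x j)) \<partial>M)"
    by (simp add: int)
  also have "\<dots> \<ge> 0"
    by (intro Bochner_Integration.integral_nonneg) (use K in \<open>auto simp: stationary_covariance_def\<close>)
  finally show "(\<Sum>i<n. \<Sum>j<n. v i * v j * (\<integral>w. K w (x i - x j) \<partial>M)) \<ge> 0" .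
qed

text \<open>
  The increments of a field over the step \<open>e\<close> have this covariance: each site \<open>x i\<close> is replaced by the two sites
  \<open>x i\<close> and \<open>x i + e\<close>, with the weights \<open>v i\<close> and \<open>- v i\<close>.
\<close>

lemma stationary_covariance_second_difference:
  fixes C :: "'a::euclidean_space \<Rightarrow> real"
  assumes C: "stationary_covariance C"
  shows "stationary_covariance (\<lambda>h. 2 * C h - C (h + e) - C (h - e))"
  unfolding stationary_covariance_def
proof (intro conjI allI)
  fix h
  have "C (- h + e) = C (h - e)" "C (- h - e) = C (h + e)"
    using stationary_covariance_even[OF C, of "h - e"] stationary_covariance_even[OF C, of "h + e"] by simp_all
  then show "2 * C (- h) - C (- h + e) - C (- h - e) = 2 * C h - C (h + e) - C (h - e)"
    using stationary_covariance_even[OF C] by simp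
next
  fix n :: nat and v :: "nat \<Rightarrow> real" and x :: "nat \<Rightarrow> 'a"
  \<comment> \<open>the Boolean component marks the shifted copy of a site\<close>
  define V where "V p = (if snd p then - v (fst p) else v (fst p))" for p :: "nat \<times> bool"
  define X where "X p = (if snd p then x (fst p) + e else x (fst p))" for p :: "nat \<times> bool"
  have "0 \<le> (\<Sum>p\<in>{..<n}\<times>UNIV. \<Sum>q\<in>{..<n}\<times>UNIV. V p * V q * C (X p - X q))"
    by (rule stationary_covariance_finite_sum[OF C]) simp
  also have "\<dots> = (\<Sum>i<n. \<Sum>j<n. v i * v j * (2 * C (x i - x j) - C (x i - x j + e) - C (x i - x j - e)))"
  proof -
    have split: "(\<Sum>p\<in>{..<n}\<times>UNIV. F p) = (\<Sum>i<n. F (i, False) + F (i, True))" for F :: "nat \<times> bool \<Rightarrow> real"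
      by (simp add: sum.cartesian_product' UNIV_bool)
    have shift: "x i + e - (x j + e) = x i - x j" "x i - (x j + e) = x i - x j - e" "x i + e - x j = x i - x j + e" for i j
      by (simp_all add: algebra_simps)
    show ?thesis unfolding split sum.distrib[symmetric] V_def X_def
      by (simp add: shift algebra_simps)
  qed
  finally show "(\<Sum>i<n. \<Sum>j<n. v i * v j * (2 * C (x i - x j) - C (x i - x j + e) - C (x i - x j - e))) \<ge> 0" .
qed

text \<open>
  Each factor \<open>x i \<bullet> x j\<close> is a sum over coordinates of products, so that one factor can be absorbed
  into the weights; the weights are therefore generalised in the induction.
\<close>

lemma sum_inner_power_nonneg:
  fixes x :: "nat \<Rightarrow> 'a::euclidean_space"
  shows "(\<Sum>i<n. \<Sum>j<n. v i * v j * (x i \<bullet> x j) ^ k) \<ge> 0"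
proof (induction k arbitrary: v)
  case 0
  have "(\<Sum>i<n. \<Sum>j<n. v i * v j * (x i \<bullet> x j) ^ 0) = (\<Sum>i<n. v i)\<^sup>2"
    by (simp add: power2_eq_square sum_product)
  then show ?case by simp
next
  case (Suc k)
  have "(\<Sum>i<n. \<Sum>j<n. v i * v j * (x i \<bullet> x j) ^ Suc k)
     = (\<Sum>i<n. \<Sum>j<n. \<Sum>b\<in>Basis. (v i * (x i \<bullet> b)) * (v j * (x j \<bullet> b)) * (x i \<bullet> x j) ^ k)"
  proof (intro sum.cong refl)
    fix i j
    have "(x i \<bullet> x j) ^ Suc k = (\<Sum>b\<in>Basis. (x i \<bullet> b) * (x j \<bullet> b)) * (x i \<bullet> x j) ^ k"
      by (simp add: euclidean_inner[of "x i" "x j"])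
    then show "v i * v j * (x i \<bullet> x j) ^ Suc k = (\<Sum>b\<in>Basis. (v i * (x i \<bullet> b)) * (v j * (x j \<bullet> b)) * (x i \<bullet> x j) ^ k)"
      by (simp add: sum_distrib_left sum_distrib_right mult_ac)
  qed
  also have "\<dots> = (\<Sum>b\<in>Basis. \<Sum>i<n. \<Sum>j<n. (v i * (x i \<bullet> b)) * (v j * (x j \<bullet> b)) * (x i \<bullet> x j) ^ k)"
    by (subst (2) sum.swap, subst sum.swap) (rule refl)
  also have "\<dots> \<ge> 0" by (intro sum_nonneg Suc.IH)
  finally show ?case .
qed

text \<open>
  Up to the factors \<open>exp (- w |x i|^2)\<close>, which are absorbed into the weights, the kernel is
  \<open>exp (2 w (x i \<bullet> x j))\<close>, a power series in the inner product with nonnegative coefficients.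
\<close>

lemma stationary_covariance_gauss:
  assumes w: "w \<ge> 0"
  shows "stationary_covariance (\<lambda>h::'a::euclidean_space. exp (- w * (norm h)\<^sup>2))"
  unfolding stationary_covariance_def
proof (intro conjI allI)
  show "exp (- w * (norm (- h))\<^sup>2) = exp (- w * (norm h)\<^sup>2)" for h :: 'a by simp
  fix n :: nat and v :: "nat \<Rightarrow> real" and x :: "nat \<Rightarrow> 'a"
  define V where "V i = v i * exp (- w * (norm (x i))\<^sup>2)" for i
  have eq: "v i * v j * exp (- w * (norm (x i - x j))\<^sup>2) = V i * V j * exp (2 * w * (x i \<bullet> x j))" for i j
  proof -
    have "- w * (norm (x i - x j))\<^sup>2 = - w * (norm (x i))\<^sup>2 + - w * (norm (x j))\<^sup>2 + 2 * w * (x i \<bullet> x j)"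
      by (simp add: power2_norm_eq_inner inner_diff inner_commute algebra_simps)
    then show ?thesis by (simp only: exp_add V_def) (simp add: mult_ac)
  qed
  have S: "(\<lambda>k. \<Sum>i<n. \<Sum>j<n. V i * V j * ((2 * w * (x i \<bullet> x j)) ^ k /\<^sub>R fact k)) sums
      (\<Sum>i<n. \<Sum>j<n. V i * V j * exp (2 * w * (x i \<bullet> x j)))"
    by (intro sums_sum sums_mult exp_converges)
  have P: "0 \<le> (\<Sum>i<n. \<Sum>j<n. V i * V j * ((2 * w * (x i \<bullet> x j)) ^ k /\<^sub>R fact k))" for k
  proof -
    have "(\<Sum>i<n. \<Sum>j<n. V i * V j * ((2 * w * (x i \<bullet> x j)) ^ k /\<^sub>R fact k))
       = (2 * w) ^ k / fact k * (\<Sum>i<n. \<Sum>j<n. V i * V j * (x i \<bullet> x j) ^ k)"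
      unfolding sum_distrib_left by (intro sum.cong refl) (simp only: power_mult_distrib real_scaleR_def divide_inverse mult_ac)
    also have "\<dots> \<ge> 0" using w by (intro mult_nonneg_nonneg sum_inner_power_nonneg) auto
    finally show ?thesis .
  qed
  have "(\<Sum>i<n. \<Sum>j<n. V i * V j * exp (2 * w * (x i \<bullet> x j))) \<ge> 0"
    by (rule sums_le[OF P sums_zero S])
  then show "(\<Sum>i<n. \<Sum>j<n. v i * v j * exp (- w * (norm (x i - x j))\<^sup>2)) \<ge> 0" by (simp only: eq)
qed

text \<open>
  One application of l'Hospital's rule leaves a symmetric difference quotient of \<open>f'\<close>, which the
  differentiability of \<open>f'\<close> at the single point 0 controls.
\<close>

lemma symmetric_second_difference:
  fixes f :: "real \<Rightarrow> real"
  assumes f: "\<And>s. (f has_real_derivative f' s) (at s)" and f': "(f' has_real_derivative L) (at 0)"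
  shows "((\<lambda>s. (2 * f 0 - f s - f (- s)) / s\<^sup>2) \<longlongrightarrow> - L) (at_right 0)"
proof (rule lhopital_right_0[where f' = "\<lambda>s. - f' s + f' (- s)" and g' = "\<lambda>s. 2 * s"])
  have cf: "isCont f s" for s using f by (rule DERIV_isCont)
  have "((\<lambda>s. 2 * f 0 - f s - f (- s)) \<longlongrightarrow> 2 * f 0 - f 0 - f (- 0)) (at_right 0)"
    by (intro tendsto_intros isCont_tendsto_compose[OF cf]) 
  then show "((\<lambda>s. 2 * f 0 - f s - f (- s)) \<longlongrightarrow> 0) (at_right 0)" by simp
  have "((\<lambda>s::real. s\<^sup>2) \<longlongrightarrow> 0\<^sup>2) (at_right 0)" by (intro tendsto_intros)
  then show "((\<lambda>s::real. s\<^sup>2) \<longlongrightarrow> 0) (at_right 0)" by simp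
  show "\<forall>\<^sub>F s in at_right 0. s\<^sup>2 \<noteq> (0::real)" "\<forall>\<^sub>F s in at_right 0. 2 * s \<noteq> (0::real)"
    by (auto simp: eventually_at_filter)
  have "((\<lambda>s. 2 * f 0 - f s - f (- s)) has_real_derivative - f' s + f' (- s)) (at s)" for s
  proof -
    have "(uminus has_real_derivative -1) (at s)" by (auto intro!: derivative_eq_intros)
    from DERIV_chain2[OF f[of "- s"] this] have g: "((\<lambda>s. f (- s)) has_real_derivative - f' (- s)) (at s)" by simp
    show ?thesis by (rule DERIV_cong[OF DERIV_diff[OF DERIV_diff[OF DERIV_const f] g]]) simp
  qed
  then show "\<forall>\<^sub>F s in at_right 0. ((\<lambda>s. 2 * f 0 - f s - f (- s)) has_real_derivative - f' s + f' (- s)) (at s)"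
    by simp
  show "\<forall>\<^sub>F s in at_right 0. ((\<lambda>s. s\<^sup>2) has_real_derivative 2 * s) (at s)"
    by (intro always_eventually allI) (auto intro!: derivative_eq_intros)
  have d: "((\<lambda>s. (f' s - f' 0) / s) \<longlongrightarrow> L) (at 0)"
    using f' by (simp add: has_field_derivative_iff)
  have d1: "((\<lambda>s. (f' s - f' 0) / s) \<longlongrightarrow> L) (at_right 0)"
    by (rule tendsto_mono[OF at_le d]) simp
  have "filterlim (\<lambda>s::real. - s) (at 0) (at_right 0)"
    by (auto simp: filterlim_at eventually_at_filter intro!: tendsto_eq_intros)
  then have d2: "((\<lambda>s. (f' (- s) - f' 0) / (- s)) \<longlongrightarrow> L) (at_right 0)"
    by (rule filterlim_compose[OF d])
  have "((\<lambda>s. - (((f' s - f' 0) / s + (f' (- s) - f' 0) / (- s)) / 2)) \<longlongrightarrow> - ((L + L) / 2)) (at_right 0)"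
    by (intro tendsto_intros d1 d2) auto
  moreover have "- (((f' s - f' 0) / s + (f' (- s) - f' 0) / (- s)) / 2) = (- f' s + f' (- s)) / (2 * s)" for s
    by (cases "s = 0") (auto simp: field_simps)
  ultimately show "((\<lambda>s. (- f' s + f' (- s)) / (2 * s)) \<longlongrightarrow> - L) (at_right 0)" by simp
qed

section \<open>Second directional derivatives\<close>

lemma deriv_nonneg_eq:
  assumes "(\<phi> has_real_derivative d) (at t within {0..})" and "t \<ge> 0"
  shows "deriv_nonneg \<phi> t = d"
proof -
  have "at_right t \<le> at t within {0..}" using assms(2) by (intro at_le) auto
  then have "at t within {0..} \<noteq> bot" using trivial_limit_at_right_real[of t] le_bot by metis
  then show ?thesis
    unfolding deriv_nonneg_def using assms(1)
    by (simp add: has_real_derivative_iff_has_vector_derivative vector_derivative_within)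
qed

text \<open>
  The profile is described through \<open>g\<close> as a function of \<open>t^2\<close>, because \<open>|h + s u|^2\<close> is a polynomial in \<open>s\<close>: the
  second derivative in direction \<open>u\<close> is then the ordinary chain rule, also at the origin, where mere
  continuity of \<open>g'\<close> takes the place of a second derivative.
\<close>

theorem T3_stationary_covariance:
  fixes u :: "'a::euclidean_space"
  assumes a: "a1 > 0" "a2 > 0" and b: "b1 \<ge> 0" "b2 \<ge> 0" and u: "norm u = 1"
    and sc: "stationary_covariance (\<lambda>h::'a. g ((norm h)\<^sup>2))"
    and phi: "\<And>t. t \<ge> 0 \<Longrightarrow> \<phi> t = g (t\<^sup>2)"
    and g1: "\<And>\<tau>. \<tau> \<ge> 0 \<Longrightarrow> (g has_real_derivative g1 \<tau>) (at \<tau> within {0..})"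
    and g2: "\<And>\<tau>. \<tau> > 0 \<Longrightarrow> (g1 has_real_derivative g2 \<tau>) (at \<tau>)"
    and cont: "continuous (at 0 within {0..}) g1"
  shows "stationary_covariance (T3 a1 a2 b1 b2 u \<phi>)"
proof -
  have d1: "(\<phi> has_real_derivative 2 * t * g1 (t\<^sup>2)) (at t within {0..})" if t: "t \<ge> 0" for t
  proof -
    have "((\<lambda>t. t\<^sup>2) has_real_derivative 2 * t) (at t within {0..})"
      by (auto intro!: derivative_eq_intros)
    moreover have "(g has_real_derivative g1 (t\<^sup>2)) (at (t\<^sup>2) within (\<lambda>t. t\<^sup>2) ` {0..})"
      by (rule DERIV_subset[OF g1]) auto
    ultimately have "((\<lambda>t. g (t\<^sup>2)) has_real_derivative g1 (t\<^sup>2) * (2 * t)) (at t within {0..})"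
      by (rule DERIV_image_chain[unfolded o_def, rotated])
    then have "(\<phi> has_real_derivative g1 (t\<^sup>2) * (2 * t)) (at t within {0..})"
      by (rule has_field_derivative_transform_within[where d = 1]) (use t in \<open>simp_all add: phi\<close>)
    then show ?thesis by (simp add: mult_ac)
  qed
  then have D1: "deriv_nonneg \<phi> t = 2 * t * g1 (t\<^sup>2)" if "t \<ge> 0" for t
    using deriv_nonneg_eq that by blast
  have D2: "deriv_nonneg (deriv_nonneg \<phi>) t = 2 * g1 (t\<^sup>2) + 4 * t\<^sup>2 * g2 (t\<^sup>2)" if t: "t > 0" for t
  proof (rule deriv_nonneg_eq)
    have "((\<lambda>t. t\<^sup>2) has_real_derivative 2 * t) (at t)"
      by (auto intro!: derivative_eq_intros)
    from DERIV_chain2[OF g2 this] t have c: "((\<lambda>t. g1 (t\<^sup>2)) has_real_derivative g2 (t\<^sup>2) * (2 * t)) (at t)" by simp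
    have "((\<lambda>t. 2 * t) has_real_derivative 2) (at t)" by (auto intro!: derivative_eq_intros)
    from DERIV_mult'[OF this c]
    have "((\<lambda>t. 2 * t * g1 (t\<^sup>2)) has_real_derivative 2 * g1 (t\<^sup>2) + 4 * t\<^sup>2 * g2 (t\<^sup>2)) (at t)"
      by (rule DERIV_cong) (simp add: power2_eq_square)
    then have "((\<lambda>t. 2 * t * g1 (t\<^sup>2)) has_real_derivative 2 * g1 (t\<^sup>2) + 4 * t\<^sup>2 * g2 (t\<^sup>2)) (at t within {0..})"
      by (rule has_field_derivative_at_within)
    then show "(deriv_nonneg \<phi> has_real_derivative 2 * g1 (t\<^sup>2) + 4 * t\<^sup>2 * g2 (t\<^sup>2)) (at t within {0..})"
      by (rule has_field_derivative_transform_within[where d = 1]) (use t in \<open>simp_all add: D1\<close>)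
  qed (use t in simp)
  have sq0: "((\<lambda>t. t\<^sup>2) \<longlongrightarrow> (0::real)) (at 0)" by (auto intro!: tendsto_eq_intros)
  have g1_sq: "((\<lambda>t. g1 (c * t\<^sup>2)) \<longlongrightarrow> g1 0) (at 0)" if "c > 0" for c
  proof -
    have "((\<lambda>t. c * t\<^sup>2) \<longlongrightarrow> c * 0) (at 0)" by (intro tendsto_intros sq0)
    then have "filterlim (\<lambda>t. c * t\<^sup>2) (at 0 within {0..}) (at 0)"
      using that by (auto simp: filterlim_at eventually_at_filter)
    moreover have "(g1 \<longlongrightarrow> g1 0) (at 0 within {0..})" using cont by (simp add: continuous_within)
    ultimately show ?thesis by (rule filterlim_compose[rotated])
  qed
  have D20: "deriv_nonneg (deriv_nonneg \<phi>) 0 = 2 * g1 0"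
  proof (rule deriv_nonneg_eq)
    have "((\<lambda>t. 2 * g1 (1 * t\<^sup>2)) \<longlongrightarrow> 2 * g1 0) (at 0)" by (intro tendsto_intros g1_sq) simp
    moreover have "\<forall>\<^sub>F t in at 0. 2 * g1 (1 * t\<^sup>2) = (2 * t * g1 (t\<^sup>2) - 2 * 0 * g1 (0\<^sup>2)) / (t - 0)"
      by (auto simp: eventually_at_filter)
    ultimately have "((\<lambda>t. 2 * t * g1 (t\<^sup>2)) has_real_derivative 2 * g1 0) (at 0)"
      unfolding has_field_derivative_iff by (rule Lim_transform_eventually)
    then have "((\<lambda>t. 2 * t * g1 (t\<^sup>2)) has_real_derivative 2 * g1 0) (at 0 within {0..})"
      by (rule has_field_derivative_at_within)
    then show "(deriv_nonneg \<phi> has_real_derivative 2 * g1 0) (at 0 within {0..})"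
      by (rule has_field_derivative_transform_within[where d = 1]) (simp_all add: D1)
  qed simp
  define \<Phi> where "\<Phi> h = g (a2 * (norm h)\<^sup>2)" for h :: 'a
  \<comment> \<open>the bracket of \<open>T3\<close> at \<open>h\<close>; \<open>a2 * B h\<close> is the second derivative of \<open>\<Phi>\<close> at \<open>h\<close> in direction \<open>u\<close>\<close>
  define B where "B h = (if h = 0 then 2 * g1 0 else 2 * g1 (a2 * (norm h)\<^sup>2) + 4 * a2 * (h \<bullet> u)\<^sup>2 * g2 (a2 * (norm h)\<^sup>2))" for h :: 'a
  have T3_eq: "T3 a1 a2 b1 b2 u \<phi> h = b1 * g (a1 * (norm h)\<^sup>2) - b2 * B h" for h
  proof (cases "h = 0")
    case True
    then show ?thesis by (simp add: T3_def D20 B_def phi)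
  next
    case False
    define t where "t = sqrt a2 * norm h"
    define c where "c = (h \<bullet> u) / norm h"
    have t: "t > 0" using False a by (simp add: t_def)
    have t2: "t\<^sup>2 = a2 * (norm h)\<^sup>2" using a by (simp add: t_def power_mult_distrib)
    have "\<bar>c\<bar> \<le> 1" using Cauchy_Schwarz_ineq2[of h u] u False by (simp add: c_def divide_le_eq)
    then have "cos (vec_angle h u) = c" by (simp add: vec_angle_def u c_def cos_arccos_abs)
    moreover have "t\<^sup>2 * c\<^sup>2 = a2 * (h \<bullet> u)\<^sup>2" using False by (simp add: t2 c_def power_divide)
    ultimately have "(cos (vec_angle h u))\<^sup>2 * deriv_nonneg (deriv_nonneg \<phi>) t
        + (sin (vec_angle h u))\<^sup>2 * (deriv_nonneg \<phi> t / t) = B h"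
      using t False D2[OF t] D1[of t] unfolding B_def sin_squared_eq t2[symmetric]
      by (simp add: algebra_simps)
    then show ?thesis
      using False a by (simp add: T3_def t_def[symmetric] phi power_mult_distrib)
  qed
  have lim: "((\<lambda>s. (2 * \<Phi> h - \<Phi> (h + s *\<^sub>R u) - \<Phi> (h - s *\<^sub>R u)) / s\<^sup>2) \<longlongrightarrow> - (a2 * B h)) (at_right 0)" for h
  proof -
    \<comment> \<open>\<open>q s = a2 |h + s u|^2\<close>, expanded by means of \<open>|u| = 1\<close>\<close>
    define q where "q s = a2 * ((norm h)\<^sup>2 + 2 * s * (h \<bullet> u) + s\<^sup>2)" for s
    have q: "a2 * (norm (h + s *\<^sub>R u))\<^sup>2 = q s" for s
    proof -
      have "(norm (h + s *\<^sub>R u))\<^sup>2 = (norm h)\<^sup>2 + 2 * s * (h \<bullet> u) + s\<^sup>2 * (norm u)\<^sup>2"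
        unfolding power2_norm_eq_inner
        by (simp add: inner_add_left inner_add_right inner_commute[of u h] power2_eq_square[of s] algebra_simps)
      then show ?thesis by (simp add: q_def u)
    qed
    have q0: "q s \<ge> 0" for s using a q[of s, symmetric] by simp
    have qd: "(q has_real_derivative 2 * a2 * (h \<bullet> u + s)) (at s)" for s
      unfolding q_def by (auto intro!: derivative_eq_intros simp: algebra_simps)
    define f where "f s = g (q s)" for s
    define f' where "f' s = g1 (q s) * (2 * a2 * (h \<bullet> u + s))" for s
    have "(f has_real_derivative f' s) (at s)" for s
    proof -
      have "(g has_real_derivative g1 (q s)) (at (q s) within q ` UNIV)"
        by (rule DERIV_subset[OF g1]) (use q0 in auto)
      from DERIV_image_chain[OF this qd] show ?thesis by (simp add: f_def[abs_def] f'_def o_def)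
    qed
    moreover have "(f' has_real_derivative a2 * B h) (at 0)"
    proof (cases "h = 0")
      case True
      have "((\<lambda>s. 2 * a2 * g1 (a2 * s\<^sup>2)) \<longlongrightarrow> 2 * a2 * g1 0) (at 0)" using a by (intro tendsto_intros g1_sq)
      moreover have "\<forall>\<^sub>F s in at 0. 2 * a2 * g1 (a2 * s\<^sup>2) = (f' s - f' 0) / (s - 0)"
        using True by (auto simp: eventually_at_filter f'_def q_def)
      ultimately show ?thesis
        unfolding has_field_derivative_iff using True by (simp add: B_def Lim_transform_eventually mult_ac)
    next
      case False
      have "q 0 > 0" using a False by (simp add: q_def)
      note c = DERIV_chain2[OF g2[OF this] qd[of 0]]
      have "((\<lambda>s. 2 * a2 * (h \<bullet> u + s)) has_real_derivative 2 * a2) (at 0)"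
        by (auto intro!: derivative_eq_intros)
      from DERIV_mult'[OF c this]
      have "(f' has_real_derivative g1 (q 0) * (2 * a2) + g2 (q 0) * (2 * a2 * (h \<bullet> u + 0)) * (2 * a2 * (h \<bullet> u + 0))) (at 0)"
        unfolding f'_def[abs_def] .
      moreover have "q 0 = a2 * (norm h)\<^sup>2" by (simp add: q_def)
      ultimately show ?thesis using False by (simp add: B_def power2_eq_square algebra_simps)
    qed
    ultimately have "((\<lambda>s. (2 * f 0 - f s - f (- s)) / s\<^sup>2) \<longlongrightarrow> - (a2 * B h)) (at_right 0)"
      by (rule symmetric_second_difference)
    moreover have "f s = \<Phi> (h + s *\<^sub>R u)" for s by (simp add: f_def \<Phi>_def q)
    ultimately show ?thesis by simp
  qed
  have scale: "stationary_covariance (\<lambda>h::'a. g (c * (norm h)\<^sup>2))" if "c > 0" for c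
    using stationary_covariance_scale[OF sc, of "sqrt c"] that by (simp add: power_mult_distrib)
  define s where "s k = 1 / real (Suc k)" for k
  have s: "filterlim s (at_right 0) sequentially"
    unfolding s_def filterlim_at using LIMSEQ_inverse_real_of_nat by (auto simp: inverse_eq_divide)
  define C where "C k h = b1 * g (a1 * (norm h)\<^sup>2)
     + b2 / (a2 * (s k)\<^sup>2) * (2 * \<Phi> h - \<Phi> (h + s k *\<^sub>R u) - \<Phi> (h - s k *\<^sub>R u))" for k h
  have "stationary_covariance (C k)" for k
    unfolding C_def using a b
    by (intro stationary_covariance_add scale stationary_covariance_second_difference) (auto simp: \<Phi>_def[abs_def] scale)
  moreover have "(\<lambda>k. C k h) \<longlonglongrightarrow> T3 a1 a2 b1 b2 u \<phi> h" for h
  proof -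
    have "(\<lambda>k. b1 * g (a1 * (norm h)\<^sup>2) + b2 / a2 * ((2 * \<Phi> h - \<Phi> (h + s k *\<^sub>R u) - \<Phi> (h - s k *\<^sub>R u)) / (s k)\<^sup>2))
        \<longlonglongrightarrow> b1 * g (a1 * (norm h)\<^sup>2) + b2 / a2 * - (a2 * B h)"
      by (intro tendsto_intros filterlim_compose[OF lim s])
    then show ?thesis using a by (simp add: T3_eq C_def)
  qed
  ultimately show ?thesis by (rule stationary_covariance_limit)
qed

section \<open>The Cauchy model\<close>

lemma Gamma_bochner_integral:
  assumes "s > (0::real)"
  shows "has_bochner_integral lborel (\<lambda>t. indicator {0<..} t * t powr (s - 1) * exp (- t)) (Gamma s)"
proof -
  have "has_bochner_integral lborel (\<lambda>t. indicator {0..} t * t powr (s - 1) / exp t) (Gamma s)"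
    by (rule has_bochner_integral_nn_integral)
       (use assms Gamma_conv_nn_integral_real[OF assms] in \<open>auto intro!: borel_measurable_times\<close>)
  moreover have "(\<lambda>t. indicator {0..} t * t powr (s - 1) / exp t) = (\<lambda>t. indicator {0<..} t * t powr (s - 1) * exp (- t))"
    by (auto simp: indicator_def exp_minus field_simps)
  ultimately show ?thesis by simp
qed

lemma Gamma_bochner_integral_scaled:
  assumes s: "s > (0::real)" and c: "c > 0"
  shows "has_bochner_integral lborel (\<lambda>t. indicator {0<..} t * t powr (s - 1) * exp (- (c * t))) (Gamma s * c powr (- s))"
proof -
  have "has_bochner_integral lborel (\<lambda>t. indicator {0<..} (0 + c * t) * (0 + c * t) powr (s - 1) * exp (- (0 + c * t))) (Gamma s /\<^sub>R \<bar>c\<bar>)"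
    using Gamma_bochner_integral[OF s] c by (subst lborel_has_bochner_integral_real_affine_iff[symmetric]) auto
  then have A: "has_bochner_integral lborel (\<lambda>t. c powr (1 - s) * (indicator {0<..} (0 + c * t) * (0 + c * t) powr (s - 1) * exp (- (0 + c * t)))) (c powr (1 - s) * (Gamma s /\<^sub>R \<bar>c\<bar>))"
    by (rule has_bochner_integral_mult_right)
  have B: "(\<lambda>t. c powr (1 - s) * (indicator {0<..} (0 + c * t) * (0 + c * t) powr (s - 1) * exp (- (0 + c * t))))
      = (\<lambda>t. indicator {0<..} t * t powr (s - 1) * exp (- (c * t)))"
  proof
    fix t
    have "c powr (1 - s) * c powr (s - 1) = 1" using c by (simp flip: powr_add)
    then show "c powr (1 - s) * (indicator {0<..} (0 + c * t) * (0 + c * t) powr (s - 1) * exp (- (0 + c * t)))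
        = indicator {0<..} t * t powr (s - 1) * exp (- (c * t))"
      using c by (auto simp: indicator_def powr_mult zero_less_mult_iff)
  qed
  have C: "c powr (1 - s) * (Gamma s /\<^sub>R \<bar>c\<bar>) = Gamma s * c powr (- s)"
    using c by (simp add: powr_diff powr_minus field_simps)
  show ?thesis using A unfolding B C .
qed

text \<open>
  A Gamma mixture of Gaussian kernels: \<open>(1 + r)^{-\<delta>}\<close> is the integral of
  \<open>w^{\<delta>-1} exp (- (1 + r) w)\<close> divided by \<open>\<Gamma>(\<delta>)\<close>.
\<close>

lemma stationary_covariance_cauchy:
  assumes d: "\<delta> > 0"
  shows "stationary_covariance (\<lambda>h::'a::euclidean_space. (1 + (norm h)\<^sup>2) powr (- \<delta>))"
proof -
  define K where "K w h = indicator {0<..} w * w powr (\<delta> - 1) * exp (- ((1 + (norm h)\<^sup>2) * w))" for w and h :: 'a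
  have int: "has_bochner_integral lborel (\<lambda>w. K w h) (Gamma \<delta> * (1 + (norm h)\<^sup>2) powr (- \<delta>))" for h
    unfolding K_def by (rule Gamma_bochner_integral_scaled[OF d]) (simp add: add_pos_nonneg)
  have "stationary_covariance (K w)" for w
  proof (cases "w > 0")
    case True
    have "K w = (\<lambda>h. w powr (\<delta> - 1) * exp (- w) * exp (- w * (norm h)\<^sup>2))"
      using True by (auto simp: K_def fun_eq_iff algebra_simps simp flip: exp_add)
    then show ?thesis using True stationary_covariance_gauss[of w] by (auto intro!: stationary_covariance_cmult)
  next
    case False
    then have "K w = (\<lambda>h. 0)" by (auto simp: K_def)
    then show ?thesis by (simp add: stationary_covariance_def)
  qed
  then have "stationary_covariance (\<lambda>h. \<integral>w. K w h \<partial>lborel)"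
    by (rule stationary_covariance_mixture) (use int in \<open>auto simp: has_bochner_integral_iff\<close>)
  then have "stationary_covariance (\<lambda>h::'a. Gamma \<delta> * (1 + (norm h)\<^sup>2) powr (- \<delta>))"
    using int by (simp add: has_bochner_integral_iff)
  from stationary_covariance_cmult[OF this, of "1 / Gamma \<delta>"] show ?thesis
    using Gamma_real_pos[OF d] by simp
qed

theorem T3_cauchy:
  fixes u :: "'a::euclidean_space"
  assumes "a1 > 0" "a2 > 0" "b1 \<ge> 0" "b2 \<ge> 0" "norm u = 1" and d: "\<delta> > 0"
  shows "stationary_covariance (T3 a1 a2 b1 b2 u (cauchy_model \<delta>))"
proof (rule T3_stationary_covariance[where g = "\<lambda>\<tau>. (1 + \<tau>) powr (- \<delta>)"
      and ?g1.0 = "\<lambda>\<tau>. - \<delta> * (1 + \<tau>) powr (- \<delta> - 1)" and ?g2.0 = "\<lambda>\<tau>. - \<delta> * ((- \<delta> - 1) * (1 + \<tau>) powr (- \<delta> - 1 - 1))"])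
  have D: "((\<lambda>\<tau>. (1 + \<tau>) powr p) has_real_derivative p * (1 + \<tau>) powr (p - 1)) (at \<tau>)" if "\<tau> \<ge> 0" for \<tau> p :: real
    using that by (auto intro!: derivative_eq_intros)
  show "((\<lambda>\<tau>. (1 + \<tau>) powr (- \<delta>)) has_real_derivative - \<delta> * (1 + \<tau>) powr (- \<delta> - 1)) (at \<tau> within {0..})" if "\<tau> \<ge> 0" for \<tau>
    using D[OF that, of "- \<delta>"] by (rule has_field_derivative_at_within)
  have D1: "((\<lambda>\<tau>. - \<delta> * (1 + \<tau>) powr (- \<delta> - 1)) has_real_derivative - \<delta> * ((- \<delta> - 1) * (1 + \<tau>) powr (- \<delta> - 1 - 1))) (at \<tau>)"
    if "\<tau> \<ge> 0" for \<tau>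
    using DERIV_cmult[OF D[OF that, of "- \<delta> - 1"], of "- \<delta>"] .
  show "((\<lambda>\<tau>. - \<delta> * (1 + \<tau>) powr (- \<delta> - 1)) has_real_derivative - \<delta> * ((- \<delta> - 1) * (1 + \<tau>) powr (- \<delta> - 1 - 1))) (at \<tau>)"
    if "\<tau> > 0" for \<tau> using D1 that by simp
  show "continuous (at 0 within {0..}) (\<lambda>\<tau>. - \<delta> * (1 + \<tau>) powr (- \<delta> - 1))"
    by (rule continuous_at_imp_continuous_at_within[OF DERIV_isCont[OF D1]]) simp
  show "cauchy_model \<delta> t = (1 + t\<^sup>2) powr (- \<delta>)" for t by (simp add: cauchy_model_def add.commute)
  show "stationary_covariance (\<lambda>h::'a. (1 + (norm h)\<^sup>2) powr (- \<delta>))" by (rule stationary_covariance_cauchy[OF d])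
qed (fact assms)+

lemma laplace_integrable_mono:
  fixes k p :: "'w \<Rightarrow> real"
  assumes "integrable M (\<lambda>w. k w * exp (- \<tau>0 * p w))" and [measurable]: "k \<in> borel_measurable M" "p \<in> borel_measurable M"
    and "\<And>w. k w \<ge> 0" "\<And>w. p w \<ge> 0" and "\<tau> \<ge> \<tau>0"
  shows "integrable M (\<lambda>w. k w * exp (- \<tau> * p w))"
proof (rule Bochner_Integration.integrable_bound[OF assms(1)])
  show "AE w in M. norm (k w * exp (- \<tau> * p w)) \<le> norm (k w * exp (- \<tau>0 * p w))"
    by (rule AE_I2) (use assms in \<open>auto simp: abs_mult intro!: mult_left_mono mult_right_mono\<close>)
qed simp

lemma laplace_continuous:
  fixes k p :: "'w \<Rightarrow> real"
  assumes int: "integrable M (\<lambda>w. k w * exp (- \<tau>0 * p w))" and [measurable]: "k \<in> borel_measurable M" "p \<in> borel_measurable M"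
    and k: "\<And>w. k w \<ge> 0" and p: "\<And>w. p w \<ge> 0" and "\<tau> \<ge> \<tau>0"
  shows "continuous (at \<tau> within {\<tau>0..}) (\<lambda>\<tau>. \<integral>w. k w * exp (- \<tau> * p w) \<partial>M)"
  unfolding continuous_within tendsto_at_iff_sequentially
proof (intro allI impI)
  fix X assume X: "\<forall>i. X i \<in> {\<tau>0..} - {\<tau>}" "X \<longlonglongrightarrow> \<tau>"
  have "(\<lambda>i. \<integral>w. k w * exp (- X i * p w) \<partial>M) \<longlonglongrightarrow> (\<integral>w. k w * exp (- \<tau> * p w) \<partial>M)"
  proof (rule integral_dominated_convergence[OF _ _ int])
    show "AE w in M. (\<lambda>i. k w * exp (- X i * p w)) \<longlonglongrightarrow> k w * exp (- \<tau> * p w)"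
      by (intro AE_I2 tendsto_intros X)
    show "AE w in M. norm (k w * exp (- X i * p w)) \<le> k w * exp (- \<tau>0 * p w)" for i
      by (rule AE_I2) (use X k p in \<open>auto simp: abs_mult intro!: mult_left_mono mult_right_mono\<close>)
  qed simp_all
  then show "((\<lambda>\<tau>. \<integral>w. k w * exp (- \<tau> * p w) \<partial>M) \<circ> X) \<longlonglongrightarrow> (\<integral>w. k w * exp (- \<tau> * p w) \<partial>M)" by (simp add: o_def)
qed

text \<open>
  A bound on the difference quotient that does not depend on the second point; it dominates the limit in
  the next lemma.
\<close>

lemma exp_diff_quotient_bound:
  fixes s t p :: real
  assumes "s \<ge> \<tau>0" "t \<ge> \<tau>0" "s \<noteq> t" "p \<ge> 0"
  shows "\<bar>(exp (- s * p) - exp (- t * p)) / (s - t)\<bar> \<le> p * exp (- \<tau>0 * p)"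
proof -
  have main: "\<bar>(exp (- s * p) - exp (- t * p)) / (s - t)\<bar> \<le> p * exp (- \<tau>0 * p)" if "\<tau>0 \<le> s" "s < t" for s t
  proof -
    have "1 - exp (- ((t - s) * p)) \<le> (t - s) * p" using exp_ge_add_one_self[of "- ((t - s) * p)"] by simp
    then have "exp (- s * p) * (1 - exp (- ((t - s) * p))) \<le> exp (- \<tau>0 * p) * ((t - s) * p)"
      using that assms(4) by (intro mult_mono) (auto intro: mult_right_mono)
    moreover have "exp (- s * p) * (1 - exp (- ((t - s) * p))) = exp (- s * p) - exp (- t * p)"
      by (simp add: right_diff_distrib algebra_simps flip: exp_add)
    moreover have "exp (- t * p) \<le> exp (- s * p)" using that assms(4) by (simp add: mult_right_mono)
    ultimately show ?thesis using that by (simp add: abs_divide field_simps)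
  qed
  show ?thesis
  proof (cases "s < t")
    case True then show ?thesis using main assms by blast
  next
    case False
    then have "t < s" using assms by simp
    from main[OF assms(2) this] show ?thesis by (metis abs_divide abs_minus_commute)
  qed
qed

text \<open>Differentiation under the integral sign, including the one-sided derivative at \<open>\<tau>0\<close>, to the left of which the integral may diverge.\<close>

lemma laplace_derivative:
  fixes k p :: "'w \<Rightarrow> real"
  assumes int: "integrable M (\<lambda>w. k w * exp (- \<tau>0 * p w))" and int': "integrable M (\<lambda>w. k w * p w * exp (- \<tau>0 * p w))"
    and [measurable]: "k \<in> borel_measurable M" "p \<in> borel_measurable M"
    and k: "\<And>w. k w \<ge> 0" and p: "\<And>w. p w \<ge> 0" and t: "\<tau> \<ge> \<tau>0"
  shows "((\<lambda>\<tau>. \<integral>w. k w * exp (- \<tau> * p w) \<partial>M) has_real_derivative - (\<integral>w. k w * p w * exp (- \<tau> * p w) \<partial>M)) (at \<tau> within {\<tau>0..})"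
  unfolding has_field_derivative_iff tendsto_at_iff_sequentially
proof (intro allI impI)
  fix X assume X: "\<forall>i. X i \<in> {\<tau>0..} - {\<tau>}" "X \<longlonglongrightarrow> \<tau>"
  have I: "integrable M (\<lambda>w. k w * exp (- s * p w))" if "s \<ge> \<tau>0" for s
    using laplace_integrable_mono[OF int _ _ k p that] by simp
  have lim: "(\<lambda>i. \<integral>w. k w * ((exp (- X i * p w) - exp (- \<tau> * p w)) / (X i - \<tau>)) \<partial>M) \<longlonglongrightarrow> (\<integral>w. - (k w * p w * exp (- \<tau> * p w)) \<partial>M)"
  proof (rule integral_dominated_convergence[OF _ _ int'])
    show "AE w in M. (\<lambda>i. k w * ((exp (- X i * p w) - exp (- \<tau> * p w)) / (X i - \<tau>))) \<longlonglongrightarrow> - (k w * p w * exp (- \<tau> * p w))"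
    proof (rule AE_I2)
      fix w
      have "((\<lambda>\<tau>. exp (- \<tau> * p w)) has_real_derivative - p w * exp (- \<tau> * p w)) (at \<tau> within {\<tau>0..})"
        by (auto intro!: derivative_eq_intros)
      then have "(\<lambda>i. (exp (- X i * p w) - exp (- \<tau> * p w)) / (X i - \<tau>)) \<longlonglongrightarrow> - p w * exp (- \<tau> * p w)"
        unfolding has_field_derivative_iff tendsto_at_iff_sequentially using X by (auto simp: o_def)
      from tendsto_mult_left[OF this, of "k w"]
      show "(\<lambda>i. k w * ((exp (- X i * p w) - exp (- \<tau> * p w)) / (X i - \<tau>))) \<longlonglongrightarrow> - (k w * p w * exp (- \<tau> * p w))"
        by (simp add: mult.assoc)
    qed
    show "AE w in M. norm (k w * ((exp (- X i * p w) - exp (- \<tau> * p w)) / (X i - \<tau>))) \<le> k w * p w * exp (- \<tau>0 * p w)" for i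
    proof (rule AE_I2)
      fix w
      have "\<bar>(exp (- X i * p w) - exp (- \<tau> * p w)) / (X i - \<tau>)\<bar> \<le> p w * exp (- \<tau>0 * p w)"
        by (rule exp_diff_quotient_bound) (use X t p in auto)
      from mult_left_mono[OF this k[of w]]
      show "norm (k w * ((exp (- X i * p w) - exp (- \<tau> * p w)) / (X i - \<tau>))) \<le> k w * p w * exp (- \<tau>0 * p w)"
        using k[of w] by (simp add: abs_mult mult.assoc)
    qed
  qed simp_all
  have eq: "(\<integral>w. k w * ((exp (- X i * p w) - exp (- \<tau> * p w)) / (X i - \<tau>)) \<partial>M)
      = ((\<integral>w. k w * exp (- X i * p w) \<partial>M) - (\<integral>w. k w * exp (- \<tau> * p w) \<partial>M)) / (X i - \<tau>)" for i
  proof -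
    have "(\<lambda>w. k w * ((exp (- X i * p w) - exp (- \<tau> * p w)) / (X i - \<tau>)))
       = (\<lambda>w. (k w * exp (- X i * p w) - k w * exp (- \<tau> * p w)) / (X i - \<tau>))"
      by (simp add: right_diff_distrib)
    moreover have "X i \<ge> \<tau>0" using X by auto
    ultimately show ?thesis using I[of "X i"] I[OF t] by (simp only: integral_divide_zero Bochner_Integration.integral_diff)
  qed
  from lim[unfolded eq] show "((\<lambda>y. ((\<integral>w. k w * exp (- y * p w) \<partial>M) - (\<integral>w. k w * exp (- \<tau> * p w) \<partial>M)) / (y - \<tau>)) \<circ> X)
      \<longlonglongrightarrow> - (\<integral>w. k w * p w * exp (- \<tau> * p w) \<partial>M)" by (simp add: o_def)
qed

section \<open>The Matern model\<close>

definition gamma_kernel :: "real \<Rightarrow> real \<Rightarrow> real" where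
  "gamma_kernel \<mu> w = indicator {0<..} w * w powr (\<mu> - 1) * exp (- w)"

text \<open>
  The rate \<open>1 / (4 w)\<close> of the Gaussian kernel. It is set to 0 for \<open>w \<le> 0\<close>, where the Gamma kernel vanishes,
  so that rates are nonnegative everywhere.
\<close>

definition recip4 :: "real \<Rightarrow> real" where
  "recip4 w = (if w > 0 then 1 / (4 * w) else 0)"

text \<open>
  The Matern profile of order \<open>\<mu>\<close>, as a function of \<open>\<tau> = t^2\<close> and without its normalising factor. It converges
  at \<open>\<tau> = 0\<close> only for \<open>\<mu> > 0\<close>, but for \<open>\<tau> > 0\<close> at every real order.
\<close>

definition matern_integral :: "real \<Rightarrow> real \<Rightarrow> real" where
  "matern_integral \<mu> \<tau> = (\<integral>w. gamma_kernel \<mu> w * exp (- \<tau> * recip4 w) \<partial>lborel)"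

lemma gamma_kernel_measurable [measurable]: "gamma_kernel \<mu> \<in> borel_measurable borel"
  unfolding gamma_kernel_def[abs_def] by measurable

lemma recip4_measurable [measurable]: "recip4 \<in> borel_measurable borel"
  unfolding recip4_def[abs_def] by measurable

lemma gamma_kernel_nonneg: "gamma_kernel \<mu> w \<ge> 0" by (simp add: gamma_kernel_def)
lemma recip4_nonneg: "recip4 w \<ge> 0" by (simp add: recip4_def)

text \<open>Differentiating in \<open>\<tau>\<close> lowers the order by 1.\<close>

lemma gamma_kernel_recip4: "gamma_kernel \<mu> w * recip4 w = gamma_kernel (\<mu> - 1) w / 4"
  by (simp add: gamma_kernel_def recip4_def powr_diff field_simps power2_eq_square)

lemma gamma_kernel_integrable: "\<mu> > 0 \<Longrightarrow> integrable lborel (gamma_kernel \<mu>)"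
  using Gamma_bochner_integral[of \<mu>] by (simp add: has_bochner_integral_iff gamma_kernel_def[abs_def])

lemma matern_integrable_0:
  assumes "\<mu> > 0" "\<tau> \<ge> 0"
  shows "integrable lborel (\<lambda>w. gamma_kernel \<mu> w * exp (- \<tau> * recip4 w))"
  using laplace_integrable_mono[of lborel "gamma_kernel \<mu>" 0 recip4 \<tau>] assms gamma_kernel_integrable
  by (simp add: gamma_kernel_nonneg recip4_nonneg)

lemma exp_neg_le_fact_power:
  assumes "x > (0::real)"
  shows "exp (- x) \<le> fact m / x ^ m"
proof -
  have "x ^ m / fact m \<le> exp x"
    using exp_sums_real[of x] sum_le_suminf[of "\<lambda>n. x ^ n / fact n" "{m}"] assms by (simp add: sums_iff)
  then show ?thesis using assms by (simp add: exp_minus field_simps)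
qed

text \<open>
  Near 0 the factor \<open>exp (- \<tau> / (4 w))\<close> beats every power of \<open>w\<close>, so the order can be raised until the Gamma
  integral converges.
\<close>

lemma matern_integrable_pos:
  assumes t: "\<tau> > 0"
  shows "integrable lborel (\<lambda>w. gamma_kernel \<mu> w * exp (- \<tau> * recip4 w))"
proof -
  \<comment> \<open>raises the order \<open>\<mu>\<close> to a positive one\<close>
  obtain m :: nat where "- \<mu> < real m" using reals_Archimedean2 by blast
  then have m: "\<mu> + real m > 0" by simp
  show ?thesis
  proof (rule Bochner_Integration.integrable_bound)
    show "integrable lborel (\<lambda>w. fact m * (4 / \<tau>) ^ m * gamma_kernel (\<mu> + real m) w)"
      using gamma_kernel_integrable[OF m] by simp
    show "AE w in lborel. norm (gamma_kernel \<mu> w * exp (- \<tau> * recip4 w)) \<le> norm (fact m * (4 / \<tau>) ^ m * gamma_kernel (\<mu> + real m) w)"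
    proof (rule AE_I2)
      fix w :: real
      show "norm (gamma_kernel \<mu> w * exp (- \<tau> * recip4 w)) \<le> norm (fact m * (4 / \<tau>) ^ m * gamma_kernel (\<mu> + real m) w)"
      proof (cases "w > 0")
        case True
        have "exp (- (\<tau> / (4 * w))) \<le> fact m / (\<tau> / (4 * w)) ^ m" by (rule exp_neg_le_fact_power) (use True t in simp)
        also have "\<dots> = fact m * (4 / \<tau>) ^ m * w ^ m" using True t by (simp add: power_divide power_mult_distrib)
        finally have "gamma_kernel \<mu> w * exp (- \<tau> * recip4 w) \<le> gamma_kernel \<mu> w * (fact m * (4 / \<tau>) ^ m * w ^ m)"
          using True by (intro mult_left_mono gamma_kernel_nonneg) (simp add: recip4_def)
        also have "\<dots> = fact m * (4 / \<tau>) ^ m * gamma_kernel (\<mu> + real m) w"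
        proof -
          have "w powr (\<mu> + real m - 1) = w powr (\<mu> - 1) * w ^ m"
            using True by (simp add: powr_realpow[symmetric] powr_add[symmetric] algebra_simps)
          then show ?thesis using True by (simp add: gamma_kernel_def)
        qed
        finally show ?thesis using t by (simp add: gamma_kernel_nonneg abs_mult)
      qed (simp add: gamma_kernel_def)
    qed
  qed simp
qed

lemma matern_integral_derivative:
  assumes int: "integrable lborel (\<lambda>w. gamma_kernel \<mu> w * exp (- \<tau>0 * recip4 w))"
    and int': "integrable lborel (\<lambda>w. gamma_kernel (\<mu> - 1) w * exp (- \<tau>0 * recip4 w))" and t: "\<tau> \<ge> \<tau>0"
  shows "(matern_integral \<mu> has_real_derivative - matern_integral (\<mu> - 1) \<tau> / 4) (at \<tau> within {\<tau>0..})"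
proof -
  have "((\<lambda>\<tau>. \<integral>w. gamma_kernel \<mu> w * exp (- \<tau> * recip4 w) \<partial>lborel) has_real_derivative
      - (\<integral>w. gamma_kernel \<mu> w * recip4 w * exp (- \<tau> * recip4 w) \<partial>lborel)) (at \<tau> within {\<tau>0..})"
    by (rule laplace_derivative) (use int int' t in \<open>auto simp: gamma_kernel_recip4 gamma_kernel_nonneg recip4_nonneg\<close>)
  then show ?thesis by (simp add: gamma_kernel_recip4 matern_integral_def[abs_def])
qed

text \<open>With \<open>w = (t/2) e^s\<close> one has \<open>w + t^2 / (4 w) = t cosh s\<close>; the integral over all \<open>s\<close> is then folded onto \<open>s \<ge> 0\<close>.\<close>

lemma matern_eq:
  assumes nu: "\<nu> > 0" and t: "t \<ge> 0"
  shows "matern \<nu> t = matern_integral \<nu> (t\<^sup>2) / Gamma \<nu>"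
proof (cases "t = 0")
  case True
  have "matern_integral \<nu> 0 = Gamma \<nu>"
    using Gamma_bochner_integral[OF nu] by (simp add: has_bochner_integral_iff matern_integral_def gamma_kernel_def)
  then show ?thesis using True Gamma_real_pos[OF nu] by (simp add: matern_def)
next
  case False
  then have t: "t > 0" using t by simp
  define f where "f w = gamma_kernel \<nu> w * exp (- (t\<^sup>2) * recip4 w)" for w
  define g where "g s = t / 2 * exp s" for s
  define h where "h s = (t / 2) powr \<nu> * (exp (\<nu> * s) * exp (- t * cosh s))" for s
  have [measurable]: "f \<in> borel_measurable borel" unfolding f_def[abs_def] by measurable
  have [measurable]: "h \<in> borel_measurable borel"
    unfolding h_def[abs_def] by (intro borel_measurable_continuous_onI continuous_intros)
  have fint: "integrable lborel f" unfolding f_def by (rule matern_integrable_pos) (use t in simp)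
  have f0: "indicator {0<..} w *\<^sub>R f w = f w" for w by (auto simp: f_def gamma_kernel_def indicator_def)
  have range: "g ` UNIV = {0<..}"
  proof -
    have "w \<in> range g" if "w > 0" for w
      using that t by (intro image_eqI[of _ _ "ln (w / (t / 2))"]) (auto simp: g_def)
    then show ?thesis using t by (auto simp: g_def)
  qed
  have fset: "set_integrable lebesgue {0<..} f"
    unfolding set_integrable_def f0 using fint by (simp add: integrable_completion)
  have fval: "integral {0<..} f = matern_integral \<nu> (t\<^sup>2)"
    using set_lebesgue_integral_eq_integral(2)[OF fset]
    unfolding set_lebesgue_integral_def f0 by (simp add: integral_completion) (simp add: f_def[abs_def] matern_integral_def)
  have cv: "(\<lambda>s. \<bar>g s\<bar> * f (g s)) absolutely_integrable_on UNIV \<and> integral UNIV (\<lambda>s. \<bar>g s\<bar> * f (g s)) = matern_integral \<nu> (t\<^sup>2)"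
  proof -
    have "(g has_real_derivative g s) (at s within UNIV)" for s
      unfolding g_def by (auto intro!: derivative_eq_intros)
    moreover have "inj_on g UNIV" using t by (auto simp: inj_on_def g_def)
    moreover have "f absolutely_integrable_on g ` UNIV \<and> integral (g ` UNIV) f = matern_integral \<nu> (t\<^sup>2)"
      using fset fval by (simp add: range)
    ultimately show ?thesis
      by (intro has_absolute_integral_change_of_variables_1'[THEN iffD2]) auto
  qed
  have gh: "\<bar>g s\<bar> * f (g s) = h s" for s
  proof -
    have gp: "g s > 0" using t by (simp add: g_def)
    have e: "g s + t\<^sup>2 / (4 * g s) = t * cosh s"
    proof -
      have "t\<^sup>2 / (4 * (t / 2 * exp s)) = t / 2 * exp (- s)"
      proof -
        have "t\<^sup>2 / (4 * (t / 2 * e)) = t / 2 * inverse e" if "e > 0" for e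
          using that t by (simp add: field_simps power2_eq_square)
        from this[OF exp_gt_zero] show ?thesis unfolding exp_minus .
      qed
      then show ?thesis by (simp add: g_def cosh_def distrib_left)
    qed
    have "\<bar>g s\<bar> * f (g s) = (g s * g s powr (\<nu> - 1)) * (exp (- g s) * exp (- (t\<^sup>2 / (4 * g s))))"
      using gp by (simp add: f_def gamma_kernel_def recip4_def)
    also have "g s * g s powr (\<nu> - 1) = g s powr \<nu>" using gp by (simp add: powr_diff)
    also have "\<dots> = (t / 2) powr \<nu> * exp s powr \<nu>" unfolding g_def using t by (intro powr_mult)
    also have "exp s powr \<nu> = exp (\<nu> * s)" by (simp add: powr_def)
    also have "exp (- g s) * exp (- (t\<^sup>2 / (4 * g s))) = exp (- t * cosh s)"
      unfolding exp_add[symmetric] using e by simp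
    finally show ?thesis by (simp add: h_def)
  qed
  have hint: "integrable lborel h"
    using cv unfolding gh set_integrable_def by (simp add: integrable_completion)
  have hval: "(\<integral>s. h s \<partial>lborel) = matern_integral \<nu> (t\<^sup>2)"
    using cv set_lebesgue_integral_eq_integral(2)[of UNIV h] unfolding gh
    by (simp add: set_lebesgue_integral_def integral_completion)
  define E where "E s = exp (- t * cosh s) * cosh (\<nu> * s)" for s
  have [measurable]: "E \<in> borel_measurable borel" unfolding E_def[abs_def] by (intro borel_measurable_continuous_onI continuous_intros)
  have hneg: "integrable lborel (\<lambda>s. h (- s))" "(\<integral>s. h (- s) \<partial>lborel) = (\<integral>s. h s \<partial>lborel)"
    using lborel_integrable_real_affine[OF hint, of "-1" 0] lborel_integral_real_affine[of "-1" h 0] by simp_all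
  have Eh: "(t / 2) powr \<nu> * E s = (h s + h (- s)) / 2" for s
    by (simp add: E_def h_def cosh_def algebra_simps)
  have cp: "(t / 2) powr \<nu> > 0" using t by simp
  have Eint: "integrable lborel E"
  proof -
    have "integrable lborel (\<lambda>s. (t / 2) powr \<nu> * E s)" unfolding Eh using hint hneg by simp
    then show ?thesis using cp by simp
  qed
  have "(t / 2) powr \<nu> * (\<integral>s. E s \<partial>lborel) = (\<integral>s. (h s + h (- s)) / 2 \<partial>lborel)"
    by (simp flip: Eh)
  also have "\<dots> = matern_integral \<nu> (t\<^sup>2)" using hint hneg hval by simp
  finally have Eval: "(t / 2) powr \<nu> * (\<integral>s. E s \<partial>lborel) = matern_integral \<nu> (t\<^sup>2)" .
  have half: "(\<integral>s. E s \<partial>lborel) = 2 * bessel_K \<nu> t"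
  proof -
    have i1: "integrable lborel (\<lambda>s. indicator {0..} s * E s)"
      using integrable_mult_indicator[OF _ Eint, of "{0..}"] by simp
    have i2: "integrable lborel (\<lambda>s. indicator {0..} (- s) * E (- s))"
      using lborel_integrable_real_affine[OF i1, of "-1" 0] by simp
    have ev: "E (- s) = E s" for s by (simp add: E_def)
    have "AE s in lborel. E s = indicator {0..} s * E s + indicator {0..} (- s) * E (- s)"
      using AE_lborel_singleton[of "0::real"] by eventually_elim (auto simp: indicator_def ev)
    then have "(\<integral>s. E s \<partial>lborel) = (\<integral>s. indicator {0..} s * E s + indicator {0..} (- s) * E (- s) \<partial>lborel)"
      by (intro integral_cong_AE) auto
    also have "\<dots> = (\<integral>s. indicator {0..} s * E s \<partial>lborel) + (\<integral>s. indicator {0..} (- s) * E (- s) \<partial>lborel)"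
      by (rule Bochner_Integration.integral_add[OF i1 i2])
    also have "(\<integral>s. indicator {0..} (- s) * E (- s) \<partial>lborel) = (\<integral>s. indicator {0..} s * E s \<partial>lborel)"
      using lborel_integral_real_affine[of "-1" "\<lambda>s. indicator {0..} s * E s" 0] by simp
    also have "(\<integral>s. indicator {0..} s * E s \<partial>lborel) = bessel_K \<nu> t"
      by (simp add: bessel_K_def set_lebesgue_integral_def E_def)
    finally show ?thesis by simp
  qed
  have "2 powr (1 - \<nu>) * t powr \<nu> = 2 * (t / 2) powr \<nu>"
    using t by (simp add: powr_diff powr_divide)
  then have "matern \<nu> t = (t / 2) powr \<nu> * (2 * bessel_K \<nu> t) / Gamma \<nu>"
    using t by (simp add: matern_def)
  then show ?thesis using Eval half by simp
qed

lemma stationary_covariance_matern: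
  assumes "\<nu> > 0"
  shows "stationary_covariance (\<lambda>h::'a::euclidean_space. matern_integral \<nu> ((norm h)\<^sup>2))"
  unfolding matern_integral_def
proof (rule stationary_covariance_mixture)
  fix w :: real
  have "stationary_covariance (\<lambda>h::'a. exp (- recip4 w * (norm h)\<^sup>2))"
    by (rule stationary_covariance_gauss) (rule recip4_nonneg)
  from stationary_covariance_cmult[OF this gamma_kernel_nonneg[of \<nu> w]]
  show "stationary_covariance (\<lambda>h::'a. gamma_kernel \<nu> w * exp (- (norm h)\<^sup>2 * recip4 w))"
    by (simp add: mult.commute)
qed (rule matern_integrable_0[OF assms], simp)

text \<open>
  The second derivative involves the integral of order \<open>\<nu> - 2\<close>, which may diverge at 0; at the
  origin the continuity of the first derivative takes over.
\<close>

theorem T3_matern: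
  fixes u :: "'a::euclidean_space"
  assumes "a1 > 0" "a2 > 0" "b1 \<ge> 0" "b2 \<ge> 0" "norm u = 1" and nu: "\<nu> > 1"
  shows "stationary_covariance (T3 a1 a2 b1 b2 u (matern \<nu>))"
proof (rule T3_stationary_covariance[where g = "\<lambda>\<tau>. matern_integral \<nu> \<tau> / Gamma \<nu>"
      and ?g1.0 = "\<lambda>\<tau>. - matern_integral (\<nu> - 1) \<tau> / 4 / Gamma \<nu>"
      and ?g2.0 = "\<lambda>\<tau>. - (- matern_integral (\<nu> - 1 - 1) \<tau> / 4) / 4 / Gamma \<nu>"])
  have "stationary_covariance (\<lambda>h::'a. 1 / Gamma \<nu> * matern_integral \<nu> ((norm h)\<^sup>2))"
    using nu by (intro stationary_covariance_cmult stationary_covariance_matern) (auto simp: Gamma_real_pos less_imp_le)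
  then show "stationary_covariance (\<lambda>h::'a. matern_integral \<nu> ((norm h)\<^sup>2) / Gamma \<nu>)" by simp
  show "matern \<nu> t = matern_integral \<nu> (t\<^sup>2) / Gamma \<nu>" if "t \<ge> 0" for t using matern_eq nu that by simp
  show "((\<lambda>\<tau>. matern_integral \<nu> \<tau> / Gamma \<nu>) has_real_derivative - matern_integral (\<nu> - 1) \<tau> / 4 / Gamma \<nu>) (at \<tau> within {0..})"
    if "\<tau> \<ge> 0" for \<tau>
    by (intro DERIV_cdivide matern_integral_derivative matern_integrable_0) (use nu that in auto)
  show "((\<lambda>\<tau>. - matern_integral (\<nu> - 1) \<tau> / 4 / Gamma \<nu>) has_real_derivative - (- matern_integral (\<nu> - 1 - 1) \<tau> / 4) / 4 / Gamma \<nu>) (at \<tau>)"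
    if t: "\<tau> > 0" for \<tau>
  proof (intro DERIV_cdivide DERIV_minus)
    have "(matern_integral (\<nu> - 1) has_real_derivative - matern_integral (\<nu> - 1 - 1) \<tau> / 4) (at \<tau> within {\<tau>/2..})"
      by (intro matern_integral_derivative matern_integrable_pos) (use t in auto)
    then have "(matern_integral (\<nu> - 1) has_real_derivative - matern_integral (\<nu> - 1 - 1) \<tau> / 4) (at \<tau> within {\<tau>/2<..})"
      by (rule DERIV_subset) auto
    then show "(matern_integral (\<nu> - 1) has_real_derivative - matern_integral (\<nu> - 1 - 1) \<tau> / 4) (at \<tau>)"
      using t by (simp add: at_within_open[of \<tau> "{\<tau>/2<..}"])
  qed
  have "continuous (at 0 within {0..}) (matern_integral (\<nu> - 1))"
    unfolding matern_integral_def[abs_def]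
    by (rule laplace_continuous) (use nu matern_integrable_0[of "\<nu> - 1" 0] in \<open>auto simp: gamma_kernel_nonneg recip4_nonneg\<close>)
  then show "continuous (at 0 within {0..}) (\<lambda>\<tau>. - matern_integral (\<nu> - 1) \<tau> / 4 / Gamma \<nu>)"
    using Gamma_real_pos[of \<nu>] nu by (intro continuous_intros) linarith+
qed (use assms in auto)

section \<open>An inverse pair of series\<close>

text \<open>For \<open>j = M\<close> the closed form is minus the one remaining term of the full sum.\<close>

lemma alternating_binomial_telescope:
  fixes z :: real
  assumes z: "z > 0" and "j \<le> M"
  shows "(\<Sum>m\<le>j. (-1)^m * real (Suc M choose m) * (z + 2 * real m) / pochhammer (z + real m) (Suc (Suc M)))
         = (-1)^j * real (M choose j) / pochhammer (z + real j + 1) (Suc M)"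
  using assms(2)
proof (induction j)
  case 0
  then show ?case using z by (simp add: pochhammer_rec[of z "Suc M"] del: pochhammer_Suc)
next
  case (Suc j)
  define P where "P = pochhammer (z + real j + 2) M"
  have P: "P > 0" unfolding P_def using z by (intro pochhammer_pos) auto
  have e1: "pochhammer (z + real j + 1) (Suc M) = (z + real j + 1) * P"
    unfolding P_def by (simp add: pochhammer_rec add_ac)
  have e2: "pochhammer (z + (real j + 1)) (Suc (Suc M)) = (z + real j + 1) * (P * (z + real j + 2 + real M))"
    unfolding P_def using pochhammer_rec[of "z + real j + 1" "Suc M"] pochhammer_Suc[of "z + real j + 2" M]
    by (simp add: add_ac)
  have e3: "pochhammer (z + real (Suc j) + 1) (Suc M) = P * (z + real j + 2 + real M)"
    unfolding P_def by (simp add: pochhammer_Suc add_ac)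
  have pos: "z + real j + 1 > 0" "z + real j + 2 + real M > 0" using z by auto
  have b1: "real (Suc M choose Suc j) = real (M choose j) + real (M choose Suc j)" by simp
  have b2: "real (M choose Suc j) * (real j + 1) = real (M choose j) * (real M - real j)"
  proof -
    have "(M choose Suc j) * Suc j = (M choose j) * (M - j)"
      by (metis binomial_absorb_comp binomial_absorption mult.commute)
    then have "real ((M choose Suc j) * Suc j) = real ((M choose j) * (M - j))" by simp
    then show ?thesis using Suc.prems by (simp add: of_nat_diff algebra_simps)
  qed
  have alg: "C0 / (u * P) - (C0 + C1) * (z + 2 * (J + 1)) / (u * (P * v)) = - C1 / (P * v)"
    if "C1 * (J + 1) = C0 * (m - J)" "u = z + J + 1" "v = z + J + 2 + m" "u > 0" "v > 0" for C0 C1 J m u v :: real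
  proof -
    have "C0 * v - (C0 + C1) * (z + 2 * (J + 1)) = - C1 * u"
      using that(1) unfolding that(2,3) by (simp add: algebra_simps)
    then have "(C0 * v - (C0 + C1) * (z + 2 * (J + 1))) / (u * P * v) = - C1 * u / (u * P * v)" by simp
    then show ?thesis using that(4,5) P by (simp add: field_simps)
  qed
  have "(\<Sum>m\<le>Suc j. (-1)^m * real (Suc M choose m) * (z + 2 * real m) / pochhammer (z + real m) (Suc (Suc M)))
     = (-1)^j * (real (M choose j) / ((z + real j + 1) * P)
        - (real (M choose j) + real (M choose Suc j)) * (z + 2 * (real j + 1)) / ((z + real j + 1) * (P * (z + real j + 2 + real M))))"
  proof -
    have alg2: "s * C0 / (u * P) + (-1 * s) * (C0 + C1) * w / D = s * (C0 / (u * P) - (C0 + C1) * w / D)"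
      for s C0 C1 u w D :: real by (simp add: algebra_simps diff_divide_distrib add_divide_distrib)
    have "real (Suc j) = real j + 1" by simp
    show ?thesis using Suc.IH Suc.prems
      by (simp only: sum.atMost_Suc e1 e2 b1 power_Suc alg2 Suc_leD \<open>real (Suc j) = real j + 1\<close>)
  qed
  also have "\<dots> = (-1)^j * (- real (M choose Suc j) / (P * (z + real j + 2 + real M)))"
    by (subst alg[OF b2 refl refl pos]) simp
  finally show ?case unfolding e3 by simp
qed

lemma alternating_binomial_sum_eq_0:
  fixes z :: real
  assumes "z > 0" and "M > 0"
  shows "(\<Sum>m\<le>M. (-1)^m * real (M choose m) * (z + 2 * real m) / pochhammer (z + real m) (Suc M)) = 0"
proof -
  obtain L where M: "M = Suc L" using \<open>M > 0\<close> by (cases M) auto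
  have p: "pochhammer (z + real (Suc L)) (Suc (Suc L)) = pochhammer (z + real L + 1) (Suc L) * (z + 2 * real (Suc L))"
    by (simp add: pochhammer_Suc algebra_simps)
  have "z + 2 * real (Suc L) > 0" "pochhammer (z + real L + 1) (Suc L) > 0" using \<open>z > 0\<close> by (auto intro!: pochhammer_pos simp del: pochhammer_Suc)
  then show ?thesis
    unfolding M sum.atMost_Suc alternating_binomial_telescope[OF \<open>z > 0\<close> order_refl] p
    by (simp del: pochhammer_Suc)
qed

text \<open>
  The weights dual to the basis below: pairing them with the basis gives the Kronecker symbol. This is
  the classical inverse pair behind expansions in Jacobi polynomials.
\<close>

definition inv_weight :: "real \<Rightarrow> nat \<Rightarrow> nat \<Rightarrow> real" where
  "inv_weight \<nu> N n = (-1)^n * real (N choose n) * (2 * \<nu> + 2 * real n) / pochhammer (2 * \<nu> + real n) (Suc N)"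

definition inv_basis :: "real \<Rightarrow> nat \<Rightarrow> nat \<Rightarrow> real" where
  "inv_basis \<nu> n k = pochhammer (- real n) k * pochhammer (real n + 2 * \<nu>) k / fact k"

lemma inv_basis_eq_0: "n < k \<Longrightarrow> inv_basis \<nu> n k = 0"
  by (simp add: inv_basis_def pochhammer_of_nat_eq_0_iff)

text \<open>
  Only \<open>n \<ge> k\<close> contributes, and after the shift \<open>n = k + m\<close> the sum is the alternating binomial sum with
  \<open>z = 2 \<nu> + 2 k\<close>.
\<close>

lemma inverse_pair:
  assumes nu: "\<nu> > 0" and kN: "k \<le> N"
  shows "(\<Sum>n\<le>N. inv_weight \<nu> N n * inv_basis \<nu> n k) = (if k = N then 1 else 0)"
proof -
  define z where "z = 2 * \<nu> + 2 * real k"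
  have z: "z > 0" using nu by (simp add: z_def)
  have term_eq: "inv_weight \<nu> N (k + m) * inv_basis \<nu> (k + m) k =
      real (N choose k) * ((-1)^m * real ((N - k) choose m) * (z + 2 * real m) / pochhammer (z + real m) (Suc (N - k)))"
    if m: "m \<le> N - k" for m
  proof -
    have p1: "pochhammer (- real (k + m)) k = (-1)^k * (fact (k + m) / fact m)"
    proof -
      have "fact (m + k) = (fact m :: real) * pochhammer (real m + 1) k"
        unfolding pochhammer_fact using pochhammer_product'[of "1::real" m k] by (simp add: add.commute)
      then have "pochhammer (real m + 1) k = fact (k + m) / fact m" by (simp add: add.commute)
      then show ?thesis by (subst pochhammer_minus) simp
    qed
    have p2: "pochhammer (2 * \<nu> + real (k + m)) (Suc N) = pochhammer (real (k + m) + 2 * \<nu>) k * pochhammer (z + real m) (Suc (N - k))"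
    proof -
      have "Suc N = k + Suc (N - k)" using kN by simp
      then show ?thesis using pochhammer_product'[of "2 * \<nu> + real (k + m)" k "Suc (N - k)"]
        by (simp add: z_def add_ac del: pochhammer_Suc)
    qed
    have p3: "pochhammer (real (k + m) + 2 * \<nu>) k > 0" using nu by (intro pochhammer_pos) auto
    have b: "real (N choose (k + m)) * (fact (k + m) / (fact m * fact k)) = real (N choose k) * real ((N - k) choose m)"
    proof -
      have "(N choose (k + m)) * ((k + m) choose k) = (N choose k) * ((N - k) choose m)"
        using choose_mult[of k "k + m" N] m kN by simp
      then have "real (N choose (k + m)) * real ((k + m) choose k) = real (N choose k) * real ((N - k) choose m)"
        by (metis of_nat_mult)
      moreover have "real ((k + m) choose k) = fact (k + m) / (fact m * fact k)"
        by (subst binomial_fact) (simp_all add: mult.commute)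
      ultimately show ?thesis by simp
    qed
    have "inv_weight \<nu> N (k + m) * inv_basis \<nu> (k + m) k =
       ((-1)^(k+m) * (-1)^k) * (real (N choose (k + m)) * (fact (k + m) / (fact m * fact k))) * (z + 2 * real m) / pochhammer (z + real m) (Suc (N - k))"
    proof -
      have alg: "s * B * w / (P * Q) * (s' * (f / fm) * P / fk) = (s * s') * (B * (f / (fm * fk))) * w / Q"
        if "P > 0" for s B w P Q s' f fm fk :: real
        using that by (simp add: divide_simps)
      have w: "2 * \<nu> + 2 * real (k + m) = z + 2 * real m" by (simp add: z_def)
      show ?thesis
        unfolding inv_weight_def inv_basis_def p1 p2 w by (rule alg[OF p3])
    qed
    also have "(-1::real)^(k+m) * (-1)^k = (-1)^m" by (simp add: power_add mult.commute mult.left_commute flip: power_mult_distrib)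
    finally show ?thesis unfolding b by simp
  qed
  have "(\<Sum>n\<le>N. inv_weight \<nu> N n * inv_basis \<nu> n k) = (\<Sum>n=k..N. inv_weight \<nu> N n * inv_basis \<nu> n k)"
    by (rule sum.mono_neutral_right) (auto simp: inv_basis_eq_0)
  also have "\<dots> = (\<Sum>m\<le>N-k. inv_weight \<nu> N (k + m) * inv_basis \<nu> (k + m) k)"
    by (rule sum.reindex_bij_witness[of _ "\<lambda>m. k + m" "\<lambda>n. n - k"]) (use kN in auto)
  also have "\<dots> = real (N choose k) * (\<Sum>m\<le>N-k. (-1)^m * real ((N - k) choose m) * (z + 2 * real m) / pochhammer (z + real m) (Suc (N - k)))"
    unfolding sum_distrib_left by (rule sum.cong) (auto simp: term_eq simp del: pochhammer_Suc)
  also have "\<dots> = (if k = N then 1 else 0)"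
    using alternating_binomial_sum_eq_0[OF z, of "N - k"] kN z by (auto simp del: pochhammer_Suc simp add: pochhammer_0 )
  finally show ?thesis .
qed

section \<open>A nonnegative family of Wilson polynomial values\<close>

text \<open>
  The identity behind the three-term recurrence, after division of the terms with index \<open>k = j + 1\<close> by their
  common factor. The relation between \<open>v\<close> and \<open>a, x, y\<close> says that the \<open>4F3\<close> series is balanced, and it
  is what makes the coefficients of the higher powers of \<open>j\<close> cancel.
\<close>

lemma wilson_polynomial_identity:
  fixes n v a x y j :: real
  assumes y: "2 * v = x + y + a - 3/2"
  shows "(n + a + x) * (n + a + y) * (- (n+1)) * (n + 2 * v + j) * (n + 2 * v + j + 1)
       - (n + 2 * v) * (n + a + x) * (n + a + y) * (j - n) * (n + 2 * v + j)
       - n * (n - 3/2 + x) * (n - 3/2 + y) * (j - n) * (n + 2 * v + j)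
       - (n - 3/2 + x) * (n - 3/2 + y) * (j - n) * (j + 1 - n) * (n - 1 + 2 * v)
       + 4 * (n + v) * a * (v + 1) * (j - n) * (n + 2 * v + j)
     = 4 * (n + v) * ((v + 2 + j) * (a + j + 1) * (j - n) * (n + 2 * v + j)
          - (j + 1) * (v + 1/2 + j) * (a + x + j) * (a + y + j))"
proof -
  \<comment> \<open>shifts by 3/2 that clear the halves, so that an identity with integer coefficients remains\<close>
  define A e where "A = a + 3/2" and "e = x - 3/2"
  have subs: "n + a + x = n + A + e" "n + a + y = n + 2 * v - e" "n - 3/2 + x = n + e"
     "n - 3/2 + y = n + 2 * v - A - e" "a + x + j = A + e + j" "a + y + j = 2 * v - e + j"
    using y by (auto simp: A_def e_def)
  have halves: "4 * (n + v) * a * (v + 1) = 2 * (n + v) * (2 * A - 3) * (v + 1)"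
     "4 * (n + v) * ((v + 2 + j) * (a + j + 1) * p * q - (j + 1) * (v + 1/2 + j) * r * s)
       = 2 * (n + v) * ((v + 2 + j) * (2 * A + 2 * j - 1) * p * q - (j + 1) * (2 * v + 1 + 2 * j) * r * s)" for p q r s
    by (simp_all add: A_def algebra_simps)
  show ?thesis unfolding subs halves by algebra
qed

context
  fixes a x y \<nu> :: real
begin

text \<open>
  Coefficients of \<open>1F2(a; a + x, a + y)\<close> without their factor \<open>1 / k!\<close>, multiplied by \<open>(\<nu> + 1)_k / (\<nu> + 1/2)_k\<close>; this extra ratio comes from the
  coefficients of the squares of \<open>0F1\<close>.
\<close>

definition wilson_moment :: "nat \<Rightarrow> real" where
  "wilson_moment k = pochhammer (\<nu> + 1) k * pochhammer a k /
     (pochhammer (\<nu> + 1/2) k * pochhammer (a + x) k * pochhammer (a + y) k)"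

definition wilson_term :: "nat \<Rightarrow> nat \<Rightarrow> real" where
  "wilson_term n k = inv_basis \<nu> n k * wilson_moment k"

text \<open>
  The terminating series \<open>4F3(-n, n + 2 \<nu>, \<nu> + 1, a; \<nu> + 1/2, a + x, a + y; 1)\<close>, a value of a Wilson polynomial
  of degree \<open>n\<close>.
\<close>

definition wilson :: "nat \<Rightarrow> real" where
  "wilson n = (\<Sum>k\<le>n. wilson_term n k)"

text \<open>
  Telescoping certificate for the recurrence in \<open>n\<close>: the terms of the recurrence add up to differences of
  consecutive values.
\<close>

private definition flux :: "nat \<Rightarrow> nat \<Rightarrow> real" where
  "flux n k = inv_basis \<nu> n k * wilson_moment (Suc k) * ((\<nu> + 1/2 + real k) * (a + x + real k) * (a + y + real k))"

text \<open>
  Subtracting this multiple of \<open>wilson n\<close> leaves a quantity that obeys a first-order recurrence. If the line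
  condition is an equality, then it vanishes and the recurrence for \<open>wilson\<close> is two-term (Saalschuetz's formula).
\<close>

definition defect :: "nat \<Rightarrow> real" where
  "defect n = (real n + a + x) * (real n + a + y) * wilson (Suc n)
     - (real n + x - 1/2) * (real n + y - 1/2) * wilson n"

context
  assumes a: "a > 1/2" and x: "x > 0" and y: "y > 0" and line: "x + y \<ge> a + 1/2" and hyp: "2 * x * y \<ge> a"
    and nu_eq: "2 * \<nu> = x + y + a - 3/2"
begin

private lemma nu_pos: "\<nu> > 0" using nu_eq line a by simp

private lemma moment_Suc: "wilson_moment (Suc k) * ((\<nu> + 1/2 + real k) * (a + x + real k) * (a + y + real k))
   = wilson_moment k * ((\<nu> + 1 + real k) * (a + real k))"
proof -
  have "pochhammer (\<nu> + 1/2) k > 0" "pochhammer (a+x) k > 0" "pochhammer (a+y) k > 0"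
    "\<nu> + 1/2 + real k > 0" "a + x + real k > 0" "a + y + real k > 0"
    using nu_pos a x y by (auto intro!: pochhammer_pos)
  then show ?thesis unfolding wilson_moment_def pochhammer_Suc
    by (simp add: divide_simps)
qed

private lemma wilson_extend: "n \<le> m \<Longrightarrow> wilson n = (\<Sum>k\<le>m. wilson_term n k)"
  unfolding wilson_def wilson_term_def
  by (rule sum.mono_neutral_left) (auto simp: inv_basis_eq_0)

text \<open>How the basis changes when \<open>k\<close> grows by 1 and \<open>n\<close> moves to a neighbour. Denominators are multiplied out.\<close>

private lemma basis_shift:
  fixes n m j :: nat
  assumes n: "n = Suc m"
  defines "e \<equiv> inv_basis \<nu> n j"
  shows "inv_basis \<nu> n (Suc j) * (real j + 1) = e * (real j - real n) * (real n + 2 * \<nu> + real j)"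
    and "inv_basis \<nu> (Suc n) (Suc j) * (real j + 1) * (real n + 2 * \<nu>)
         = - e * (real n + 1) * (real n + 2 * \<nu> + real j) * (real n + 2 * \<nu> + real j + 1)"
    and "inv_basis \<nu> m (Suc j) * (real j + 1) * real n
         = - e * (real j - real n) * (real j + 1 - real n) * (real n - 1 + 2 * \<nu>)"
proof -
  define P where "P = pochhammer (- real n) j"
  define Q where "Q = pochhammer (real n + 2 * \<nu>) j"
  have e: "e = P * Q / fact j" by (simp add: e_def inv_basis_def P_def Q_def)
  have P0: "pochhammer (- real n) (Suc j) = P * (real j - real n)" by (simp add: pochhammer_Suc P_def)
  have Q0: "pochhammer (real n + 2 * \<nu>) (Suc j) = Q * (real n + 2 * \<nu> + real j)" by (simp add: pochhammer_Suc Q_def)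
  have P1: "pochhammer (- real (Suc n)) (Suc j) = - ((real n + 1) * P)"
    using pochhammer_rec[of "- real (Suc n)" j] by (simp add: P_def algebra_simps)
  have Q1: "pochhammer (real (Suc n) + 2 * \<nu>) (Suc j) * (real n + 2 * \<nu>)
      = Q * (real n + 2 * \<nu> + real j) * (real n + 2 * \<nu> + real j + 1)"
    using pochhammer_rec[of "real n + 2 * \<nu>" "Suc j"] pochhammer_Suc[of "real n + 2 * \<nu>" "Suc j"] Q0
    by (simp add: algebra_simps del: pochhammer_Suc)
  have P2: "pochhammer (- real m) (Suc j) * real n = - P * (real j - real n) * (real j + 1 - real n)"
  proof -
    have "- real n * pochhammer (- real m) (Suc j) = pochhammer (- real n) (Suc j) * (- real n + real (Suc j))"
      using pochhammer_rec[of "- real n" "Suc j"] pochhammer_Suc[of "- real n" "Suc j"] n by (simp del: pochhammer_Suc)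
    then show ?thesis unfolding P0 of_nat_Suc by algebra
  qed
  have Q2: "pochhammer (real m + 2 * \<nu>) (Suc j) = (real n - 1 + 2 * \<nu>) * Q"
    using pochhammer_rec[of "real m + 2 * \<nu>" j] n by (simp add: Q_def algebra_simps)
  have F: "fact (Suc j) = fact j * (real j + 1)" by (simp add: algebra_simps)
  have can: "p / (fact j * (real j + 1)) * (real j + 1) = p / fact j" for p :: real by simp
  have mv: "p / fact j * r = (p * r) / fact j" for p r :: real by simp
  show "inv_basis \<nu> n (Suc j) * (real j + 1) = e * (real j - real n) * (real n + 2 * \<nu> + real j)"
    unfolding inv_basis_def F can e P0 Q0 by (simp add: ac_simps)
  show "inv_basis \<nu> (Suc n) (Suc j) * (real j + 1) * (real n + 2 * \<nu>)
         = - e * (real n + 1) * (real n + 2 * \<nu> + real j) * (real n + 2 * \<nu> + real j + 1)"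
  proof -
    have "inv_basis \<nu> (Suc n) (Suc j) * (real j + 1) * (real n + 2 * \<nu>)
       = pochhammer (- real (Suc n)) (Suc j) * (pochhammer (real (Suc n) + 2 * \<nu>) (Suc j) * (real n + 2 * \<nu>)) / fact j"
      unfolding inv_basis_def F can mv by (simp only: ac_simps)
    then show ?thesis unfolding P1 Q1 e by (simp add: ac_simps)
  qed
  show "inv_basis \<nu> m (Suc j) * (real j + 1) * real n
         = - e * (real j - real n) * (real j + 1 - real n) * (real n - 1 + 2 * \<nu>)"
  proof -
    have "inv_basis \<nu> m (Suc j) * (real j + 1) * real n
       = (pochhammer (- real m) (Suc j) * real n) * pochhammer (real m + 2 * \<nu>) (Suc j) / fact j"
      unfolding inv_basis_def F can mv by (simp only: ac_simps)
    then show ?thesis unfolding P2 Q2 e by (simp add: ac_simps)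
  qed
qed

private lemma wilson_term_recurrence:
  assumes n: "n = Suc m"
  shows "(real n + 2*\<nu>) * (real n + a + x) * (real n + a + y) * (wilson_term (Suc n) k - wilson_term n k)
      - real n * (real n - 3/2 + x) * (real n - 3/2 + y) * (wilson_term n k - wilson_term m k)
      + 4 * (real n + \<nu>) * a * (\<nu> + 1) * wilson_term n k
    = 4 * (real n + \<nu>) * (flux n k - (case k of 0 \<Rightarrow> 0 | Suc j \<Rightarrow> flux n j))"
proof (cases k)
  case 0
  have "wilson_term N 0 = 1" for N by (simp add: wilson_term_def inv_basis_def wilson_moment_def)
  moreover have "flux n 0 = (\<nu> + 1) * a"
    using moment_Suc[of 0] by (simp add: flux_def inv_basis_def wilson_moment_def)
  ultimately show ?thesis using 0 by simp
next
  case (Suc j)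
  define e where "e = inv_basis \<nu> n j"
  define C where "C = wilson_moment (Suc j)"
  define J where "J = real j"
  define R where "R = real n"
  define E0 where "E0 = inv_basis \<nu> n (Suc j)"
  define E1 where "E1 = inv_basis \<nu> (Suc n) (Suc j)"
  define E2 where "E2 = inv_basis \<nu> m (Suc j)"
  note sh = basis_shift[OF n, of j, folded e_def J_def R_def E0_def E1_def E2_def]
  have f1: "flux n (Suc j) = E0 * C * ((\<nu> + 2 + J) * (a + J + 1))"
  proof -
    have "(\<nu> + 1 + real (Suc j)) * (a + real (Suc j)) = (\<nu> + 2 + J) * (a + J + 1)"
      by (simp add: J_def add_ac)
    moreover have "flux n (Suc j) = E0 * (C * ((\<nu> + 1 + real (Suc j)) * (a + real (Suc j))))"
      unfolding moment_Suc[of "Suc j", folded C_def, symmetric] flux_def E0_def by (simp only: mult.assoc)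
    ultimately show ?thesis by (simp only: mult.assoc)
  qed
  have f0: "flux n j = e * C * ((\<nu> + 1/2 + J) * (a + x + J) * (a + y + J))"
    by (simp add: flux_def e_def C_def J_def)
  have ring1: "(J + 1) * (p * b * c * (E1 * C - E0 * C) - R * g * h * (E0 * C - E2 * C) + q * (E0 * C))
    = C * (b * c * (E1 * (J + 1) * p) - p * b * c * (E0 * (J + 1)) - R * g * h * (E0 * (J + 1))
        + g * h * (E2 * (J + 1) * R) + q * (E0 * (J + 1)))" for p b c g h q
    by (simp add: algebra_simps)
  have ring2: "C * (b * c * (- e * n1 * p1 * p2) - p * b * c * (e * d * p1) - R * g * h * (e * d * p1)
        + g * h * (- e * d * d1 * r) + q * (e * d * p1))
    = C * e * (b * c * (- n1) * p1 * p2 - p * b * c * d * p1 - R * g * h * d * p1 - g * h * d * d1 * r + q * d * p1)"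
    for b c n1 p1 p2 p d g h d1 r q by (simp add: algebra_simps)
  have ring3: "C * e * (q * (b * c * d * p - s * D * E * F)) = q * (b * c * (e * d * p) * C - s * (e * C * (D * E * F)))"
    for b c d p s D E F q by (simp add: algebra_simps)
  have ring4: "q * (b * c * (E0 * s) * C - s * (e * C * D)) = s * (q * (E0 * C * (b * c) - e * C * D))" for b c s D q
    by (simp add: algebra_simps)
  have "(J + 1) * ((R + 2*\<nu>) * (R + a + x) * (R + a + y) * (E1 * C - E0 * C)
      - R * (R - 3/2 + x) * (R - 3/2 + y) * (E0 * C - E2 * C)
      + 4 * (R + \<nu>) * a * (\<nu> + 1) * (E0 * C))
    = C * e * (4 * (R + \<nu>) * ((\<nu> + 2 + J) * (a + J + 1) * (J - R) * (R + 2*\<nu> + J)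
          - (J + 1) * (\<nu> + 1/2 + J) * (a + x + J) * (a + y + J)))"
    unfolding ring1 sh ring2 wilson_polynomial_identity[OF nu_eq, of R J] ..
  also have "\<dots> = (J + 1) * (4 * (R + \<nu>) * (flux n (Suc j) - flux n j))"
    unfolding ring3 sh(1)[symmetric] ring4 f1 f0 ..
  finally have "(R + 2*\<nu>) * (R + a + x) * (R + a + y) * (E1 * C - E0 * C)
      - R * (R - 3/2 + x) * (R - 3/2 + y) * (E0 * C - E2 * C)
      + 4 * (R + \<nu>) * a * (\<nu> + 1) * (E0 * C) = 4 * (R + \<nu>) * (flux n (Suc j) - flux n j)"
    by (subst (asm) mult_left_cancel) (auto simp: J_def)
  then show ?thesis
    unfolding Suc wilson_term_def E0_def E1_def E2_def C_def R_def by simp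
qed

lemma wilson_recurrence:
  assumes n: "n = Suc m"
  shows "(real n + 2*\<nu>) * (real n + a + x) * (real n + a + y) * (wilson (Suc n) - wilson n)
      - real n * (real n - 3/2 + x) * (real n - 3/2 + y) * (wilson n - wilson m)
      + 4 * (real n + \<nu>) * a * (\<nu> + 1) * wilson n = 0"
proof -
  have tele: "(\<Sum>k\<le>K. flux n k - (case k of 0 \<Rightarrow> 0 | Suc j \<Rightarrow> flux n j)) = flux n K" for K
    by (induction K) auto
  have "(real n + 2*\<nu>) * (real n + a + x) * (real n + a + y) * (wilson (Suc n) - wilson n)
      - real n * (real n - 3/2 + x) * (real n - 3/2 + y) * (wilson n - wilson m)
      + 4 * (real n + \<nu>) * a * (\<nu> + 1) * wilson n
    = (\<Sum>k\<le>Suc n. (real n + 2*\<nu>) * (real n + a + x) * (real n + a + y) * (wilson_term (Suc n) k - wilson_term n k)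
      - real n * (real n - 3/2 + x) * (real n - 3/2 + y) * (wilson_term n k - wilson_term m k)
      + 4 * (real n + \<nu>) * a * (\<nu> + 1) * wilson_term n k)"
    unfolding sum.distrib sum_subtractf sum_distrib_left[symmetric]
    using wilson_extend[of n "Suc n"] wilson_extend[of m "Suc n"] wilson_extend[of "Suc n" "Suc n"] n by simp
  also have "\<dots> = 4 * (real n + \<nu>) * (\<Sum>k\<le>Suc n. flux n k - (case k of 0 \<Rightarrow> 0 | Suc j \<Rightarrow> flux n j))"
    unfolding sum_distrib_left by (rule sum.cong[OF refl], rule wilson_term_recurrence[OF n])
  also have "\<dots> = 0" unfolding tele by (simp add: flux_def inv_basis_eq_0)
  finally show ?thesis .
qed

lemma wilson_0: "wilson 0 = 1"
  by (simp add: wilson_def wilson_term_def inv_basis_def wilson_moment_def)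

text \<open>This value vanishes exactly on the hyperbola \<open>2 x y = a\<close>.\<close>

lemma wilson_1: "(a + x) * (a + y) * wilson (Suc 0) = (a + x) * (a + y) - 2 * a * (\<nu> + 1)"
proof -
  have "wilson_moment (Suc 0) * ((\<nu> + 1/2) * (a + x) * (a + y)) = (\<nu> + 1) * a"
    using moment_Suc[of 0] by (simp add: wilson_moment_def)
  then have "wilson_moment (Suc 0) * ((a + x) * (a + y)) = 2 * (\<nu> + 1) * a / (2 * \<nu> + 1)"
    using nu_pos by (simp add: field_simps)
  moreover have "wilson (Suc 0) = 1 - (1 + 2 * \<nu>) * wilson_moment (Suc 0)"
  proof -
    have "wilson_moment 0 = 1" by (simp add: wilson_moment_def)
    then show ?thesis by (simp add: wilson_def wilson_term_def inv_basis_def algebra_simps)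
  qed
  ultimately have "(a + x) * (a + y) * wilson (Suc 0)
      = (a + x) * (a + y) - (1 + 2 * \<nu>) * (2 * (\<nu> + 1) * a / (2 * \<nu> + 1))"
    by (simp add: right_diff_distrib mult_ac)
  moreover have "(1 + 2 * \<nu>) * (2 * (\<nu> + 1) * a / (2 * \<nu> + 1)) = 2 * a * (\<nu> + 1)"
    using nu_pos by (simp add: divide_simps) algebra
  ultimately show ?thesis by simp
qed

lemma defect_0: "defect 0 = \<nu> + 1/2 - a"
proof -
  have "y = 2 * \<nu> + 3/2 - a - x" using nu_eq by simp
  then have "(a + x) * (a + y) - 2 * a * (\<nu> + 1) - (x - 1/2) * (y - 1/2) = \<nu> + 1/2 - a"
    by (simp only:) (simp add: algebra_simps power2_eq_square)
  then show ?thesis unfolding defect_def wilson_0 using wilson_1 by simp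
qed

text \<open>The inhomogeneity has the sign of \<open>\<nu> + 1/2 - a\<close>, that is, of \<open>x + y - a - 1/2\<close>.\<close>

lemma defect_Suc:
  "(real (Suc m) + 2 * \<nu>) * defect (Suc m) =
     real (Suc m) * defect m + 2 * (real (Suc m) + \<nu>) * (\<nu> + 1/2 - a) * wilson (Suc m)"
proof -
  define R where "R = real (Suc m)"
  have m: "real m = R - 1" by (simp add: R_def)
  have "y = 2 * \<nu> + 3/2 - a - x" using nu_eq by simp
  then have "(R + 2*\<nu>) * (R + a + x) * (R + a + y) * (W2 - W1)
      - R * (R - 3/2 + x) * (R - 3/2 + y) * (W1 - W0)
      + 4 * (R + \<nu>) * a * (\<nu> + 1) * W1 = 0 \<Longrightarrow>
     (R + 2 * \<nu>) * ((R + a + x) * (R + a + y) * W2 - (R + x - 1/2) * (R + y - 1/2) * W1)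
     = R * ((R - 1 + a + x) * (R - 1 + a + y) * W1 - (R - 1 + x - 1/2) * (R - 1 + y - 1/2) * W0)
       + 2 * (R + \<nu>) * (\<nu> + 1/2 - a) * W1" for W0 W1 W2
    by (simp only:) algebra
  from this[OF wilson_recurrence[OF refl, of m, folded R_def]]
  show ?thesis unfolding defect_def m R_def[symmetric] by simp
qed

text \<open>
  For \<open>n \<ge> 1\<close> the factors \<open>n + x - 1/2\<close> and \<open>n + y - 1/2\<close> are positive, so nonnegativity passes from \<open>wilson n\<close> and
  \<open>defect n\<close> to \<open>wilson (Suc n)\<close>. At \<open>n = 0\<close> one of them may be negative, and the hyperbola condition steps in.
\<close>

lemma wilson_defect_nonneg: "wilson n \<ge> 0 \<and> wilson (Suc n) \<ge> 0 \<and> defect n \<ge> 0"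
proof (induction n)
  case 0
  have "y = 2 * \<nu> + 3/2 - a - x" using nu_eq by simp
  then have "(a + x) * (a + y) - 2 * a * (\<nu> + 1) = x * y - a / 2"
    by (simp only:) (simp add: algebra_simps power2_eq_square)
  then have "(a + x) * (a + y) * wilson (Suc 0) \<ge> 0" using wilson_1 hyp by simp
  moreover have "(a + x) * (a + y) > 0" using a x y by simp
  ultimately show ?case using wilson_0 defect_0 nu_eq line by (simp add: zero_le_mult_iff)
next
  case (Suc n)
  have "(real (Suc n) + 2 * \<nu>) * defect (Suc n) \<ge> 0"
    unfolding defect_Suc using Suc.IH nu_pos nu_eq line by (intro add_nonneg_nonneg mult_nonneg_nonneg) auto
  moreover have "real (Suc n) + 2 * \<nu> > 0" using nu_pos by simp
  ultimately have D: "defect (Suc n) \<ge> 0" by (simp add: zero_le_mult_iff)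
  have "(real (Suc n) + x - 1/2) * (real (Suc n) + y - 1/2) * wilson (Suc n) \<ge> 0"
    using Suc.IH x y by (intro mult_nonneg_nonneg) auto
  with D have "(real (Suc n) + a + x) * (real (Suc n) + a + y) * wilson (Suc (Suc n)) \<ge> 0"
    unfolding defect_def by linarith
  moreover have "(real (Suc n) + a + x) * (real (Suc n) + a + y) > 0" using a x y by simp
  ultimately have "wilson (Suc (Suc n)) \<ge> 0" by (simp add: zero_le_mult_iff)
  with D Suc.IH show ?case by simp
qed

text \<open>A crude geometric bound, needed only to interchange the sums in the expansion into squares.\<close>

lemma wilson_bound: "\<exists>K\<ge>1. \<forall>n. wilson n \<le> K ^ n"
proof -
  define \<delta> where "\<delta> = 2 * (\<nu> + 1/2 - a)"
  \<comment> \<open>the summand 2 pays for the bound on the defects, the other one for the bound on \<open>wilson\<close>\<close>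
  define K where "K = 2 + 2 * \<delta> / ((a + x) * (a + y))"
  have d: "\<delta> \<ge> 0" using nu_eq line by (simp add: \<delta>_def)
  have bc: "(a + x) * (a + y) > 0" using a x y by simp
  have K: "K \<ge> 2" using d bc by (simp add: K_def)
  have "wilson n \<le> K ^ n \<and> defect n \<le> 2 * \<delta> * K ^ n" for n
  proof (induction n)
    case 0
    then show ?case using wilson_0 defect_0 d by (simp add: \<delta>_def)
  next
    case (Suc n)
    define B where "B = (real n + a + x) * (real n + a + y)"
    have B: "B \<ge> (a + x) * (a + y)" unfolding B_def using a x y by (intro mult_mono) auto
    have le: "(real n + x - 1/2) * (real n + y - 1/2) * wilson n \<le> B * wilson n"
    proof (rule mult_right_mono)
      show "(real n + x - 1/2) * (real n + y - 1/2) \<le> B"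
      proof (cases "n = 0")
        case True
        have "(a + x) * (a + y) - (x - 1/2) * (y - 1/2) = (a + 1/2) * (x + y + a - 1/2)" by (simp add: algebra_simps)
        moreover have "\<dots> \<ge> 0" using a x y by (intro mult_nonneg_nonneg) auto
        ultimately show ?thesis using True by (simp add: B_def)
      next
        case False
        then have "real n \<ge> 1" by simp
        then show ?thesis unfolding B_def using a x y by (intro mult_mono) auto
      qed
    qed (use wilson_defect_nonneg in simp)
    have "B * wilson (Suc n) = defect n + (real n + x - 1/2) * (real n + y - 1/2) * wilson n"
      by (simp add: defect_def B_def)
    also have "\<dots> \<le> 2 * \<delta> * K ^ n + B * wilson n" using Suc.IH le by linarith
    also have "\<dots> \<le> 2 * \<delta> * K ^ n * (B / ((a + x) * (a + y))) + B * K ^ n"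
    proof (rule add_mono)
      have "2 * \<delta> * K ^ n * 1 \<le> 2 * \<delta> * K ^ n * (B / ((a + x) * (a + y)))"
        using d K B bc by (intro mult_left_mono) auto
      then show "2 * \<delta> * K ^ n \<le> 2 * \<delta> * K ^ n * (B / ((a + x) * (a + y)))" by simp
      show "B * wilson n \<le> B * K ^ n" using Suc.IH B bc by (intro mult_left_mono) auto
    qed
    also have "\<dots> = B * (K ^ n * (1 + 2 * \<delta> / ((a + x) * (a + y))))" by (simp add: algebra_simps)
    also have "\<dots> \<le> B * (K ^ n * K)" using B bc K by (intro mult_left_mono) (auto simp: K_def)
    finally have W: "wilson (Suc n) \<le> K ^ Suc n" using B bc by (simp add: mult.commute)
    define R where "R = real (Suc n)"
    have Rp: "R + 2 * \<nu> > 0" using nu_pos by (simp add: R_def)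
    have "(R + 2 * \<nu>) * defect (Suc n) = R * defect n + (R + \<nu>) * \<delta> * wilson (Suc n)"
      unfolding R_def \<delta>_def defect_Suc by (simp only: ac_simps)
    also have "\<dots> \<le> (R + 2 * \<nu>) * (2 * \<delta> * K ^ n) + (R + 2 * \<nu>) * \<delta> * K ^ Suc n"
    proof (rule add_mono)
      have "R * defect n \<le> (R + 2 * \<nu>) * defect n"
        using wilson_defect_nonneg[of n] nu_pos by (intro mult_right_mono) auto
      also have "\<dots> \<le> (R + 2 * \<nu>) * (2 * \<delta> * K ^ n)" using Suc.IH Rp by (intro mult_left_mono) auto
      finally show "R * defect n \<le> (R + 2 * \<nu>) * (2 * \<delta> * K ^ n)" .
      show "(R + \<nu>) * \<delta> * wilson (Suc n) \<le> (R + 2 * \<nu>) * \<delta> * K ^ Suc n"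
        using wilson_defect_nonneg[of n] nu_pos d W Rp by (intro mult_mono mult_nonneg_nonneg) (auto simp: R_def)
    qed
    also have "\<dots> \<le> (R + 2 * \<nu>) * (\<delta> * K ^ Suc n) + (R + 2 * \<nu>) * \<delta> * K ^ Suc n"
    proof -
      have "2 * K ^ n \<le> K * K ^ n" using K by (intro mult_right_mono) auto
      then have "\<delta> * (2 * K ^ n) \<le> \<delta> * (K * K ^ n)" using d by (rule mult_left_mono)
      then show ?thesis using Rp by (intro add_right_mono mult_left_mono) (auto simp: ac_simps)
    qed
    also have "\<dots> = (R + 2 * \<nu>) * (2 * \<delta> * K ^ Suc n)" by (simp add: algebra_simps)
    finally have "defect (Suc n) \<le> 2 * \<delta> * K ^ Suc n" using Rp by simp
    with W show ?case by simp
  qed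
  then show ?thesis using K by (intro exI[of _ K]) auto
qed

lemma moment_inversion: "(\<Sum>n\<le>N. inv_weight \<nu> N n * wilson n) = wilson_moment N"
proof -
  have "(\<Sum>n\<le>N. inv_weight \<nu> N n * wilson n) = (\<Sum>n\<le>N. \<Sum>k\<le>N. inv_weight \<nu> N n * inv_basis \<nu> n k * wilson_moment k)"
    by (rule sum.cong[OF refl]) (simp add: wilson_extend[of _ N] wilson_term_def sum_distrib_left mult.assoc)
  also have "\<dots> = (\<Sum>k\<le>N. (\<Sum>n\<le>N. inv_weight \<nu> N n * inv_basis \<nu> n k) * wilson_moment k)"
    by (subst sum.swap) (simp add: sum_distrib_right)
  also have "\<dots> = (\<Sum>k\<le>N. (if k = N then 1 else 0) * wilson_moment k)"
    by (rule sum.cong[OF refl]) (simp add: inverse_pair[OF nu_pos])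
  also have "\<dots> = (\<Sum>k\<le>N. if k = N then wilson_moment k else 0)"
    by (rule sum.cong) auto
  also have "\<dots> = wilson_moment N" by simp
  finally show ?thesis .
qed

end
end

section \<open>Expansion of 1F2 into squares\<close>

text \<open>
  Vandermonde's identity in disguise: \<open>(c)_k / (c)_i\<close> is a factorial times a binomial coefficient with upper
  entry \<open>c + k - 1\<close>.
\<close>

lemma sum_binomial_inverse_pochhammer:
  fixes c :: real
  assumes "c > 0"
  shows "(\<Sum>i\<le>k. 1 / (pochhammer c i * fact i) * (1 / (pochhammer c (k - i) * fact (k - i))))
     = pochhammer (2 * c + real k - 1) k / (fact k * (pochhammer c k)\<^sup>2)"
proof -
  have g: "((c + real k - 1) gchoose (k - i)) = pochhammer c k / pochhammer c i / fact (k - i)" if "i \<le> k" for i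
  proof -
    have "pochhammer c k = pochhammer c i * pochhammer (c + real i) (k - i)"
      using pochhammer_product[OF that, of c] by simp
    moreover have "pochhammer c i > 0" using assms by (rule pochhammer_pos)
    moreover have "c + real k - 1 - real (k - i) + 1 = c + real i" using that by (simp add: of_nat_diff)
    ultimately show ?thesis unfolding gbinomial_pochhammer' by simp
  qed
  have pk: "pochhammer c k > 0" using assms by (rule pochhammer_pos)
  have "(\<Sum>i\<le>k. 1 / (pochhammer c i * fact i) * (1 / (pochhammer c (k - i) * fact (k - i))))
      = (\<Sum>i\<le>k. ((c + real k - 1) gchoose i) * ((c + real k - 1) gchoose (k - i))) / (pochhammer c k)\<^sup>2"
    unfolding sum_divide_distrib
  proof (rule sum.cong)
    fix i assume "i \<in> {..k}"
    then have i: "i \<le> k" by simp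
    show "1 / (pochhammer c i * fact i) * (1 / (pochhammer c (k - i) * fact (k - i))) =
        ((c + real k - 1) gchoose i) * ((c + real k - 1) gchoose (k - i)) / (pochhammer c k)\<^sup>2"
      using g[OF i] g[of "k - i"] i pk by (simp add: power2_eq_square field_simps)
  qed simp
  also have "\<dots> = ((2 * (c + real k - 1)) gchoose k) / (pochhammer c k)\<^sup>2"
    using gbinomial_Vandermonde[of "c + real k - 1" "c + real k - 1" k] by (simp only: atMost_atLeast0 mult_2)
  also have "\<dots> = pochhammer (2 * c + real k - 1) k / (fact k * (pochhammer c k)\<^sup>2)"
    unfolding gbinomial_pochhammer' by (simp add: algebra_simps)
  finally show ?thesis .
qed

text \<open>The coefficient of \<open>z^k\<close> in the square of \<open>0F1(c; z)\<close>.\<close>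

definition square_coeff :: "real \<Rightarrow> nat \<Rightarrow> real" where
  "square_coeff c k = pochhammer (2 * c + real k - 1) k / (fact k * (pochhammer c k)\<^sup>2)"

lemma pochhammer_ge_1: "c \<ge> 1 \<Longrightarrow> pochhammer c k \<ge> (1::real)"
proof (induction k)
  case (Suc k)
  then have "1 * 1 \<le> pochhammer c k * (c + real k)" by (intro mult_mono) auto
  then show ?case by (simp add: pochhammer_Suc)
qed simp

lemma square_coeff_bounds:
  assumes "c \<ge> 1"
  shows "0 \<le> square_coeff c k" and "square_coeff c k \<le> 2 ^ k / fact k"
proof -
  have eq: "square_coeff c k = (\<Sum>i\<le>k. 1 / (pochhammer c i * fact i) * (1 / (pochhammer c (k - i) * fact (k - i))))"
    unfolding square_coeff_def using sum_binomial_inverse_pochhammer[of c k] assms by simp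
  have p: "pochhammer c i \<ge> 1" for i using assms by (rule pochhammer_ge_1)
  have p0: "pochhammer c i \<ge> 0" for i using p[of i] by linarith
  show "0 \<le> square_coeff c k" unfolding eq using p0 by (intro sum_nonneg mult_nonneg_nonneg) auto
  have b: "1 / (pochhammer c i * fact i) \<le> 1 / fact i" for i
  proof -
    have "1 * fact i \<le> pochhammer c i * fact i" using p by (intro mult_right_mono) auto
    then show ?thesis by (intro divide_left_mono) (auto simp: zero_less_mult_iff intro: less_le_trans[OF zero_less_one p])
  qed
  have "square_coeff c k \<le> (\<Sum>i\<le>k. 1 / fact i * (1 / fact (k - i)))"
    unfolding eq using p0 by (intro sum_mono mult_mono b) auto
  also have "\<dots> = (\<Sum>i\<le>k. real (k choose i)) / fact k"
    unfolding sum_divide_distrib by (rule sum.cong) (auto simp: binomial_fact)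
  also have "\<dots> = 2 ^ k / fact k"
    using choose_row_sum[of k] by (metis of_nat_numeral of_nat_power of_nat_sum)
  finally show "square_coeff c k \<le> 2 ^ k / fact k" .
qed

lemma square_series_nonneg:
  assumes "c \<ge> 1"
  shows "\<exists>s\<ge>0. (\<lambda>k. square_coeff c k * z ^ k) sums s"
proof -
  define h where "h k = z ^ k / (pochhammer c k * fact k)" for k
  have p: "pochhammer c i \<ge> 1" for i using assms by (rule pochhammer_ge_1)
  have "summable (\<lambda>k. norm (h k))"
  proof (rule summable_comparison_test)
    show "\<exists>N. \<forall>n\<ge>N. norm (norm (h n)) \<le> \<bar>z\<bar> ^ n / fact n"
    proof (intro exI allI impI)
      fix n
      have "1 * fact n \<le> pochhammer c n * fact n" using p by (intro mult_right_mono) auto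
      then have "\<bar>z\<bar> ^ n / (pochhammer c n * fact n) \<le> \<bar>z\<bar> ^ n / fact n"
        by (intro divide_left_mono) (auto simp: zero_less_mult_iff intro: less_le_trans[OF zero_less_one p])
      then show "norm (norm (h n)) \<le> \<bar>z\<bar> ^ n / fact n"
        using order.trans[OF zero_le_one p] by (simp add: h_def power_abs abs_mult)
    qed
    show "summable (\<lambda>n. \<bar>z\<bar> ^ n / fact n)"
      using exp_sums_real[of "\<bar>z\<bar>"] by (simp add: sums_iff)
  qed
  then have "(\<lambda>k. \<Sum>i\<le>k. h i * h (k - i)) sums ((\<Sum>k. h k) * (\<Sum>k. h k))"
    by (intro Cauchy_product_sums)
  moreover have "(\<Sum>i\<le>k. h i * h (k - i)) = square_coeff c k * z ^ k" for k
  proof -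
    have "(\<Sum>i\<le>k. h i * h (k - i)) = (\<Sum>i\<le>k. 1 / (pochhammer c i * fact i) * (1 / (pochhammer c (k - i) * fact (k - i)))) * z ^ k"
      unfolding sum_distrib_right
    proof (rule sum.cong)
      fix i assume "i \<in> {..k}"
      then have "z ^ k = z ^ i * z ^ (k - i)" by (simp flip: power_add)
      then show "h i * h (k - i) = 1 / (pochhammer c i * fact i) * (1 / (pochhammer c (k - i) * fact (k - i))) * z ^ k"
        by (simp add: h_def)
    qed simp
    then show ?thesis using sum_binomial_inverse_pochhammer[of c k] assms by (simp add: square_coeff_def)
  qed
  ultimately show ?thesis by (intro exI[of _ "(\<Sum>k. h k) * (\<Sum>k. h k)"]) auto
qed

text \<open>The positive factor by which \<open>wilson n\<close> is multiplied in the expansion of \<open>1F2\<close> into squares.\<close>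

definition square_weight :: "real \<Rightarrow> nat \<Rightarrow> real" where
  "square_weight \<nu> n = (1/4) ^ n * pochhammer (\<nu> + 1/2) n / (pochhammer (\<nu> + 1) n * fact n * pochhammer (2 * \<nu> + real n) n)"

lemma square_weight_bounds:
  assumes "\<nu> > 0"
  shows "0 \<le> square_weight \<nu> n" and "square_weight \<nu> n \<le> (1/4) ^ n / fact n"
proof -
  have p1: "pochhammer (\<nu> + 1/2) n > 0" "pochhammer (\<nu> + 1) n > 0" "pochhammer (2 * \<nu> + real n) n > 0"
    using assms by (auto intro!: pochhammer_pos)
  then show "0 \<le> square_weight \<nu> n" by (simp add: square_weight_def)
  have le: "pochhammer (\<nu> + 1/2) n \<le> pochhammer (\<nu> + 1) n"
    unfolding pochhammer_prod using assms by (intro prod_mono) auto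
  have ge: "pochhammer (2 * \<nu> + real n) n \<ge> 1"
    by (cases "n = 0") (use assms in \<open>auto intro!: pochhammer_ge_1\<close>)
  have "pochhammer (\<nu> + 1/2) n * 1 \<le> pochhammer (\<nu> + 1) n * pochhammer (2 * \<nu> + real n) n"
    using le ge p1 by (intro mult_mono) auto
  then have "(1/4) ^ n / fact n * (pochhammer (\<nu> + 1/2) n / (pochhammer (\<nu> + 1) n * pochhammer (2 * \<nu> + real n) n)) \<le> (1/4) ^ n / fact n * 1"
    using p1 by (intro mult_left_mono) auto
  then show "square_weight \<nu> n \<le> (1/4) ^ n / fact n" by (simp add: square_weight_def field_simps)
qed

text \<open>
  Matches the inverse weights with the coefficients of the squares. The duplication formula for the
  Pochhammer symbol turns \<open>(2 u)_{2k}\<close> into a product of two symbols.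
\<close>

lemma square_expansion_coeff:
  assumes nu: "\<nu> > 0"
  shows "pochhammer (\<nu> + 1/2) (n + k) / (pochhammer (\<nu> + 1) (n + k) * fact (n + k)) * inv_weight \<nu> (n + k) n * (-1/4) ^ (n + k)
     = square_weight \<nu> n * (square_coeff (\<nu> + real n + 1) k * (-1/16) ^ k)"
proof -
  define u where "u = \<nu> + real n + 1/2"
  have e1: "pochhammer (\<nu> + 1/2) (n + k) = pochhammer (\<nu> + 1/2) n * pochhammer u k"
    using pochhammer_product'[of "\<nu> + 1/2" n k] by (simp add: u_def add_ac)
  have e2: "pochhammer (\<nu> + 1) (n + k) = pochhammer (\<nu> + 1) n * pochhammer (u + 1/2) k"
    using pochhammer_product'[of "\<nu> + 1" n k] by (simp add: u_def add_ac)
  have e3: "pochhammer (2 * \<nu> + real n) (Suc (n + k)) = pochhammer (2 * \<nu> + real n) n * ((2 * \<nu> + 2 * real n) * pochhammer (2 * u) k)"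
    using pochhammer_product'[of "2 * \<nu> + real n" n "Suc k"] pochhammer_rec[of "2 * \<nu> + 2 * real n" k]
    by (simp add: u_def add_ac)
  have e4: "pochhammer (2 * u) k * pochhammer (2 * u + real k) k = 4 ^ k * pochhammer u k * pochhammer (u + 1/2) k"
  proof -
    have "pochhammer (2 * u) (2 * k) = pochhammer (2 * u) k * pochhammer (2 * u + real k) k"
      using pochhammer_product'[of "2 * u" k k] by (simp only: mult_2)
    moreover have "real (2 ^ (2 * k)) = 4 ^ k" by (simp add: power_mult)
    ultimately show ?thesis using pochhammer_double[of u k] by simp
  qed
  have up: "u > 0" using nu by (simp add: u_def)
  have pos: "pochhammer (\<nu> + 1) n > 0" "pochhammer (u + 1/2) k > 0" "pochhammer (2 * \<nu> + real n) n > 0"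
     "pochhammer (2 * u) k > 0" "2 * \<nu> + 2 * real n > 0"
    using nu up by (auto intro!: pochhammer_pos)
  have e5: "square_coeff (\<nu> + real n + 1) k = 4 ^ k * pochhammer u k / (pochhammer (2 * u) k * fact k * pochhammer (u + 1/2) k)"
  proof -
    have "2 * (\<nu> + real n + 1) + real k - 1 = 2 * u + real k" "\<nu> + real n + 1 = u + 1/2" by (simp_all add: u_def)
    then have "square_coeff (\<nu> + real n + 1) k = pochhammer (2 * u + real k) k / (fact k * (pochhammer (u + 1/2) k)\<^sup>2)"
      by (simp add: square_coeff_def)
    also have "pochhammer (2 * u + real k) k = 4 ^ k * pochhammer u k * pochhammer (u + 1/2) k / pochhammer (2 * u) k"
      using e4 pos(4) by (simp add: field_simps)
    finally show ?thesis using pos by (simp add: power2_eq_square)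
  qed
  have b: "real ((n + k) choose n) = fact (n + k) / (fact n * fact k)"
    by (subst binomial_fact) simp_all
  have s: "(-1::real)^n * (-1/4)^(n+k) = (1/4)^n * (-1/4)^k"
    by (simp add: power_add flip: power_mult_distrib)
  have s2: "(-1/4)^k = (4::real)^k * (-1/16)^k" by (simp flip: power_mult_distrib)
  have alg: "A * B / (C * D * f) * (sg * (f / (g * h)) * w / (E * (w * G))) * r
      = (sg * r) * (A * B / (C * D * g * h * E * G))"
    if "f > 0" "w > 0" for A B C D f sg g h w E G r :: real
    using that by (simp add: mult_ac)
  show ?thesis
    unfolding inv_weight_def e1 e2 e3 b e5 square_weight_def
    by (subst alg) (use pos s s2 in \<open>simp_all add: mult_ac\<close>)
qed

lemma triangle_sum_swap:
  "(\<Sum>N\<le>M. \<Sum>n\<le>N. g n (N - n)) = (\<Sum>n\<le>M. \<Sum>i\<le>M - n. g n i)" for g :: "nat \<Rightarrow> nat \<Rightarrow> real"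
proof -
  have "(\<Sum>N\<le>M. \<Sum>n\<le>N. g n (N - n)) = sum (\<lambda>(i,j). g i j) {(i,j). i + j \<le> M}"
    by (rule sum.triangle_reindex_eq[symmetric])
  also have "{(i,j). i + j \<le> M} = Sigma {..M} (\<lambda>i. {..M - i})" by auto
  also have "sum (\<lambda>(i,j). g i j) \<dots> = (\<Sum>n\<le>M. \<Sum>i\<le>M - n. g n i)"
    by (rule sum.Sigma[symmetric]) auto
  finally show ?thesis .
qed

text \<open>
  The coefficient of \<open>T^N\<close> is a finite sum over the squares with \<open>n \<le> N\<close>. Partial sums are therefore
  sums over triangles, and Tannery's theorem lets the truncated squares converge to full ones.
\<close>

theorem hyp1F2_nonneg:
  fixes a x y T :: real
  assumes a: "a > 1/2" and x: "x > 0" and y: "y > 0" and line: "x + y \<ge> a + 1/2" and hyp: "2 * x * y \<ge> a"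
    and T: "T \<ge> 0"
  shows "\<exists>s\<ge>0. (\<lambda>N. pochhammer a N / (pochhammer (a + x) N * pochhammer (a + y) N * fact N) * (- T / 4) ^ N) sums s"
proof -
  define \<nu> where "\<nu> = (x + y + a - 3/2) / 2"
  have nu_eq: "2 * \<nu> = x + y + a - 3/2" by (simp add: \<nu>_def)
  have nu: "\<nu> > 0" using nu_eq line a by simp
  define w where "w = wilson a x y \<nu>"
  have w0: "w n \<ge> 0" for n unfolding w_def using wilson_defect_nonneg[OF a x y line hyp nu_eq, of n] by simp
  obtain K where K: "K \<ge> 1" "\<And>n. w n \<le> K ^ n"
    unfolding w_def using wilson_bound[OF a x y line hyp nu_eq] by blast
  define f where "f N = pochhammer a N / (pochhammer (a + x) N * pochhammer (a + y) N * fact N) * (- T / 4) ^ N" for N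
  define \<kappa> where "\<kappa> n = square_weight \<nu> n * w n * T ^ n" for n
  define s where "s n i = square_coeff (\<nu> + real n + 1) i * (- T / 16) ^ i" for n i
  have f_eq: "f N = (\<Sum>n\<le>N. \<kappa> n * s n (N - n))" for N
  proof -
    define c where "c = pochhammer (\<nu> + 1/2) N / (pochhammer (\<nu> + 1) N * fact N)"
    have "pochhammer (\<nu> + 1/2) N > 0" "pochhammer (\<nu> + 1) N > 0" using nu by (auto intro!: pochhammer_pos)
    moreover have "(- T / 4) ^ N = (-1/4) ^ N * T ^ N" by (simp flip: power_mult_distrib)
    ultimately have "f N = c * (-1/4) ^ N * T ^ N * wilson_moment a x y \<nu> N"
    proof -
      have alg: "A / (B * C * F) * (r * t) = h / (g * F) * r * t * (g * A / (h * B * C))"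
        if "h > 0" "g > 0" for A B C F r t h g :: real using that by (simp add: field_simps)
      show ?thesis
        unfolding f_def c_def wilson_moment_def \<open>(- T / 4) ^ N = (-1/4) ^ N * T ^ N\<close>
        by (rule alg) fact+
    qed
    also have "\<dots> = (\<Sum>n\<le>N. c * (-1/4) ^ N * T ^ N * (inv_weight \<nu> N n * w n))"
      unfolding moment_inversion[OF a x y line hyp nu_eq, symmetric] w_def sum_distrib_left ..
    also have "\<dots> = (\<Sum>n\<le>N. \<kappa> n * s n (N - n))"
    proof (rule sum.cong)
      fix n assume "n \<in> {..N}"
      then obtain k where k: "N = n + k" using le_iff_add by auto
      have T16: "(- T / 16) ^ k = (-1/16) ^ k * T ^ k" by (simp flip: power_mult_distrib)
      have "c * (-1/4) ^ N * T ^ N * (inv_weight \<nu> N n * w n) = (c * inv_weight \<nu> N n * (-1/4) ^ N) * (w n * (T ^ n * T ^ k))"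
        by (simp add: k power_add)
      also have "c * inv_weight \<nu> N n * (-1/4) ^ N = square_weight \<nu> n * (square_coeff (\<nu> + real n + 1) k * (-1/16) ^ k)"
        unfolding c_def k by (rule square_expansion_coeff[OF nu])
      finally show "c * (-1/4) ^ N * T ^ N * (inv_weight \<nu> N n * w n) = \<kappa> n * s n (N - n)"
        unfolding \<kappa>_def s_def T16[symmetric] k by (simp only: T16 add_diff_cancel_left' mult_ac)
    qed simp
    finally show ?thesis .
  qed
  define b where "b n = \<kappa> n * (\<Sum>i. s n i)" for n
  \<comment> \<open>the part of the \<open>n\<close>-th square that enters the partial sum up to \<open>T^M\<close>\<close>
  define A where "A n M = (if n \<le> M then \<kappa> n * (\<Sum>i\<le>M - n. s n i) else 0)" for n M
  have sc: "\<nu> + real n + 1 \<ge> 1" for n using nu by simp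
  have s_sums: "\<exists>t\<ge>0. s n sums t" for n
    unfolding s_def by (rule square_series_nonneg[OF sc])
  have k0: "\<kappa> n \<ge> 0" for n unfolding \<kappa>_def using square_weight_bounds[OF nu] w0 T by simp
  have b0: "b n \<ge> 0" for n
    using s_sums[of n] k0[of n] by (auto simp: b_def sums_iff)
  have lim: "(\<lambda>M. A n M) \<longlonglongrightarrow> b n" for n
  proof -
    have "s n sums (\<Sum>i. s n i)" using s_sums[of n] by (auto simp: sums_iff)
    then have "(\<lambda>M. \<Sum>i\<le>M. s n i) \<longlonglongrightarrow> (\<Sum>i. s n i)" by (simp add: sums_def_le)
    then have "(\<lambda>M. \<kappa> n * (\<Sum>i\<le>M. s n i)) \<longlonglongrightarrow> b n" unfolding b_def by (intro tendsto_intros)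
    then have "(\<lambda>M. A n (M + n)) \<longlonglongrightarrow> b n" by (simp add: A_def)
    then show ?thesis by (rule LIMSEQ_offset)
  qed
  define B where "B n = (K * T / 4) ^ n / fact n * exp (T / 8)" for n
  have bound: "norm (A n M) \<le> B n" for n M
  proof (cases "n \<le> M")
    case True
    have "\<kappa> n \<le> (1/4) ^ n / fact n * K ^ n * T ^ n"
      unfolding \<kappa>_def using square_weight_bounds[OF nu, of n] w0[of n] K T
      by (intro mult_mono mult_nonneg_nonneg) auto
    also have "\<dots> = (K * T / 4) ^ n / fact n" by (simp add: power_mult_distrib power_divide)
    finally have k: "\<kappa> n \<le> (K * T / 4) ^ n / fact n" .
    have "\<bar>\<Sum>i\<le>M - n. s n i\<bar> \<le> (\<Sum>i\<le>M - n. \<bar>s n i\<bar>)" by (rule sum_abs)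
    also have "\<dots> \<le> (\<Sum>i\<le>M - n. (T / 8) ^ i / fact i)"
    proof (rule sum_mono)
      fix i
      have "\<bar>s n i\<bar> = square_coeff (\<nu> + real n + 1) i * (T / 16) ^ i"
        using square_coeff_bounds(1)[OF sc] T by (simp add: s_def abs_mult power_abs)
      also have "\<dots> \<le> 2 ^ i / fact i * (T / 16) ^ i"
        using square_coeff_bounds(2)[OF sc] T by (intro mult_right_mono) auto
      also have "\<dots> = (2 * (T / 16)) ^ i / fact i" by (simp only: power_mult_distrib times_divide_eq_left)
      also have "2 * (T / 16) = T / 8" by simp
      finally show "\<bar>s n i\<bar> \<le> (T / 8) ^ i / fact i" .
    qed
    also have "\<dots> \<le> exp (T / 8)"
    proof -
      have "(\<lambda>i. (T / 8) ^ i / fact i) sums exp (T / 8)"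
        by (rule exp_sums_real)
      then show ?thesis using T sum_le_suminf[of "\<lambda>i. (T / 8) ^ i / fact i" "{..M - n}"] by (simp add: sums_iff)
    qed
    finally have "\<bar>\<Sum>i\<le>M - n. s n i\<bar> \<le> exp (T / 8)" .
    then have "\<kappa> n * \<bar>\<Sum>i\<le>M - n. s n i\<bar> \<le> (K * T / 4) ^ n / fact n * exp (T / 8)"
      using K T by (intro mult_mono k) auto
    then show ?thesis using k0[of n] True by (simp add: A_def B_def abs_mult)
  next
    case False
    then show ?thesis using K T by (simp add: A_def B_def)
  qed
  have sB: "summable B"
    unfolding B_def using exp_sums_real[of "K * T / 4"] by (intro summable_mult2) (simp add: sums_iff)
  have "(\<lambda>M. \<Sum>n. A n M) \<longlonglongrightarrow> (\<Sum>n. b n)" and sb: "summable (\<lambda>n. norm (b n))"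
    using tannerys_theorem[of A b sequentially B, OF lim _ sB] bound by (auto intro: always_eventually)
  moreover have "(\<Sum>n. A n M) = (\<Sum>N\<le>M. f N)" for M
  proof -
    have "(\<Sum>n. A n M) = (\<Sum>n\<le>M. A n M)" by (rule suminf_finite) (auto simp: A_def)
    also have "\<dots> = (\<Sum>n\<le>M. \<Sum>i\<le>M - n. \<kappa> n * s n i)" by (simp add: A_def sum_distrib_left)
    also have "\<dots> = (\<Sum>N\<le>M. f N)" unfolding f_eq by (rule triangle_sum_swap[symmetric])
    finally show ?thesis .
  qed
  ultimately have "f sums (\<Sum>n. b n)" by (simp add: sums_def_le)
  moreover have "(\<Sum>n. b n) \<ge> 0"
    using sb b0 by (intro suminf_nonneg) (auto dest: summable_norm_cancel)
  ultimately show ?thesis unfolding f_def by blast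
qed

section \<open>Gaussian moments and moments on the unit ball\<close>

lemma nn_integral_lborel_affine:
  fixes f :: "'a::euclidean_space \<Rightarrow> ennreal" and c :: real
  assumes c: "c \<noteq> 0" and [measurable]: "f \<in> borel_measurable borel"
  shows "(\<integral>\<^sup>+x. f x \<partial>lborel) = ennreal (\<bar>c\<bar> ^ DIM('a)) * (\<integral>\<^sup>+x. f (t + c *\<^sub>R x) \<partial>lborel)"
  by (subst lborel_affine[OF c, of t])
     (simp add: nn_integral_density nn_integral_distr nn_integral_cmult)

lemma integral_lborel_affine:
  fixes f :: "'a::euclidean_space \<Rightarrow> real" and c :: real
  assumes c: "c \<noteq> 0" and [measurable]: "f \<in> borel_measurable borel"
  shows "(\<integral>x. f x \<partial>lborel) = \<bar>c\<bar> ^ DIM('a) * (\<integral>x. f (t + c *\<^sub>R x) \<partial>lborel)"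
  by (subst lborel_affine[OF c, of t])
     (simp add: integral_density integral_distr)

lemma integrable_lborel_affine:
  fixes f :: "'a::euclidean_space \<Rightarrow> real" and c :: real
  assumes f: "integrable lborel f" and c: "c \<noteq> 0"
  shows "integrable lborel (\<lambda>x. f (t + c *\<^sub>R x))"
proof -
  have [measurable]: "f \<in> borel_measurable borel" using f by auto
  have "integrable (density (distr lborel borel (\<lambda>x. t + c *\<^sub>R x)) (\<lambda>_. \<bar>c\<bar> ^ DIM('a))) f"
    using f by (subst (asm) lborel_affine[OF c, of t])
  then show ?thesis using c by (simp add: integrable_density integrable_distr_eq)
qed

text \<open>This exhibits \<open>exp (- r)\<close> as a mixture of the truncated powers \<open>(s - r)_+^l\<close>.\<close>

lemma shifted_gamma_nn_integral:
  assumes l: "l > -1" and r: "r \<ge> 0"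
  shows "(\<integral>\<^sup>+s. ennreal (indicator {0<..} s * (exp (- s) * max 0 (s - r) powr l)) \<partial>lborel) = ennreal (exp (- r) * Gamma (l + 1))"
proof -
  have "(\<integral>\<^sup>+s. ennreal (indicator {0<..} s * (exp (- s) * max 0 (s - r) powr l)) \<partial>lborel)
     = (\<integral>\<^sup>+s. ennreal (indicator {0<..} (r + 1 * s) * (exp (- (r + 1 * s)) * max 0 (r + 1 * s - r) powr l)) \<partial>lborel)"
    by (subst nn_integral_real_affine[where c = 1 and t = r]) auto
  also have "\<dots> = (\<integral>\<^sup>+s. ennreal (exp (- r)) * ennreal (indicator {0..} s * s powr (l + 1 - 1) / exp s) \<partial>lborel)"
  proof (rule nn_integral_cong)
    fix s :: real
    show "ennreal (indicator {0<..} (r + 1 * s) * (exp (- (r + 1 * s)) * max 0 (r + 1 * s - r) powr l))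
        = ennreal (exp (- r)) * ennreal (indicator {0..} s * s powr (l + 1 - 1) / exp s)"
    proof -
      have e: "exp (- (r + 1 * s)) = exp (- r) * inverse (exp s)" by (simp add: exp_diff divide_inverse)
      show ?thesis unfolding e using r by (cases "s > 0"; cases "s = 0")
        (auto simp: indicator_def max_def divide_inverse mult_ac simp flip: ennreal_mult)
    qed
  qed
  also have "\<dots> = ennreal (exp (- r)) * ennreal (Gamma (l + 1))"
    using Gamma_conv_nn_integral_real[of "l + 1"] l by (simp add: nn_integral_cmult)
  also have "\<dots> = ennreal (exp (- r) * Gamma (l + 1))" using l by (simp add: ennreal_mult' Gamma_real_pos less_imp_le)
  finally show ?thesis .
qed

definition ball_kernel :: "real \<Rightarrow> nat \<Rightarrow> 'a::euclidean_space \<Rightarrow> 'a \<Rightarrow> real" where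
  "ball_kernel l k \<xi> x = max 0 (1 - (norm x)\<^sup>2) powr l * (x \<bullet> \<xi>) ^ (2 * k)"

definition gauss_moment :: "nat \<Rightarrow> 'a::euclidean_space \<Rightarrow> real" where
  "gauss_moment k \<xi> = (\<integral>x. exp (- (norm x)\<^sup>2) * (x \<bullet> \<xi>) ^ (2 * k) \<partial>lborel)"

lemma ball_kernel_measurable [measurable]: "ball_kernel l k \<xi> \<in> borel_measurable borel"
  unfolding ball_kernel_def[abs_def] by measurable

lemma ball_kernel_nonneg: "ball_kernel l k \<xi> x \<ge> 0"
  by (simp add: ball_kernel_def)

lemma ball_kernel_le:
  assumes "l \<ge> 0"
  shows "ball_kernel l k \<xi> x \<le> indicator (cball 0 1) x * norm \<xi> ^ (2 * k)"
proof (cases "norm x \<le> 1")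
  case True
  have "\<bar>x \<bullet> \<xi>\<bar> \<le> norm x * norm \<xi>" by (rule Cauchy_Schwarz_ineq2)
  also have "\<dots> \<le> 1 * norm \<xi>" using True by (intro mult_right_mono) auto
  finally have "\<bar>x \<bullet> \<xi>\<bar> ^ (2 * k) \<le> norm \<xi> ^ (2 * k)" by (intro power_mono) auto
  moreover have "max 0 (1 - (norm x)\<^sup>2) powr l \<le> 1" using assms by (intro powr_le1) auto
  ultimately have "max 0 (1 - (norm x)\<^sup>2) powr l * (x \<bullet> \<xi>) ^ (2 * k) \<le> 1 * norm \<xi> ^ (2 * k)"
    by (intro mult_mono) (auto simp: power_even_abs)
  then show ?thesis using True by (simp add: ball_kernel_def)
next
  case False
  then have "1 < (norm x)\<^sup>2" by (simp add: power_less_one_iff less_1_mult power2_eq_square)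
  then show ?thesis by (simp add: ball_kernel_def max_def)
qed

lemma ball_kernel_integrable:
  assumes "l \<ge> 0"
  shows "integrable lborel (ball_kernel l k \<xi>)"
proof (rule Bochner_Integration.integrable_bound)
  show "integrable lborel (\<lambda>x::'a. indicator (cball 0 1) x * norm \<xi> ^ (2 * k))"
    using emeasure_bounded_finite[OF bounded_cball[of "0::'a" 1]]
    by (intro integrable_mult_left integrable_real_indicator) auto
  show "AE x in lborel. norm (ball_kernel l k \<xi> x) \<le> norm (indicator (cball 0 1) x * norm \<xi> ^ (2 * k))"
    using ball_kernel_le[OF assms, of k \<xi>] ball_kernel_nonneg[of l k \<xi>] by (intro AE_I2) auto
qed simp

text \<open>
  The integral of \<open>exp (- s) (s - |x|^2)_+^l (x \<bullet> \<xi>)^{2k}\<close> over \<open>s\<close> and \<open>x\<close> in both orders: the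
  integral over \<open>s\<close> gives a Gaussian, while rescaling \<open>x\<close> by the square root of \<open>s\<close> gives the ball moment times
  a Gamma integral.
\<close>

lemma ball_gauss_nn_moment:
  fixes \<xi> :: "'a::euclidean_space"
  assumes l: "l \<ge> 0"
  shows "ennreal (Gamma (l + real k + real DIM('a) / 2 + 1)) * (\<integral>\<^sup>+x. ennreal (ball_kernel l k \<xi> x) \<partial>lborel)
    = ennreal (Gamma (l + 1)) * (\<integral>\<^sup>+x. ennreal (exp (- (norm x)\<^sup>2) * (x \<bullet> \<xi>) ^ (2 * k)) \<partial>lborel)"
proof -
  define p where "p = l + real k + real DIM('a) / 2"
  have p: "p \<ge> 0" using l by (simp add: p_def)
  \<comment> \<open>the integrand in both variables\<close>
  define F where "F s x = indicator {0<..} s * (exp (- s) * max 0 (s - (norm x)\<^sup>2) powr l) * (x \<bullet> \<xi>) ^ (2 * k)" for s :: real and x :: 'a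
  have Fmeas: "(\<lambda>(s, x). ennreal (F s x)) \<in> borel_measurable (lborel \<Otimes>\<^sub>M lborel)"
    unfolding F_def by measurable
  have inner1: "(\<integral>\<^sup>+x. ennreal (F s x) \<partial>lborel)
      = ennreal (indicator {0..} s * s powr (p + 1 - 1) / exp s) * (\<integral>\<^sup>+x. ennreal (ball_kernel l k \<xi> x) \<partial>lborel)"
    if s0: "s \<noteq> 0" for s
  proof (cases "s > 0")
    case True
    have [measurable]: "(\<lambda>x. ennreal (F s x)) \<in> borel_measurable borel" unfolding F_def by measurable
    have "(\<integral>\<^sup>+x. ennreal (F s x) \<partial>lborel) = ennreal (\<bar>sqrt s\<bar> ^ DIM('a)) * (\<integral>\<^sup>+x. ennreal (F s (0 + sqrt s *\<^sub>R x)) \<partial>lborel)"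
      using True by (intro nn_integral_lborel_affine) auto
    also have "(\<lambda>x. ennreal (F s (0 + sqrt s *\<^sub>R x))) = (\<lambda>x. ennreal (exp (- s) * (s powr l * s ^ k)) * ennreal (ball_kernel l k \<xi> x))"
    proof
      fix x :: 'a
      have "max 0 (s - (norm (sqrt s *\<^sub>R x))\<^sup>2) = s * max 0 (1 - (norm x)\<^sup>2)"
        using True by (auto simp: power_mult_distrib max_def algebra_simps mult_le_cancel_left)
      moreover have "(sqrt s *\<^sub>R x \<bullet> \<xi>) ^ (2 * k) = s ^ k * (x \<bullet> \<xi>) ^ (2 * k)"
        using True by (simp add: power_mult_distrib power_mult)
      ultimately have "F s (0 + sqrt s *\<^sub>R x) = exp (- s) * (s powr l * s ^ k) * ball_kernel l k \<xi> x"
        using True by (simp add: F_def ball_kernel_def powr_mult)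
      then show "ennreal (F s (0 + sqrt s *\<^sub>R x)) = ennreal (exp (- s) * (s powr l * s ^ k)) * ennreal (ball_kernel l k \<xi> x)"
        using True by (simp add: ennreal_mult' ball_kernel_nonneg)
    qed
    also have "ennreal (\<bar>sqrt s\<bar> ^ DIM('a)) * (\<integral>\<^sup>+x. ennreal (exp (- s) * (s powr l * s ^ k)) * ennreal (ball_kernel l k \<xi> x) \<partial>lborel)
        = ennreal (\<bar>sqrt s\<bar> ^ DIM('a) * (exp (- s) * (s powr l * s ^ k))) * (\<integral>\<^sup>+x. ennreal (ball_kernel l k \<xi> x) \<partial>lborel)"
      using True by (simp add: nn_integral_cmult ennreal_mult' mult.assoc)
    also have "\<bar>sqrt s\<bar> ^ DIM('a) * (exp (- s) * (s powr l * s ^ k)) = indicator {0..} s * s powr (p + 1 - 1) / exp s"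
    proof -
      have "\<bar>sqrt s\<bar> ^ DIM('a) = s powr (real DIM('a) / 2)"
        using True by (simp add: powr_half_sqrt[symmetric] powr_powr flip: powr_realpow)
      moreover have "s ^ k = s powr real k" using True by (simp add: powr_realpow)
      moreover have "s powr p = s powr l * s powr real k * s powr (real DIM('a) / 2)" by (simp add: p_def powr_add)
      ultimately have "\<bar>sqrt s\<bar> ^ DIM('a) * (exp (- s) * (s powr l * s ^ k)) = s powr p * exp (- s)"
        by (simp only: mult_ac)
      then show ?thesis using True by (simp add: exp_minus divide_inverse)
    qed
    finally show ?thesis .
  next
    case False
    then show ?thesis using s0 by (simp add: F_def)
  qed
  have inner2: "(\<integral>\<^sup>+s. ennreal (F s x) \<partial>lborel) = ennreal (Gamma (l + 1)) * ennreal (exp (- (norm x)\<^sup>2) * (x \<bullet> \<xi>) ^ (2 * k))" for x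
  proof -
    have "(\<integral>\<^sup>+s. ennreal (F s x) \<partial>lborel)
       = (\<integral>\<^sup>+s. ennreal ((x \<bullet> \<xi>) ^ (2 * k)) * ennreal (indicator {0<..} s * (exp (- s) * max 0 (s - (norm x)\<^sup>2) powr l)) \<partial>lborel)"
      by (intro nn_integral_cong, subst ennreal_mult'[symmetric]) (simp, simp only: F_def mult.commute)
    also have "\<dots> = ennreal ((x \<bullet> \<xi>) ^ (2 * k)) * ennreal (exp (- (norm x)\<^sup>2) * Gamma (l + 1))"
      using l by (subst nn_integral_cmult) (auto simp: shifted_gamma_nn_integral)
    also have "\<dots> = ennreal (Gamma (l + 1)) * ennreal (exp (- (norm x)\<^sup>2) * (x \<bullet> \<xi>) ^ (2 * k))"
    proof -
      have "ennreal q * ennreal (E * G) = ennreal G * ennreal (E * q)" if "q \<ge> 0" "E \<ge> 0" "G \<ge> 0" for q E G :: real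
        using that by (simp add: mult_ac flip: ennreal_mult)
      then show ?thesis using l by (simp add: Gamma_real_pos less_imp_le)
    qed
    finally show ?thesis .
  qed
  have "(\<integral>\<^sup>+s. \<integral>\<^sup>+x. ennreal (F s x) \<partial>lborel \<partial>lborel)
     = (\<integral>\<^sup>+s. ennreal (indicator {0..} s * s powr (p + 1 - 1) / exp s) * (\<integral>\<^sup>+x. ennreal (ball_kernel l k \<xi> x) \<partial>lborel) \<partial>lborel)"
  proof (rule nn_integral_cong_AE)
    show "AE s in lborel. (\<integral>\<^sup>+x. ennreal (F s x) \<partial>lborel)
      = ennreal (indicator {0..} s * s powr (p + 1 - 1) / exp s) * (\<integral>\<^sup>+x. ennreal (ball_kernel l k \<xi> x) \<partial>lborel)"
      using AE_lborel_singleton[of "0::real"] by eventually_elim (rule inner1)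
  qed
  also have "\<dots> = ennreal (Gamma (p + 1)) * (\<integral>\<^sup>+x. ennreal (ball_kernel l k \<xi> x) \<partial>lborel)"
    using Gamma_conv_nn_integral_real[of "p + 1"] p by (simp add: nn_integral_multc)
  finally have A: "(\<integral>\<^sup>+s. \<integral>\<^sup>+x. ennreal (F s x) \<partial>lborel \<partial>lborel) = \<dots>" .
  have "(\<integral>\<^sup>+s. \<integral>\<^sup>+x. ennreal (F s x) \<partial>lborel \<partial>lborel) = (\<integral>\<^sup>+x. \<integral>\<^sup>+s. ennreal (F s x) \<partial>lborel \<partial>lborel)"
    using lborel_pair.Fubini'[OF Fmeas] by simp
  also have "\<dots> = ennreal (Gamma (l + 1)) * (\<integral>\<^sup>+x. ennreal (exp (- (norm x)\<^sup>2) * (x \<bullet> \<xi>) ^ (2 * k)) \<partial>lborel)"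
    unfolding inner2 by (rule nn_integral_cmult) simp
  finally show ?thesis unfolding A[unfolded p_def] p_def by simp
qed

text \<open>Ball moments are finite, so the previous identity yields the finiteness of the Gaussian moments.\<close>

lemma gauss_moment_integrable:
  fixes \<xi> :: "'a::euclidean_space"
  shows "integrable lborel (\<lambda>x. exp (- (norm x)\<^sup>2) * (x \<bullet> \<xi>) ^ (2 * k))"
proof -
  have "(\<integral>\<^sup>+x. ennreal (ball_kernel 0 k \<xi> x) \<partial>lborel) < \<infinity>"
    using ball_kernel_integrable[of 0 k \<xi>] by (simp add: integrable_iff_bounded ball_kernel_nonneg)
  then have "ennreal (Gamma (0 + real k + real DIM('a) / 2 + 1)) * (\<integral>\<^sup>+x. ennreal (ball_kernel 0 k \<xi> x) \<partial>lborel) < \<infinity>"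
    by (simp add: ennreal_mult_less_top)
  then have "(\<integral>\<^sup>+x. ennreal (exp (- (norm x)\<^sup>2) * (x \<bullet> \<xi>) ^ (2 * k)) \<partial>lborel) < \<infinity>"
    unfolding ball_gauss_nn_moment[OF order_refl] by simp
  then show ?thesis by (simp add: integrable_iff_bounded)
qed

lemma ball_moment:
  fixes \<xi> :: "'a::euclidean_space"
  assumes l: "l \<ge> 0"
  shows "(\<integral>x. ball_kernel l k \<xi> x \<partial>lborel) = Gamma (l + 1) / Gamma (l + real k + real DIM('a) / 2 + 1) * gauss_moment k \<xi>"
proof -
  have G: "Gamma (l + real k + real DIM('a) / 2 + 1) > 0" "Gamma (l + 1) > 0" using l by (auto intro!: Gamma_real_pos)
  have "ennreal (Gamma (l + real k + real DIM('a) / 2 + 1) * (\<integral>x. ball_kernel l k \<xi> x \<partial>lborel)) = ennreal (Gamma (l + 1) * gauss_moment k \<xi>)"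
  proof -
    have n1: "(\<integral>\<^sup>+x. ennreal (ball_kernel l k \<xi> x) \<partial>lborel) = ennreal (\<integral>x. ball_kernel l k \<xi> x \<partial>lborel)"
      by (rule nn_integral_eq_integral[OF ball_kernel_integrable[OF l]]) (simp add: ball_kernel_nonneg)
    have n2: "(\<integral>\<^sup>+x. ennreal (exp (- (norm x)\<^sup>2) * (x \<bullet> \<xi>) ^ (2 * k)) \<partial>lborel) = ennreal (gauss_moment k \<xi>)"
      unfolding gauss_moment_def by (rule nn_integral_eq_integral[OF gauss_moment_integrable]) simp
    show ?thesis using ball_gauss_nn_moment[OF l, of k \<xi>] G unfolding n1 n2 by (simp add: ennreal_mult')
  qed
  moreover have "gauss_moment k \<xi> \<ge> 0" "(\<integral>x. ball_kernel l k \<xi> x \<partial>lborel) \<ge> 0"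
    unfolding gauss_moment_def by (auto intro!: Bochner_Integration.integral_nonneg ball_kernel_nonneg)
  ultimately have "Gamma (l + real k + real DIM('a) / 2 + 1) * (\<integral>x. ball_kernel l k \<xi> x \<partial>lborel) = Gamma (l + 1) * gauss_moment k \<xi>"
    using G by simp
  then show ?thesis using G by (simp add: field_simps)
qed

lemma cosh_paired: "(\<lambda>k. z ^ (2 * k) / fact (2 * k)) sums cosh (z::real)"
proof -
  have "(\<lambda>n. if even n then z ^ n /\<^sub>R fact n else 0) sums cosh z" by (rule cosh_converges)
  moreover have "strict_mono (\<lambda>k::nat. 2 * k)" by (simp add: strict_mono_def)
  ultimately have "(\<lambda>k. if even (2 * k) then z ^ (2 * k) /\<^sub>R fact (2 * k) else 0) sums cosh z"
    by (subst sums_mono_reindex) (auto elim!: evenE)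
  then show ?thesis by (simp add: divide_inverse_commute)
qed

text \<open>
  For a weight with finite hyperbolic cosine transform, that transform dominates all partial sums, and any even
  power series whose coefficients are bounded by those of \<open>cosh\<close> can be integrated term by term.
\<close>

lemma even_series_integral:
  fixes w :: "'a::euclidean_space \<Rightarrow> real" and \<xi> :: 'a
  assumes [measurable]: "w \<in> borel_measurable borel" "G \<in> borel_measurable borel"
    and w: "\<And>x. w x \<ge> 0" and int: "integrable lborel (\<lambda>x. w x * cosh (x \<bullet> \<xi>))"
    and c: "\<And>k. \<bar>c k\<bar> \<le> 1" and G: "\<And>z::real. (\<lambda>k. c k * (z ^ (2 * k) / fact (2 * k))) sums G z"
  shows "(\<lambda>k. c k / fact (2 * k) * (\<integral>x. w x * (x \<bullet> \<xi>) ^ (2 * k) \<partial>lborel)) sums (\<integral>x. w x * G (x \<bullet> \<xi>) \<partial>lborel)"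
proof -
  have le: "z ^ (2 * k) / fact (2 * k) \<le> cosh z" for z :: real and k
    using cosh_paired[of z] sum_le_suminf[of "\<lambda>k. z ^ (2 * k) / fact (2 * k)" "{k}"] by (simp add: sums_iff)
  have intk: "integrable lborel (\<lambda>x. w x * (x \<bullet> \<xi>) ^ (2 * k))" for k
  proof (rule Bochner_Integration.integrable_bound)
    show "integrable lborel (\<lambda>x. fact (2 * k) * (w x * cosh (x \<bullet> \<xi>)))" using int by simp
    show "AE x in lborel. norm (w x * (x \<bullet> \<xi>) ^ (2 * k)) \<le> norm (fact (2 * k) * (w x * cosh (x \<bullet> \<xi>)))"
    proof (rule AE_I2)
      fix x
      have "(x \<bullet> \<xi>) ^ (2 * k) \<le> fact (2 * k) * cosh (x \<bullet> \<xi>)" using le[of "x \<bullet> \<xi>" k] by (simp add: field_simps)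
      then have "w x * (x \<bullet> \<xi>) ^ (2 * k) \<le> w x * (fact (2 * k) * cosh (x \<bullet> \<xi>))" by (rule mult_left_mono) (rule w)
      moreover have nn: "0 \<le> w x * (x \<bullet> \<xi>) ^ (2 * k)" using w[of x] by simp
      ultimately show "norm (w x * (x \<bullet> \<xi>) ^ (2 * k)) \<le> norm (fact (2 * k) * (w x * cosh (x \<bullet> \<xi>)))"
        unfolding real_norm_def abs_of_nonneg[OF nn] mult.left_commute[of "fact (2 * k)"]
        by (blast intro: order.trans[OF _ abs_ge_self])
    qed
  qed simp
  have "(\<lambda>N. \<integral>x. (\<Sum>k<N. c k / fact (2 * k) * (w x * (x \<bullet> \<xi>) ^ (2 * k))) \<partial>lborel) \<longlonglongrightarrow> (\<integral>x. w x * G (x \<bullet> \<xi>) \<partial>lborel)"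
  proof (rule integral_dominated_convergence[OF _ _ int])
    have eq: "(\<Sum>k<N. c k / fact (2 * k) * (w x * (x \<bullet> \<xi>) ^ (2 * k))) = w x * (\<Sum>k<N. c k * ((x \<bullet> \<xi>) ^ (2 * k) / fact (2 * k)))" for x N
      unfolding sum_distrib_left by (rule sum.cong) auto
    show "AE x in lborel. (\<lambda>N. \<Sum>k<N. c k / fact (2 * k) * (w x * (x \<bullet> \<xi>) ^ (2 * k))) \<longlonglongrightarrow> w x * G (x \<bullet> \<xi>)"
      unfolding eq using G by (intro AE_I2 tendsto_intros) (auto simp: sums_def)
    show "AE x in lborel. norm (\<Sum>k<N. c k / fact (2 * k) * (w x * (x \<bullet> \<xi>) ^ (2 * k))) \<le> w x * cosh (x \<bullet> \<xi>)" for N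
    proof (rule AE_I2)
      fix x
      have "\<bar>\<Sum>k<N. c k * ((x \<bullet> \<xi>) ^ (2 * k) / fact (2 * k))\<bar> \<le> (\<Sum>k<N. \<bar>c k * ((x \<bullet> \<xi>) ^ (2 * k) / fact (2 * k))\<bar>)" by (rule sum_abs)
      also have "\<dots> \<le> (\<Sum>k<N. (x \<bullet> \<xi>) ^ (2 * k) / fact (2 * k))"
      proof (rule sum_mono)
        fix k
        have "\<bar>c k * ((x \<bullet> \<xi>) ^ (2 * k) / fact (2 * k))\<bar> = \<bar>c k\<bar> * ((x \<bullet> \<xi>) ^ (2 * k) / fact (2 * k))"
          by (simp add: abs_mult)
        also have "\<dots> \<le> 1 * ((x \<bullet> \<xi>) ^ (2 * k) / fact (2 * k))" using c by (intro mult_right_mono) auto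
        finally show "\<bar>c k * ((x \<bullet> \<xi>) ^ (2 * k) / fact (2 * k))\<bar> \<le> (x \<bullet> \<xi>) ^ (2 * k) / fact (2 * k)" by simp
      qed
      also have "\<dots> \<le> cosh (x \<bullet> \<xi>)"
        using cosh_paired[of "x \<bullet> \<xi>"] sum_le_suminf[of "\<lambda>k. (x \<bullet> \<xi>) ^ (2 * k) / fact (2 * k)" "{..<N}"] by (simp add: sums_iff)
      finally show "norm (\<Sum>k<N. c k / fact (2 * k) * (w x * (x \<bullet> \<xi>) ^ (2 * k))) \<le> w x * cosh (x \<bullet> \<xi>)"
        unfolding eq using w[of x] by (simp add: abs_mult mult_left_mono)
    qed
  qed simp_all
  then show ?thesis unfolding sums_def by (simp add: intk)
qed

lemma real_power_series_eq_0:
  fixes a :: "nat \<Rightarrow> real"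
  assumes "\<And>t. (\<lambda>n. a n * t ^ n) sums 0"
  shows "a n = 0"
proof (induction n rule: less_induct)
  case (less n)
  have "(\<lambda>k. a (k + n) * t ^ k) sums 0" if "t \<noteq> 0" for t
  proof -
    have "(\<Sum>i<n. a i * t ^ i) = 0" using less.IH by simp
    then have "(\<lambda>k. a (k + n) * t ^ (k + n)) sums 0"
      using sums_split_initial_segment[OF assms[of t], of n] by simp
    then have "(\<lambda>k. a (k + n) * t ^ (k + n) / t ^ n) sums (0 / t ^ n)" by (rule sums_divide)
    then show ?thesis using that by (simp add: power_add)
  qed
  then have "((\<lambda>t::real. 0) \<longlongrightarrow> a (0 + n)) (at 0)"
    by (intro powser_limit_0_strong[of 1 "\<lambda>k. a (k + n)"]) auto
  then show "a n = 0" using LIM_const_eq by fastforce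
qed

text \<open>The value is \<open>\<pi>^{d/2}\<close>.\<close>

definition gauss_total :: "'a::euclidean_space itself \<Rightarrow> real" where
  "gauss_total _ = (\<integral>x. exp (- (norm (x::'a))\<^sup>2) \<partial>lborel)"

lemma gauss_integrable: "integrable lborel (\<lambda>x::'a::euclidean_space. exp (- (norm x)\<^sup>2))"
  using gauss_moment_integrable[of "0::'a" 0] by simp

lemma gauss_total_pos: "gauss_total TYPE('a::euclidean_space) > 0"
proof -
  have "gauss_total TYPE('a) \<noteq> 0"
  proof
    assume "gauss_total TYPE('a) = 0"
    then have "AE x in lborel. exp (- (norm (x::'a))\<^sup>2) = 0"
      unfolding gauss_total_def by (subst (asm) integral_nonneg_eq_0_iff_AE[OF gauss_integrable]) auto
    then have "AE x in (lborel :: 'a measure). False" by simp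
    then have "emeasure lborel (UNIV :: 'a set) = 0"
      by (subst (asm) AE_iff_measurable[of UNIV]) auto
    then show False by simp
  qed
  moreover have "gauss_total TYPE('a) \<ge> 0" unfolding gauss_total_def by simp
  ultimately show ?thesis by simp
qed

text \<open>Completing the square, by translation invariance.\<close>

lemma gauss_exp_transform:
  fixes t :: "'a::euclidean_space"
  shows "integrable lborel (\<lambda>x. exp (- (norm x)\<^sup>2) * exp (2 * (x \<bullet> t)))"
    and "(\<integral>x. exp (- (norm x)\<^sup>2) * exp (2 * (x \<bullet> t)) \<partial>lborel) = gauss_total TYPE('a) * exp ((norm t)\<^sup>2)"
proof -
  have eq: "exp (- (norm x)\<^sup>2) * exp (2 * (x \<bullet> t)) = exp ((norm t)\<^sup>2) * exp (- (norm (- t + 1 *\<^sub>R x))\<^sup>2)" for x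
    unfolding exp_add[symmetric] power2_norm_eq_inner by (simp add: inner_add_left inner_add_right inner_diff inner_commute)
  show "integrable lborel (\<lambda>x. exp (- (norm x)\<^sup>2) * exp (2 * (x \<bullet> t)))"
    unfolding eq by (intro integrable_mult_right integrable_lborel_affine[OF gauss_integrable]) simp
  have "gauss_total TYPE('a) = (\<integral>x. exp (- (norm (- t + 1 *\<^sub>R x))\<^sup>2) \<partial>lborel)"
    unfolding gauss_total_def by (subst integral_lborel_affine[of 1 _ "- t"]) auto
  then show "(\<integral>x. exp (- (norm x)\<^sup>2) * exp (2 * (x \<bullet> t)) \<partial>lborel) = gauss_total TYPE('a) * exp ((norm t)\<^sup>2)"
    unfolding eq by (simp add: mult.commute)
qed

lemma gauss_cosh_transform:
  fixes \<xi> :: "'a::euclidean_space"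
  shows "integrable lborel (\<lambda>x. exp (- (norm x)\<^sup>2) * cosh (x \<bullet> \<xi>))"
    and "(\<integral>x. exp (- (norm x)\<^sup>2) * cosh (x \<bullet> \<xi>) \<partial>lborel) = gauss_total TYPE('a) * exp ((norm \<xi>)\<^sup>2 / 4)"
proof -
  have eq: "exp (- (norm x)\<^sup>2) * cosh (x \<bullet> \<xi>)
     = (exp (- (norm x)\<^sup>2) * exp (2 * (x \<bullet> (1/2) *\<^sub>R \<xi>)) + exp (- (norm x)\<^sup>2) * exp (2 * (x \<bullet> (-1/2) *\<^sub>R \<xi>))) / 2" for x
    by (simp add: cosh_def distrib_left)
  note I = gauss_exp_transform[of "(1/2) *\<^sub>R \<xi>"] gauss_exp_transform[of "(-1/2) *\<^sub>R \<xi>"]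
  have n: "(norm ((1/2) *\<^sub>R \<xi>))\<^sup>2 = (norm \<xi>)\<^sup>2 / 4" "(norm ((-1/2) *\<^sub>R \<xi>))\<^sup>2 = (norm \<xi>)\<^sup>2 / 4"
    by (simp_all add: power_mult_distrib power2_eq_square)
  show "integrable lborel (\<lambda>x. exp (- (norm x)\<^sup>2) * cosh (x \<bullet> \<xi>))"
    unfolding eq using I(1,3) by (intro integrable_divide Bochner_Integration.integrable_add)
  show "(\<integral>x. exp (- (norm x)\<^sup>2) * cosh (x \<bullet> \<xi>) \<partial>lborel) = gauss_total TYPE('a) * exp ((norm \<xi>)\<^sup>2 / 4)"
    unfolding eq integral_divide_zero Bochner_Integration.integral_add[OF I(1,3)] I(2,4) n by simp
qed

text \<open>
  Both sides are the coefficients of the same power series in \<open>\<eta>\<close>, the hyperbolic cosine transform of the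
  Gaussian at \<open>\<eta> \<xi>\<close>.
\<close>

lemma gauss_moment_eq:
  fixes \<xi> :: "'a::euclidean_space"
  shows "gauss_moment k \<xi> = gauss_total TYPE('a) * (fact (2 * k) / (4 ^ k * fact k) * norm \<xi> ^ (2 * k))"
proof -
  define Z where "Z = gauss_total TYPE('a)"
  define F where "F n = (if even n then gauss_moment (n div 2) \<xi> / fact n else 0)" for n :: nat
  define H where "H n = (if even n then Z * (((norm \<xi>)\<^sup>2 / 4) ^ (n div 2) / fact (n div 2)) else 0)" for n :: nat
  have mono: "strict_mono (\<lambda>k::nat. 2 * k)" by (simp add: strict_mono_def)
  have F: "(\<lambda>n. F n * \<eta> ^ n) sums (Z * exp (\<eta>\<^sup>2 * ((norm \<xi>)\<^sup>2 / 4)))" for \<eta>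
  proof -
    have A: "(\<lambda>k. 1 / fact (2 * k) * (\<integral>x. exp (- (norm x)\<^sup>2) * (x \<bullet> (\<eta> *\<^sub>R \<xi>)) ^ (2 * k) \<partial>lborel)) sums
        (\<integral>x. exp (- (norm x)\<^sup>2) * cosh (x \<bullet> (\<eta> *\<^sub>R \<xi>)) \<partial>lborel)"
      by (rule even_series_integral) (auto intro!: gauss_cosh_transform borel_measurable_continuous_onI continuous_intros simp: cosh_paired simp del: inner_scaleR_right)
    have B: "(\<integral>x. exp (- (norm x)\<^sup>2) * (x \<bullet> (\<eta> *\<^sub>R \<xi>)) ^ (2 * k) \<partial>lborel) = \<eta> ^ (2 * k) * gauss_moment k \<xi>" for k
    proof -
      have "(\<lambda>x. exp (- (norm x)\<^sup>2) * (x \<bullet> (\<eta> *\<^sub>R \<xi>)) ^ (2 * k)) = (\<lambda>x. \<eta> ^ (2 * k) * (exp (- (norm x)\<^sup>2) * (x \<bullet> \<xi>) ^ (2 * k)))"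
        by (simp add: power_mult_distrib mult_ac)
      then show ?thesis by (simp add: gauss_moment_def)
    qed
    have C: "(norm (\<eta> *\<^sub>R \<xi>))\<^sup>2 / 4 = \<eta>\<^sup>2 * ((norm \<xi>)\<^sup>2 / 4)" by (simp add: power_mult_distrib)
    have D: "(\<lambda>k. 1 / fact (2 * k) * (\<eta> ^ (2 * k) * gauss_moment k \<xi>)) = (\<lambda>k. F (2 * k) * \<eta> ^ (2 * k))"
      by (simp add: F_def mult_ac)
    have "(\<lambda>k. F (2 * k) * \<eta> ^ (2 * k)) sums (Z * exp (\<eta>\<^sup>2 * ((norm \<xi>)\<^sup>2 / 4)))"
      using A unfolding B gauss_cosh_transform(2) C D Z_def .
    then show ?thesis by (subst (asm) sums_mono_reindex[OF mono]) (auto simp: F_def elim!: evenE)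
  qed
  have H: "(\<lambda>n. H n * \<eta> ^ n) sums (Z * exp (\<eta>\<^sup>2 * ((norm \<xi>)\<^sup>2 / 4)))" for \<eta>
  proof -
    have "(\<lambda>k. Z * ((\<eta>\<^sup>2 * ((norm \<xi>)\<^sup>2 / 4)) ^ k / fact k)) sums (Z * exp (\<eta>\<^sup>2 * ((norm \<xi>)\<^sup>2 / 4)))"
      by (intro sums_mult exp_sums_real)
    moreover have "Z * ((\<eta>\<^sup>2 * ((norm \<xi>)\<^sup>2 / 4)) ^ k / fact k) = H (2 * k) * \<eta> ^ (2 * k)" for k
      unfolding power_mult_distrib[of "\<eta>\<^sup>2"] by (simp add: H_def power_mult)
    ultimately have "(\<lambda>k. H (2 * k) * \<eta> ^ (2 * k)) sums (Z * exp (\<eta>\<^sup>2 * ((norm \<xi>)\<^sup>2 / 4)))" by simp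
    then show ?thesis by (subst (asm) sums_mono_reindex[OF mono]) (auto simp: H_def elim!: evenE)
  qed
  have "(\<lambda>n. (F n - H n) * \<eta> ^ n) sums 0" for \<eta>
    using sums_diff[OF F[of \<eta>] H[of \<eta>]] by (simp add: left_diff_distrib)
  then have "F (2 * k) - H (2 * k) = 0" by (rule real_power_series_eq_0)
  then have "gauss_moment k \<xi> = Z * (fact (2 * k) / (4 ^ k * fact k) * ((norm \<xi>)\<^sup>2) ^ k)"
    by (simp add: F_def H_def field_simps power_divide)
  then show ?thesis by (simp only: Z_def power_mult)
qed

lemma gauss_cos_transform:
  fixes \<xi> :: "'a::euclidean_space"
  shows "(\<integral>x. exp (- (norm x)\<^sup>2) * cos (x \<bullet> \<xi>) \<partial>lborel) = gauss_total TYPE('a) * exp (- (norm \<xi>)\<^sup>2 / 4)"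
proof -
  have "(\<lambda>k. (-1) ^ k / fact (2 * k) * (\<integral>x. exp (- (norm x)\<^sup>2) * (x \<bullet> \<xi>) ^ (2 * k) \<partial>lborel)) sums
      (\<integral>x. exp (- (norm x)\<^sup>2) * cos (x \<bullet> \<xi>) \<partial>lborel)"
    using cos_paired by (intro even_series_integral gauss_cosh_transform) auto
  then have "(\<lambda>k. gauss_total TYPE('a) * ((- (norm \<xi>)\<^sup>2 / 4) ^ k / fact k)) sums (\<integral>x. exp (- (norm x)\<^sup>2) * cos (x \<bullet> \<xi>) \<partial>lborel)"
  proof (rule sums_cong[THEN iffD1, rotated])
    fix k
    have "(- (norm \<xi>)\<^sup>2 / 4) ^ k = (-1) ^ k * norm \<xi> ^ (2 * k) / 4 ^ k"
    proof -
      have "- (norm \<xi>)\<^sup>2 / 4 = (-1) * ((norm \<xi>)\<^sup>2 / 4)" by simp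
      then show ?thesis by (simp only: power_mult_distrib power_divide power_mult times_divide_eq_right)
    qed
    then show "(-1) ^ k / fact (2 * k) * (\<integral>x. exp (- (norm x)\<^sup>2) * (x \<bullet> \<xi>) ^ (2 * k) \<partial>lborel)
        = gauss_total TYPE('a) * ((- (norm \<xi>)\<^sup>2 / 4) ^ k / fact k)"
      unfolding gauss_moment_def[symmetric] gauss_moment_eq by simp
  qed
  moreover have "(\<lambda>k. gauss_total TYPE('a) * ((- (norm \<xi>)\<^sup>2 / 4) ^ k / fact k)) sums (gauss_total TYPE('a) * exp (- (norm \<xi>)\<^sup>2 / 4))"
    by (intro sums_mult exp_sums_real)
  ultimately show ?thesis by (rule sums_unique2)
qed

section \<open>Functions with nonnegative Fourier transform\<close>

lemma stationary_covariance_cos: "stationary_covariance (\<lambda>h. cos (h \<bullet> v))"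
  unfolding stationary_covariance_def
proof (intro conjI allI)
  fix n :: nat and V :: "nat \<Rightarrow> real" and x :: "nat \<Rightarrow> 'a"
  have "(\<Sum>i<n. \<Sum>j<n. V i * V j * cos ((x i - x j) \<bullet> v))
     = (\<Sum>i<n. \<Sum>j<n. (V i * cos (x i \<bullet> v)) * (V j * cos (x j \<bullet> v)) + (V i * sin (x i \<bullet> v)) * (V j * sin (x j \<bullet> v)))"
    by (intro sum.cong refl) (simp add: inner_diff_left cos_diff algebra_simps)
  also have "\<dots> = (\<Sum>i<n. V i * cos (x i \<bullet> v))\<^sup>2 + (\<Sum>i<n. V i * sin (x i \<bullet> v))\<^sup>2"
    by (simp add: power2_eq_square sum_product sum.distrib)
  also have "\<dots> \<ge> 0" by simp
  finally show "(\<Sum>i<n. \<Sum>j<n. V i * V j * cos ((x i - x j) \<bullet> v)) \<ge> 0" .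
qed simp

text \<open>
  The convolution of \<open>\<Phi>\<close> with a Gaussian is, by Fubini, a mixture of the functions \<open>cos (x \<bullet> \<sigma> \<xi>)\<close> whose density is
  the Fourier transform of \<open>\<Phi>\<close> times a Gaussian. The Gaussian factor makes this density
  integrable, and letting \<open>\<sigma>\<close> tend to infinity recovers \<open>\<Phi>\<close>.
\<close>

theorem stationary_covariance_Fourier:
  fixes \<Phi> :: "'a::euclidean_space \<Rightarrow> real"
  assumes cont: "continuous_on UNIV \<Phi>" and even: "\<And>x. \<Phi> (- x) = \<Phi> x"
    and int: "integrable lborel \<Phi>" and bound: "\<And>x. \<bar>\<Phi> x\<bar> \<le> B"
    and fourier: "\<And>\<xi>. (\<integral>y. \<Phi> y * cos (y \<bullet> \<xi>) \<partial>lborel) \<ge> 0"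
  shows "stationary_covariance \<Phi>"
proof -
  have [measurable]: "\<Phi> \<in> borel_measurable borel" by (rule borel_measurable_continuous_onI[OF cont])
  define Z where "Z = gauss_total TYPE('a)"
  have Z: "Z > 0" unfolding Z_def by (rule gauss_total_pos)
  define F where "F \<xi> = (\<integral>y. \<Phi> y * cos (y \<bullet> \<xi>) \<partial>lborel)" for \<xi>
  have int_cos: "integrable lborel (\<lambda>y. \<Phi> y * cos (y \<bullet> \<xi>))" and int_sin: "integrable lborel (\<lambda>y. \<Phi> y * sin (y \<bullet> \<xi>))" for \<xi>
    by (rule Bochner_Integration.integrable_bound[OF int], auto simp: abs_mult mult_left_le)+
  have sin0: "(\<integral>y. \<Phi> y * sin (y \<bullet> \<xi>) \<partial>lborel) = 0" for \<xi>
  proof -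
    have "(\<integral>y. \<Phi> y * sin (y \<bullet> \<xi>) \<partial>lborel) = (\<integral>y. \<Phi> (0 + (-1) *\<^sub>R y) * sin ((0 + (-1) *\<^sub>R y) \<bullet> \<xi>) \<partial>lborel)"
      by (subst integral_lborel_affine[of "-1" _ 0]) auto
    also have "\<dots> = - (\<integral>y. \<Phi> y * sin (y \<bullet> \<xi>) \<partial>lborel)" by (simp add: even)
    finally show ?thesis by simp
  qed
  have shift: "(\<integral>y. \<Phi> y * cos ((x - y) \<bullet> \<xi>) \<partial>lborel) = F \<xi> * cos (x \<bullet> \<xi>)" for x \<xi>
  proof -
    have "(\<integral>y. \<Phi> y * cos ((x - y) \<bullet> \<xi>) \<partial>lborel)
       = (\<integral>y. cos (x \<bullet> \<xi>) * (\<Phi> y * cos (y \<bullet> \<xi>)) + sin (x \<bullet> \<xi>) * (\<Phi> y * sin (y \<bullet> \<xi>)) \<partial>lborel)"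
      by (intro Bochner_Integration.integral_cong refl) (simp add: inner_diff_left cos_diff algebra_simps)
    also have "\<dots> = cos (x \<bullet> \<xi>) * F \<xi>"
      using int_cos[of \<xi>] int_sin[of \<xi>] by (simp add: F_def sin0)
    finally show ?thesis by (simp add: mult.commute)
  qed
  define \<Psi> where "\<Psi> \<sigma> x = (\<integral>y. \<Phi> y * exp (- (norm (\<sigma> *\<^sub>R (x - y)))\<^sup>2 / 4) \<partial>lborel)" for \<sigma> :: real and x
  have psi: "stationary_covariance (\<lambda>x. Z * \<Psi> \<sigma> x)" for \<sigma>
  proof -
    \<comment> \<open>the mixture components\<close>
    define K where "K \<xi> x = exp (- (norm \<xi>)\<^sup>2) * F (\<sigma> *\<^sub>R \<xi>) * cos (x \<bullet> (\<sigma> *\<^sub>R \<xi>))" for \<xi> x :: 'a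
    define f where "f x \<xi> y = exp (- (norm \<xi>)\<^sup>2) * (\<Phi> y * cos ((x - y) \<bullet> (\<sigma> *\<^sub>R \<xi>)))" for x \<xi> y :: 'a
    have fm: "case_prod (f x) \<in> borel_measurable (lborel \<Otimes>\<^sub>M lborel)" for x
      unfolding f_def by measurable
    have fint: "integrable (lborel \<Otimes>\<^sub>M lborel) (case_prod (f x))" for x
    proof (rule Bochner_Integration.integrable_bound)
      show "integrable (lborel \<Otimes>\<^sub>M lborel) (\<lambda>p. exp (- (norm (fst p :: 'a))\<^sup>2) * \<Phi> (snd p))"
      proof (rule lborel_pair.Fubini_integrable)
        show "integrable lborel (\<lambda>\<xi>. \<integral>y. norm (exp (- (norm (fst (\<xi>, y) :: 'a))\<^sup>2) * \<Phi> (snd (\<xi>, y))) \<partial>lborel)"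
          using gauss_integrable[where 'a='a] by (simp add: abs_mult)
      qed (use int in auto)
      show "AE p in lborel \<Otimes>\<^sub>M lborel. norm (case_prod (f x) p) \<le> norm (exp (- (norm (fst p :: 'a))\<^sup>2) * \<Phi> (snd p))"
        by (intro AE_I2) (auto simp: f_def abs_mult mult_left_le)
    qed (rule fm)
    have inner1: "(\<integral>y. f x \<xi> y \<partial>lborel) = K \<xi> x" for x \<xi>
      unfolding f_def K_def by (simp only: integral_mult_right_zero shift mult.assoc)
    have inner2: "(\<integral>\<xi>. f x \<xi> y \<partial>lborel) = Z * (\<Phi> y * exp (- (norm (\<sigma> *\<^sub>R (x - y)))\<^sup>2 / 4))" for x y
    proof -
      have "(\<integral>\<xi>. f x \<xi> y \<partial>lborel) = (\<integral>\<xi>. \<Phi> y * (exp (- (norm \<xi>)\<^sup>2) * cos (\<xi> \<bullet> (\<sigma> *\<^sub>R (x - y)))) \<partial>lborel)"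
        unfolding f_def by (intro Bochner_Integration.integral_cong refl) (simp add: inner_commute)
      then show ?thesis unfolding integral_mult_right_zero gauss_cos_transform Z_def by (simp only: mult_ac)
    qed
    have K_int: "integrable lborel (\<lambda>\<xi>. K \<xi> x)" for x
      using lborel_pair.integrable_fst'[OF fint[of x]] by (simp add: inner1)
    have "stationary_covariance (K \<xi>)" for \<xi>
    proof -
      have "stationary_covariance (\<lambda>x. (exp (- (norm \<xi>)\<^sup>2) * F (\<sigma> *\<^sub>R \<xi>)) * cos (x \<bullet> (\<sigma> *\<^sub>R \<xi>)))"
        by (intro stationary_covariance_cmult stationary_covariance_cos) (simp_all add: F_def fourier del: inner_scaleR_right)
      then show ?thesis by (simp add: K_def[abs_def])
    qed
    then have "stationary_covariance (\<lambda>x. \<integral>\<xi>. K \<xi> x \<partial>lborel)"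
      by (rule stationary_covariance_mixture) (rule K_int)
    moreover have "(\<integral>\<xi>. K \<xi> x \<partial>lborel) = Z * \<Psi> \<sigma> x" for x
      using lborel_pair.Fubini_integral[OF fint[of x]] by (simp add: inner1 inner2 \<Psi>_def)
    ultimately show ?thesis by simp
  qed
  define Z' where "Z' = (\<integral>y. exp (- (norm (y::'a))\<^sup>2 / 4) \<partial>lborel)"
  have g4: "exp (- (norm (y::'a))\<^sup>2 / 4) = exp (- (norm (0 + (1/2) *\<^sub>R y))\<^sup>2)" for y
    by (simp add: power_mult_distrib power2_eq_square)
  have int4: "integrable lborel (\<lambda>y::'a. exp (- (norm y)\<^sup>2 / 4))"
    unfolding g4 by (rule integrable_lborel_affine[OF gauss_integrable]) simp
  have "Z = (1/2) ^ DIM('a) * Z'"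
    unfolding Z_def gauss_total_def Z'_def g4 by (subst integral_lborel_affine[of "1/2" _ 0]) auto
  with Z have Z': "Z' > 0" by (simp add: zero_less_mult_iff)
  have scaled: "\<sigma> ^ DIM('a) * \<Psi> \<sigma> x = (\<integral>y. \<Phi> (x + (- 1 / \<sigma>) *\<^sub>R y) * exp (- (norm y)\<^sup>2 / 4) \<partial>lborel)" if "\<sigma> > 0" for \<sigma> x
  proof -
    have "\<Psi> \<sigma> x = \<bar>- 1 / \<sigma>\<bar> ^ DIM('a) * (\<integral>y. \<Phi> (x + (- 1 / \<sigma>) *\<^sub>R y) * exp (- (norm (\<sigma> *\<^sub>R (x - (x + (- 1 / \<sigma>) *\<^sub>R y))))\<^sup>2 / 4) \<partial>lborel)"
      unfolding \<Psi>_def using that by (intro integral_lborel_affine) auto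
    also have "(\<lambda>y. \<Phi> (x + (- 1 / \<sigma>) *\<^sub>R y) * exp (- (norm (\<sigma> *\<^sub>R (x - (x + (- 1 / \<sigma>) *\<^sub>R y))))\<^sup>2 / 4))
        = (\<lambda>y. \<Phi> (x + (- 1 / \<sigma>) *\<^sub>R y) * exp (- (norm y)\<^sup>2 / 4))" using that by simp
    finally show ?thesis using that by (simp add: power_divide)
  qed
  define s where "s n = real (Suc n)" for n
  define C where "C n x = (s n ^ DIM('a) / (Z' * Z)) * (Z * \<Psi> (s n) x)" for n x
  have "stationary_covariance (C n)" for n
    unfolding C_def by (intro stationary_covariance_cmult psi) (use Z Z' in \<open>auto simp: s_def\<close>)
  moreover have "(\<lambda>n. C n x) \<longlonglongrightarrow> \<Phi> x" for x
  proof -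
    have "(\<lambda>n. \<integral>y. \<Phi> (x + (- 1 / s n) *\<^sub>R y) * exp (- (norm y)\<^sup>2 / 4) \<partial>lborel) \<longlonglongrightarrow> (\<integral>y. \<Phi> x * exp (- (norm (y::'a))\<^sup>2 / 4) \<partial>lborel)"
    proof (rule integral_dominated_convergence[where w = "\<lambda>y::'a. B * exp (- (norm y)\<^sup>2 / 4)"])
      show "AE y in lborel. (\<lambda>n. \<Phi> (x + (- 1 / s n) *\<^sub>R y) * exp (- (norm y)\<^sup>2 / 4)) \<longlonglongrightarrow> \<Phi> x * exp (- (norm y)\<^sup>2 / 4)"
      proof (rule AE_I2)
        fix y :: 'a
        have "(\<lambda>n. - 1 / s n) \<longlonglongrightarrow> 0"
          using tendsto_minus[OF LIMSEQ_inverse_real_of_nat] by (simp add: s_def inverse_eq_divide del: of_nat_Suc)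
        then have "(\<lambda>n. x + (- 1 / s n) *\<^sub>R y) \<longlonglongrightarrow> x + 0 *\<^sub>R y" by (intro tendsto_intros)
        then have "(\<lambda>n. \<Phi> (x + (- 1 / s n) *\<^sub>R y)) \<longlonglongrightarrow> \<Phi> x"
          using continuous_on_tendsto_compose[OF cont] by simp
        then show "(\<lambda>n. \<Phi> (x + (- 1 / s n) *\<^sub>R y) * exp (- (norm y)\<^sup>2 / 4)) \<longlonglongrightarrow> \<Phi> x * exp (- (norm y)\<^sup>2 / 4)"
          by (intro tendsto_intros)
      qed
      show "AE y in lborel. norm (\<Phi> (x + (- 1 / s n) *\<^sub>R y) * exp (- (norm y)\<^sup>2 / 4)) \<le> B * exp (- (norm y)\<^sup>2 / 4)" for n
        by (intro AE_I2) (simp add: abs_mult bound)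
    qed (use int4 in auto)
    then have "(\<lambda>n. (s n ^ DIM('a) * \<Psi> (s n) x) / Z') \<longlonglongrightarrow> (\<Phi> x * Z') / Z'"
      using Z' by (intro tendsto_divide) (auto simp: scaled s_def Z'_def)
    moreover have "(s n ^ DIM('a) * \<Psi> (s n) x) / Z' = C n x" for n using Z by (simp add: C_def)
    ultimately show ?thesis using Z' by simp
  qed
  ultimately show ?thesis by (rule stationary_covariance_limit)
qed

section \<open>Gauss sums\<close>

definition gauss_term :: "real \<Rightarrow> real \<Rightarrow> real \<Rightarrow> nat \<Rightarrow> real" where
  "gauss_term x y C j = pochhammer x j * pochhammer y j / (pochhammer C j * fact j)"

context
  fixes x y C :: real
  assumes x: "x > 0" and y: "y > 0" and C: "C > x + y"
begin

lemma gauss_term_pos: "gauss_term x y C j > 0"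
  unfolding gauss_term_def using x y C by (auto intro!: divide_pos_pos mult_pos_pos pochhammer_pos)

lemma gauss_term_Suc: "gauss_term x y C (Suc j) * ((C + real j) * (real j + 1)) = gauss_term x y C j * ((x + real j) * (y + real j))"
proof -
  have "pochhammer C j > 0" "C + real j > 0" using x y C by (auto intro!: pochhammer_pos)
  then show ?thesis unfolding gauss_term_def by (simp add: pochhammer_Suc divide_simps)
qed

text \<open>
  For large \<open>j\<close> the fraction exceeds a positive constant, so \<open>j\<close> times the term decreases at least as fast as a
  fixed multiple of the term. Summability follows without asymptotics.
\<close>

lemma gauss_term_telescope:
  "real j * gauss_term x y C j - real (Suc j) * gauss_term x y C (Suc j)
     = gauss_term x y C j * (((C - x - y) * real j - x * y) / (C + real j))"
proof -
  have p: "C + real j > 0" using x y C by simp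
  have "(C + real j) * (real j * gauss_term x y C j - real (Suc j) * gauss_term x y C (Suc j))
     = (C + real j) * real j * gauss_term x y C j - gauss_term x y C j * ((x + real j) * (y + real j))"
    unfolding gauss_term_Suc[symmetric] by (simp add: algebra_simps)
  also have "\<dots> = gauss_term x y C j * ((C - x - y) * real j - x * y)" by (simp add: algebra_simps)
  finally show ?thesis using p by (simp add: field_simps)
qed

lemma gauss_term_eventually:
  "\<exists>J. \<forall>j\<ge>J. gauss_term x y C j * ((C - x - y) / 2) \<le> real j * gauss_term x y C j - real (Suc j) * gauss_term x y C (Suc j)"
proof -
  define e where "e = C - x - y"
  have e: "e > 0" using C by (simp add: e_def)
  \<comment> \<open>the threshold beyond which the fraction is at least \<open>e/2\<close>\<close>
  obtain J :: nat where J: "real J \<ge> (2 * x * y + e * C) / e" using real_arch_simple by blast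
  have "gauss_term x y C j * (e / 2) \<le> gauss_term x y C j * ((e * real j - x * y) / (C + real j))" if "j \<ge> J" for j
  proof (rule mult_left_mono)
    have "real j \<ge> (2 * x * y + e * C) / e" using J that by linarith
    then have "e * real j \<ge> 2 * x * y + e * C" using e by (simp add: field_simps)
    moreover have "C + real j > 0" using x y C by simp
    ultimately show "e / 2 \<le> (e * real j - x * y) / (C + real j)" by (simp add: field_simps)
  qed (use gauss_term_pos[of j] in simp)
  then show ?thesis unfolding gauss_term_telescope e_def by blast
qed

lemma summable_gauss_term: "summable (gauss_term x y C)"
proof -
  define e where "e = (C - x - y) / 2"
  have e: "e > 0" using C by (simp add: e_def)
  obtain J where J: "\<And>j. j \<ge> J \<Longrightarrow> gauss_term x y C j * e \<le> real j * gauss_term x y C j - real (Suc j) * gauss_term x y C (Suc j)"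
    using gauss_term_eventually unfolding e_def by blast
  have "summable (\<lambda>j. gauss_term x y C (j + J) * e)"
  proof (rule bounded_imp_summable)
    show "gauss_term x y C (j + J) * e \<ge> 0" for j using gauss_term_pos[of "j + J"] e by simp
    fix n
    have "(\<Sum>j\<le>n. gauss_term x y C (j + J) * e)
        \<le> (\<Sum>j\<le>n. real (j + J) * gauss_term x y C (j + J) - real (Suc (j + J)) * gauss_term x y C (Suc (j + J)))"
      by (intro sum_mono J) simp
    also have "\<dots> = real J * gauss_term x y C J - real (Suc (n + J)) * gauss_term x y C (Suc (n + J))"
      by (induction n) simp_all
    also have "\<dots> \<le> real J * gauss_term x y C J" using gauss_term_pos[of "Suc (n + J)"] by simp
    finally show "(\<Sum>j\<le>n. gauss_term x y C (j + J) * e) \<le> real J * gauss_term x y C J" .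
  qed
  then have "summable (\<lambda>j. gauss_term x y C (j + J))" using e by (simp add: summable_cmult_iff mult.commute)
  then show ?thesis by (simp add: summable_iff_shift)
qed

text \<open>A positive limit would make the terms comparable with the harmonic series.\<close>

lemma gauss_term_linear_null: "(\<lambda>j. real j * gauss_term x y C j) \<longlonglongrightarrow> 0"
proof -
  define V where "V j = real j * gauss_term x y C j" for j
  obtain J where J: "\<And>j. j \<ge> J \<Longrightarrow> V (Suc j) \<le> V j"
  proof -
    obtain J where "\<forall>j\<ge>J. gauss_term x y C j * ((C - x - y) / 2) \<le> V j - V (Suc j)"
      using gauss_term_eventually unfolding V_def by blast
    moreover have "gauss_term x y C j * ((C - x - y) / 2) \<ge> 0" for j using gauss_term_pos[of j] C by simp
    ultimately have "V (Suc j) \<le> V j" if "j \<ge> J" for j using that by (smt (verit))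
    then show ?thesis using that by blast
  qed
  have V0: "V j \<ge> 0" for j using gauss_term_pos[of j] by (simp add: V_def)
  have "decseq (\<lambda>j. V (j + J))" by (intro decseq_SucI) (simp add: J)
  then obtain L where L: "(\<lambda>j. V (j + J)) \<longlonglongrightarrow> L" "\<And>j. L \<le> V (j + J)"
    using decseq_convergent[of "\<lambda>j. V (j + J)" 0] V0 by blast
  have "L \<ge> 0" by (rule LIMSEQ_le_const[OF L(1)]) (use V0 in auto)
  moreover have "\<not> L > 0"
  proof
    assume "L > 0"
    have "summable (\<lambda>j. L * inverse (real (Suc j)))"
    proof (rule summable_comparison_test)
      show "summable (\<lambda>j. gauss_term x y C (Suc j))" using summable_gauss_term by (simp add: summable_Suc_iff)
      show "\<exists>N. \<forall>n\<ge>N. norm (L * inverse (real (Suc n))) \<le> gauss_term x y C (Suc n)"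
      proof (intro exI[of _ J] allI impI)
        fix n assume "J \<le> n"
        then have "L \<le> V (Suc n)" using L(2)[of "Suc n - J"] by simp
        then show "norm (L * inverse (real (Suc n))) \<le> gauss_term x y C (Suc n)"
          using \<open>L > 0\<close> by (simp add: V_def field_simps)
      qed
    qed
    then have "summable (\<lambda>j. inverse (real (Suc j)))" using \<open>L > 0\<close> by (simp add: summable_cmult_iff)
    then show False using not_summable_harmonic[where 'a=real] summable_Suc_iff[of "\<lambda>n. inverse (real n)"]
      by (simp add: inverse_eq_divide)
  qed
  ultimately have "L = 0" by simp
  then have "(\<lambda>j. V (j + J)) \<longlonglongrightarrow> 0" using L by simp
  then show ?thesis unfolding V_def[symmetric] by (rule LIMSEQ_offset)
qed

end

text \<open>
  The difference of the two sides telescopes term by term, and the boundary term tends to 0. Iterating in \<open>C\<close> determines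
  the ratios of Gauss sums, and hence the ratios of the moments below.
\<close>

lemma gauss_sum_contiguous:
  assumes x: "x > 0" and y: "y > 0" and C: "C > x + y"
  shows "(C - x) * (C - y) * (\<Sum>j. gauss_term x y (C + 1) j) = C * (C - x - y) * (\<Sum>j. gauss_term x y C j)"
proof -
  have C1: "C + 1 > x + y" using C by simp
  have Cp: "C > 0" using x y C by simp
  have shift: "gauss_term x y (C + 1) j = gauss_term x y C j * (C / (C + real j))" for j
  proof -
    have "C * pochhammer (C + 1) j = pochhammer C j * (C + real j)"
      using pochhammer_rec[of C j] pochhammer_Suc[of C j] by simp
    moreover have "pochhammer (C + 1) j > 0" "pochhammer C j > 0" "C + real j > 0" using Cp by (auto intro!: pochhammer_pos)
    ultimately have "pochhammer (C + 1) j = pochhammer C j * ((C + real j) / C)" using Cp by (simp add: field_simps)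
    then show ?thesis unfolding gauss_term_def by (simp add: mult_ac)
  qed
  have term_eq: "C * (C - x - y) * gauss_term x y C j - (C - x) * (C - y) * gauss_term x y (C + 1) j
     = C * (real j * gauss_term x y C j - real (Suc j) * gauss_term x y C (Suc j))" for j
  proof -
    have "C + real j > 0" using Cp by simp
    then have "(C - x - y) - (C - x) * (C - y) / (C + real j) = ((C - x - y) * real j - x * y) / (C + real j)"
      by (simp add: field_simps)
    moreover have "C * (C - x - y) * gauss_term x y C j - (C - x) * (C - y) * gauss_term x y (C + 1) j
       = C * gauss_term x y C j * ((C - x - y) - (C - x) * (C - y) / (C + real j))"
    proof -
      have "C * E * g - M * (g * (C / D)) = C * g * (E - M / D)" for E M g D :: real
        by (simp add: right_diff_distrib mult_ac)
      then show ?thesis unfolding shift .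
    qed
    ultimately show ?thesis unfolding gauss_term_telescope[OF x y C] by simp
  qed
  have "(\<lambda>j. real j * gauss_term x y C j - real (Suc j) * gauss_term x y C (Suc j)) sums (real 0 * gauss_term x y C 0 - 0)"
    by (rule telescope_sums'[OF gauss_term_linear_null[OF x y C]])
  then have "(\<lambda>j. C * (C - x - y) * gauss_term x y C j - (C - x) * (C - y) * gauss_term x y (C + 1) j) sums (C * 0)"
    unfolding term_eq by (intro sums_mult) simp
  moreover have "(\<lambda>j. C * (C - x - y) * gauss_term x y C j - (C - x) * (C - y) * gauss_term x y (C + 1) j)
     sums (C * (C - x - y) * (\<Sum>j. gauss_term x y C j) - (C - x) * (C - y) * (\<Sum>j. gauss_term x y (C + 1) j))"
    using summable_gauss_term[OF x y C] summable_gauss_term[OF x y C1] by (intro sums_diff sums_mult summable_sums)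
  ultimately show ?thesis using sums_unique2 by fastforce
qed

text \<open>The factor \<open>j\<close> shifts all parameters by 1.\<close>

lemma summable_linear_gauss_term:
  assumes x: "x > 0" and y: "y > 0" and p: "p > x + y + 1"
  shows "summable (\<lambda>j. real j * gauss_term x y p j)"
proof -
  have "real (Suc j) * gauss_term x y p (Suc j) = x * y / p * gauss_term (x + 1) (y + 1) (p + 1) j" for j
    unfolding gauss_term_def pochhammer_rec fact_Suc by (simp add: mult_ac del: of_nat_Suc)
  moreover have "summable (gauss_term (x + 1) (y + 1) (p + 1))"
    by (rule summable_gauss_term) (use x y p in auto)
  ultimately have "summable (\<lambda>j. real (Suc j) * gauss_term x y p (Suc j))"
    by (simp add: summable_mult)
  then show ?thesis by (subst (asm) summable_Suc_iff)
qed

section \<open>The Gauss hypergeometric model\<close>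

text \<open>The exponent exceeds 1, so the two branches fit together with derivative 0 at \<open>\<tau> = 1\<close>.\<close>

lemma pos_part_powr_derivative:
  fixes q :: real
  assumes q: "q > 1"
  shows "((\<lambda>\<tau>. max 0 (1 - \<tau>) powr q) has_real_derivative - q * max 0 (1 - \<tau>) powr (q - 1)) (at \<tau>)"
proof -
  consider "\<tau> < 1" | "\<tau> > 1" | "\<tau> = 1" by linarith
  then show ?thesis
  proof cases
    case 1
    have "((\<lambda>\<tau>. (1 - \<tau>) powr q) has_real_derivative - q * (1 - \<tau>) powr (q - 1)) (at \<tau>)"
      using 1 by (auto intro!: derivative_eq_intros)
    then have "((\<lambda>\<tau>. max 0 (1 - \<tau>) powr q) has_real_derivative - q * (1 - \<tau>) powr (q - 1)) (at \<tau>)"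
      by (rule has_field_derivative_transform_within_open[where S = "{..<1}"]) (use 1 in auto)
    then show ?thesis using 1 by simp
  next
    case 2
    have "((\<lambda>\<tau>. 0::real) has_real_derivative 0) (at \<tau>)" by simp
    then have "((\<lambda>\<tau>. max 0 (1 - \<tau>) powr q) has_real_derivative 0) (at \<tau>)"
      by (rule has_field_derivative_transform_within_open[where S = "{1<..}"]) (use 2 in auto)
    then show ?thesis using 2 by simp
  next
    case 3
    have "((\<lambda>s. \<bar>s - 1\<bar> powr (q - 1)) \<longlongrightarrow> \<bar>1 - 1\<bar> powr (q - 1)) (at 1)"
      using q by (intro tendsto_powr' tendsto_intros) auto
    then have lim: "((\<lambda>s. \<bar>s - 1\<bar> powr (q - 1)) \<longlongrightarrow> 0) (at (1::real))" by simp
    have "((\<lambda>s. (max 0 (1 - s) powr q - max 0 (1 - 1) powr q) / (s - 1)) \<longlongrightarrow> 0) (at (1::real))"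
    proof (rule Lim_null_comparison[OF always_eventually lim], rule allI)
      fix s :: real
      show "norm ((max 0 (1 - s) powr q - max 0 (1 - 1) powr q) / (s - 1)) \<le> \<bar>s - 1\<bar> powr (q - 1)"
        using q by (cases "s < 1") (auto simp: powr_diff max_def)
    qed
    then show ?thesis using 3 by (simp add: has_field_derivative_iff)
  qed
qed

lemma pos_part_powr_continuous: "q > 1 \<Longrightarrow> continuous_on S (\<lambda>\<tau>. max 0 (1 - \<tau>) powr (q::real))"
  by (intro continuous_at_imp_continuous_on ballI DERIV_isCont[OF pos_part_powr_derivative])

context
  fixes x y p :: real
begin

text \<open>
  The hypergeometric model as a function of \<open>\<tau> = t^2\<close>, with \<open>x = \<beta> - \<alpha>\<close>, \<open>y = \<gamma> - \<alpha>\<close>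
  and \<open>p = \<beta> - \<alpha> + \<gamma> - d/2\<close>.
\<close>

definition profile :: "real \<Rightarrow> real" where
  "profile \<tau> = max 0 (1 - \<tau>) powr (p - 1) * hyp2F1 x y p (max 0 (1 - \<tau>))"

definition profile1 :: "real \<Rightarrow> real" where
  "profile1 \<tau> = (\<Sum>j. gauss_term x y p j * (- (p - 1 + real j) * max 0 (1 - \<tau>) powr (p - 1 + real j - 1)))"

definition profile2 :: "real \<Rightarrow> real" where
  "profile2 \<tau> = (\<Sum>j. gauss_term x y p j * (- (p - 1 + real j) * (- (p - 1 + real j - 1) * max 0 (1 - \<tau>) powr (p - 1 + real j - 1 - 1))))"

context
  assumes x: "x > 0" and y: "y > 0" and p: "p > x + y + 1" and p3: "p > 3"
begin

private lemma pxy: "p > x + y" using p by simp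

private lemma c0: "gauss_term x y p j \<ge> 0" using gauss_term_pos[OF x y pxy, of j] by simp

lemma profile_sums:
  assumes t: "\<tau> \<ge> 0"
  shows "(\<lambda>j. gauss_term x y p j * max 0 (1 - \<tau>) powr (p - 1 + real j)) sums profile \<tau>"
proof -
  define z where "z = max 0 (1 - \<tau>)"
  have z: "0 \<le> z" "z \<le> 1" using t by (auto simp: z_def)
  have "summable (\<lambda>j. gauss_term x y p j * z ^ j)"
  proof (rule summable_comparison_test[OF _ summable_gauss_term[OF x y pxy]])
    show "\<exists>N. \<forall>n\<ge>N. norm (gauss_term x y p n * z ^ n) \<le> gauss_term x y p n"
      using z c0 by (auto simp: abs_mult power_le_one mult_left_le)
  qed
  then have "(\<lambda>j. gauss_term x y p j * z ^ j) sums hyp2F1 x y p z"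
    by (simp add: hyp2F1_def eval_fps_def gauss_term_def sums_iff)
  then have "(\<lambda>j. z powr (p - 1) * (gauss_term x y p j * z ^ j)) sums (z powr (p - 1) * hyp2F1 x y p z)"
    by (rule sums_mult)
  moreover have "z powr (p - 1) * (gauss_term x y p j * z ^ j) = gauss_term x y p j * z powr (p - 1 + real j)" for j
    using z by (cases "z = 0") (auto simp: powr_add powr_realpow)
  ultimately show ?thesis unfolding profile_def z_def by simp
qed

private lemma summable_linear: "summable (\<lambda>j. gauss_term x y p j * (p - 1 + real j))"
proof -
  have "summable (\<lambda>j. (p - 1) * gauss_term x y p j + real j * gauss_term x y p j)"
    by (intro summable_add summable_mult summable_gauss_term[OF x y pxy] summable_linear_gauss_term[OF x y p])
  then show ?thesis by (simp add: algebra_simps)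
qed

private lemma uniform1:
  "uniform_limit {0..} (\<lambda>n \<tau>. \<Sum>j<n. gauss_term x y p j * (- (p - 1 + real j) * max 0 (1 - \<tau>) powr (p - 1 + real j - 1))) profile1 sequentially"
  unfolding profile1_def[abs_def]
proof (rule Weierstrass_m_test[OF _ summable_linear])
  fix j \<tau> assume "\<tau> \<in> {0::real..}"
  then have "max 0 (1 - \<tau>) powr (p - 1 + real j - 1) \<le> 1" using p3 by (intro powr_le1) auto
  then have "gauss_term x y p j * ((p - 1 + real j) * max 0 (1 - \<tau>) powr (p - 1 + real j - 1)) \<le> gauss_term x y p j * ((p - 1 + real j) * 1)"
    using c0 p3 by (intro mult_left_mono) auto
  moreover have nm: "norm (g * (- q * m)) = g * (q * m)" if "g \<ge> 0" "q \<ge> 0" "m \<ge> 0" for g q m :: real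
    using that by (simp add: abs_mult)
  have "norm (gauss_term x y p j * (- (p - 1 + real j) * max 0 (1 - \<tau>) powr (p - 1 + real j - 1)))
      = gauss_term x y p j * ((p - 1 + real j) * max 0 (1 - \<tau>) powr (p - 1 + real j - 1))"
    by (rule nm) (use c0 p3 in auto)
  ultimately show "norm (gauss_term x y p j * (- (p - 1 + real j) * max 0 (1 - \<tau>) powr (p - 1 + real j - 1))) \<le> gauss_term x y p j * (p - 1 + real j)"
    by simp
qed

text \<open>
  At \<open>\<tau> = 0\<close> the argument of the Gauss series is on the circle of convergence. The derivatives of the terms
  are summable there because \<open>p > x + y + 1\<close>.
\<close>

lemma profile_derivative:
  assumes "\<tau> \<ge> 0"
  shows "(profile has_real_derivative profile1 \<tau>) (at \<tau> within {0..})"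
proof -
  have "\<exists>g. \<forall>\<tau>\<in>{0..}. (\<lambda>j. gauss_term x y p j * max 0 (1 - \<tau>) powr (p - 1 + real j)) sums g \<tau> \<and> (g has_real_derivative profile1 \<tau>) (at \<tau> within {0..})"
  proof (rule has_field_derivative_series[OF _ _ uniform1, of _ 0])
    show "((\<lambda>\<tau>. gauss_term x y p j * max 0 (1 - \<tau>) powr (p - 1 + real j)) has_real_derivative
        gauss_term x y p j * (- (p - 1 + real j) * max 0 (1 - \<tau>) powr (p - 1 + real j - 1))) (at \<tau> within {0..})" for j \<tau>
      using p3 by (intro DERIV_cmult has_field_derivative_at_within[OF pos_part_powr_derivative]) auto
    show "summable (\<lambda>j. gauss_term x y p j * max 0 (1 - 0) powr (p - 1 + real j))"
      using profile_sums[of 0] by (simp add: sums_iff)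
  qed auto
  then obtain g where g: "\<And>\<tau>. \<tau> \<ge> 0 \<Longrightarrow> (\<lambda>j. gauss_term x y p j * max 0 (1 - \<tau>) powr (p - 1 + real j)) sums g \<tau>"
    "\<And>\<tau>. \<tau> \<ge> 0 \<Longrightarrow> (g has_real_derivative profile1 \<tau>) (at \<tau> within {0..})" by auto
  have eq: "g s = profile s" if "s \<ge> 0" for s using sums_unique2[OF g(1)[OF that] profile_sums[OF that]] .
  show ?thesis
    by (rule has_field_derivative_transform_within[OF g(2)[OF assms], where d = 1]) (use assms eq in auto)
qed

lemma profile1_continuous: "continuous (at 0 within {0..}) profile1"
proof -
  have "continuous_on {0..} profile1"
  proof (rule uniform_limit_theorem[OF always_eventually uniform1], rule allI)
    show "continuous_on {0..} (\<lambda>\<tau>. \<Sum>j<n. gauss_term x y p j * (- (p - 1 + real j) * max 0 (1 - \<tau>) powr (p - 1 + real j - 1)))" for n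
      using p3 by (intro continuous_on_sum continuous_on_mult continuous_on_const pos_part_powr_continuous) auto
  qed simp
  then show ?thesis by (simp add: continuous_on_eq_continuous_within)
qed

text \<open>
  Away from \<open>\<tau> = 0\<close> the series converges geometrically, with ratio \<open>1 - \<tau>/2\<close> on the half-line from \<open>\<tau>/2\<close>; smoothness
  at the edge \<open>\<tau> = 1\<close> of the support comes from \<open>p > 3\<close>.
\<close>

lemma profile1_derivative:
  assumes t: "\<tau> > 0"
  shows "(profile1 has_real_derivative profile2 \<tau>) (at \<tau>)"
proof -
  define r where "r = max 0 (1 - \<tau> / 2)"
  have r: "0 \<le> r" "r < 1" using t by (auto simp: r_def)
  have Bs: "(\<lambda>j. gauss_term x y p j * (p - 1 + real j)) \<longlonglongrightarrow> 0" by (rule summable_LIMSEQ_zero[OF summable_linear])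
  then obtain B where B: "\<And>j. norm (gauss_term x y p j * (p - 1 + real j)) \<le> B"
    using convergent_imp_Bseq[of "\<lambda>j. gauss_term x y p j * (p - 1 + real j)"] by (auto simp: convergent_def Bseq_def)
  have sr: "summable (\<lambda>j. (p - 1 + real j) * r ^ j)"
  proof -
    have "summable (\<lambda>j. real j * r ^ j)"
    proof -
      have "norm r < 1" using r by simp
      from powser_times_n_limit_0[of "sqrt r"] have "(\<lambda>n. real n * sqrt r ^ n) \<longlonglongrightarrow> 0" using r by (simp add: real_sqrt_lt_1_iff)
      then obtain D where D: "\<And>n. norm (real n * sqrt r ^ n) \<le> D"
        using convergent_imp_Bseq[of "\<lambda>n. real n * sqrt r ^ n"] by (auto simp: convergent_def Bseq_def)
      show ?thesis
      proof (rule summable_comparison_test)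
        show "summable (\<lambda>n. D * sqrt r ^ n)" using r by (intro summable_mult summable_geometric) (simp add: real_sqrt_lt_1_iff)
        show "\<exists>N. \<forall>n\<ge>N. norm (real n * r ^ n) \<le> D * sqrt r ^ n"
        proof (intro exI allI impI)
          fix n
          have "r ^ n = sqrt r ^ n * sqrt r ^ n" using r by (simp flip: power_mult_distrib)
          then have "norm (real n * r ^ n) = norm (real n * sqrt r ^ n) * sqrt r ^ n" using r by (simp add: abs_mult)
          also have "\<dots> \<le> D * sqrt r ^ n" using r by (intro mult_right_mono D) auto
          finally show "norm (real n * r ^ n) \<le> D * sqrt r ^ n" .
        qed
      qed
    qed
    moreover have "summable (\<lambda>j. r ^ j)" using r by (intro summable_geometric) simp
    ultimately have "summable (\<lambda>j. (p - 1) * r ^ j + real j * r ^ j)" by (intro summable_add summable_mult)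
    then show ?thesis by (simp add: algebra_simps)
  qed
  have unif: "uniform_limit {\<tau>/2..} (\<lambda>n s. \<Sum>j<n. gauss_term x y p j * (- (p - 1 + real j) * (- (p - 1 + real j - 1) * max 0 (1 - s) powr (p - 1 + real j - 1 - 1)))) profile2 sequentially"
    unfolding profile2_def[abs_def]
  proof (rule Weierstrass_m_test[OF _ summable_mult[OF sr, of B]])
    fix j s assume s: "s \<in> {\<tau>/2..}"
    have "max 0 (1 - s) powr (p - 1 + real j - 1 - 1) \<le> r powr (p - 1 + real j - 1 - 1)"
      using s p3 by (intro powr_mono2) (auto simp: r_def)
    also have "\<dots> \<le> r ^ j"
    proof (cases "r = 0")
      case False
      have "p - 1 + real j - 1 - 1 = (p - 3) + real j" by simp
      then have "r powr (p - 1 + real j - 1 - 1) = r powr (p - 3) * r ^ j" using r False by (simp only: powr_add) (simp add: powr_realpow)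
      moreover have "r powr (p - 3) \<le> 1" using r p3 by (intro powr_le1) auto
      ultimately show ?thesis using r mult_right_mono[of "r powr (p - 3)" 1 "r ^ j"] by simp
    qed simp
    finally have m: "max 0 (1 - s) powr (p - 1 + real j - 1 - 1) \<le> r ^ j" .
    have b1: "gauss_term x y p j * (p - 1 + real j) \<le> B" using B[of j] by simp
    have b2: "(p - 1 + real j - 1) * max 0 (1 - s) powr (p - 1 + real j - 1 - 1) \<le> (p - 1 + real j) * r ^ j"
      using m p3 by (intro mult_mono) auto
    have "(gauss_term x y p j * (p - 1 + real j)) * ((p - 1 + real j - 1) * max 0 (1 - s) powr (p - 1 + real j - 1 - 1)) \<le> B * ((p - 1 + real j) * r ^ j)"
      by (rule mult_mono[OF b1 b2]) (use p3 order.trans[OF norm_ge_zero B] in auto)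
    moreover have "norm (gauss_term x y p j * (- (p - 1 + real j) * (- (p - 1 + real j - 1) * max 0 (1 - s) powr (p - 1 + real j - 1 - 1))))
       = (gauss_term x y p j * (p - 1 + real j)) * ((p - 1 + real j - 1) * max 0 (1 - s) powr (p - 1 + real j - 1 - 1))"
      using p3 c0[of j] by (simp add: abs_mult)
    ultimately show "norm (gauss_term x y p j * (- (p - 1 + real j) * (- (p - 1 + real j - 1) * max 0 (1 - s) powr (p - 1 + real j - 1 - 1)))) \<le> B * ((p - 1 + real j) * r ^ j)"
      by simp
  qed
  have sums1: "(\<lambda>j. gauss_term x y p j * (- (p - 1 + real j) * max 0 (1 - s) powr (p - 1 + real j - 1))) sums profile1 s" if "s \<ge> 0" for s
    using tendsto_uniform_limitI[OF uniform1, of s] that by (simp add: sums_def)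
  have "\<exists>g. \<forall>s\<in>{\<tau>/2..}. (\<lambda>j. gauss_term x y p j * (- (p - 1 + real j) * max 0 (1 - s) powr (p - 1 + real j - 1))) sums g s \<and> (g has_real_derivative profile2 s) (at s within {\<tau>/2..})"
  proof (rule has_field_derivative_series[OF _ _ unif, of _ \<tau>])
    show "((\<lambda>s. gauss_term x y p j * (- (p - 1 + real j) * max 0 (1 - s) powr (p - 1 + real j - 1))) has_real_derivative
        gauss_term x y p j * (- (p - 1 + real j) * (- (p - 1 + real j - 1) * max 0 (1 - s) powr (p - 1 + real j - 1 - 1)))) (at s within {\<tau>/2..})" for j s
      using p3 by (intro DERIV_cmult has_field_derivative_at_within[OF pos_part_powr_derivative]) auto
    show "summable (\<lambda>j. gauss_term x y p j * (- (p - 1 + real j) * max 0 (1 - \<tau>) powr (p - 1 + real j - 1)))"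
      using sums1[of \<tau>] t by (simp add: sums_iff)
  qed (use t in auto)
  then obtain g where G: "\<forall>s\<in>{\<tau>/2..}. (\<lambda>j. gauss_term x y p j * (- (p - 1 + real j) * max 0 (1 - s) powr (p - 1 + real j - 1))) sums g s
      \<and> (g has_real_derivative profile2 s) (at s within {\<tau>/2..})" by blast
  have g: "(\<lambda>j. gauss_term x y p j * (- (p - 1 + real j) * max 0 (1 - s) powr (p - 1 + real j - 1))) sums g s"
    "(g has_real_derivative profile2 s) (at s within {\<tau>/2..})" if "s \<ge> \<tau>/2" for s
    using G[THEN bspec, of s] that by simp_all
  have eq: "g s = profile1 s" if "s \<ge> \<tau>/2" for s
    by (rule sums_unique2[OF g(1)[OF that] sums1]) (use t that in auto)
  have "(g has_real_derivative profile2 \<tau>) (at \<tau> within {\<tau>/2<..})"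
    by (rule DERIV_subset[OF g(2)]) (use t in auto)
  then have "(g has_real_derivative profile2 \<tau>) (at \<tau>)"
    using t by (simp add: at_within_open[of \<tau> "{\<tau>/2<..}"])
  then show ?thesis
    by (rule has_field_derivative_transform_within_open[where S = "{\<tau>/2<..}"]) (use t eq in auto)
qed

lemma profile_bound: "\<exists>B\<ge>0. \<forall>\<tau>\<ge>0. 0 \<le> profile \<tau> \<and> profile \<tau> \<le> B"
proof (intro exI[of _ "suminf (gauss_term x y p)"] conjI allI impI)
  show "suminf (gauss_term x y p) \<ge> 0" by (intro suminf_nonneg summable_gauss_term[OF x y pxy] c0)
  fix \<tau> :: real assume t: "\<tau> \<ge> 0"
  show "0 \<le> profile \<tau>" by (rule sums_le[OF _ sums_zero profile_sums[OF t]]) (simp add: c0)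
  have "gauss_term x y p j * max 0 (1 - \<tau>) powr (p - 1 + real j) \<le> gauss_term x y p j" for j
    using c0[of j] t p3 by (intro mult_left_le powr_le1) auto
  then show "profile \<tau> \<le> suminf (gauss_term x y p)"
    by (intro sums_le[OF _ profile_sums[OF t] summable_sums[OF summable_gauss_term[OF x y pxy]]])
qed

lemma profile_eq_0: "\<tau> \<ge> 1 \<Longrightarrow> profile \<tau> = 0"
  by (simp add: profile_def)

lemma profile_continuous: "continuous_on {0..} profile"
  unfolding continuous_on_eq_continuous_within
  by (intro ballI DERIV_continuous[OF profile_derivative]) simp

end
end

lemma Gamma_shift:
  assumes "z > (0::real)"
  shows "Gamma (z + real j) = Gamma z * pochhammer z j"
proof -
  have "z \<notin> \<int>\<^sub>\<le>\<^sub>0" using assms by (auto elim!: nonpos_Ints_cases)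
  then show ?thesis using pochhammer_Gamma[of z j] Gamma_real_pos[OF assms] by simp
qed

text \<open>
  Term by term these are ball moments, and their Gamma quotients turn the coefficients with parameter \<open>p\<close> into
  those with parameter \<open>C\<close>.
\<close>

lemma profile_moment:
  fixes \<xi> :: "'a::euclidean_space" and k :: nat
  assumes x: "x > 0" and y: "y > 0" and p: "p > x + y + 1" and p3: "p > 3"
  defines "C \<equiv> p + real k + real DIM('a) / 2"
  shows "(\<integral>v. profile x y p ((norm v)\<^sup>2) * (v \<bullet> \<xi>) ^ (2 * k) \<partial>lborel)
     = Gamma p / Gamma C * (\<Sum>j. gauss_term x y C j) * gauss_moment k \<xi>"
proof -
  have pxy: "p > x + y" using p by simp
  have Cp: "C \<ge> p" by (simp add: C_def)
  then have Cxy: "C > x + y" using pxy by simp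
  have pos: "p > 0" "C > 0" using p3 Cp by auto
  define W where "W v = profile x y p ((norm v)\<^sup>2) * (v \<bullet> \<xi>) ^ (2 * k)" for v :: 'a
  define t where "t j v = gauss_term x y p j * ball_kernel (p - 1 + real j) k \<xi> v" for j and v :: 'a
  have t0: "t j v \<ge> 0" for j v
    unfolding t_def using gauss_term_pos[OF x y pxy, of j] by (simp add: ball_kernel_nonneg)
  have ts: "(\<lambda>j. t j v) sums W v" for v
  proof -
    have "(\<lambda>j. gauss_term x y p j * max 0 (1 - (norm v)\<^sup>2) powr (p - 1 + real j) * (v \<bullet> \<xi>) ^ (2 * k)) sums W v"
      unfolding W_def by (intro sums_mult2 profile_sums[OF x y p p3]) simp
    then show ?thesis by (simp add: t_def ball_kernel_def mult.assoc)
  qed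
  obtain B where B: "B \<ge> 0" "\<And>\<tau>. \<tau> \<ge> 0 \<Longrightarrow> 0 \<le> profile x y p \<tau> \<and> profile x y p \<tau> \<le> B"
    using profile_bound[OF x y p p3] by blast
  have contW: "continuous_on UNIV W"
    unfolding W_def by (intro continuous_intros continuous_on_compose2[OF profile_continuous[OF x y p p3]]) auto
  then have Wm: "W \<in> borel_measurable borel" by (rule borel_measurable_continuous_onI)
  have Wint: "integrable lborel W"
  proof (rule Bochner_Integration.integrable_bound)
    show "integrable lborel (\<lambda>v::'a. B * (indicator (cball 0 1) v * norm \<xi> ^ (2 * k)))"
      using emeasure_bounded_finite[OF bounded_cball[of "0::'a" 1]]
      by (intro integrable_mult_right integrable_mult_left integrable_real_indicator) auto
    show "AE v in lborel. norm (W v) \<le> norm (B * (indicator (cball 0 1) v * norm \<xi> ^ (2 * k)))"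
    proof (rule AE_I2)
      fix v :: 'a
      show "norm (W v) \<le> norm (B * (indicator (cball 0 1) v * norm \<xi> ^ (2 * k)))"
      proof (cases "norm v \<le> 1")
        case True
        have "\<bar>v \<bullet> \<xi>\<bar> \<le> norm v * norm \<xi>" by (rule Cauchy_Schwarz_ineq2)
        also have "\<dots> \<le> 1 * norm \<xi>" using True by (intro mult_right_mono) auto
        finally have "\<bar>v \<bullet> \<xi>\<bar> ^ (2 * k) \<le> norm \<xi> ^ (2 * k)" by (intro power_mono) auto
        then have "\<bar>profile x y p ((norm v)\<^sup>2)\<bar> * \<bar>v \<bullet> \<xi>\<bar> ^ (2 * k) \<le> B * norm \<xi> ^ (2 * k)"
          using B(2)[of "(norm v)\<^sup>2"] B(1) by (intro mult_mono) auto
        then show ?thesis using True B(1) by (simp add: W_def abs_mult power_abs)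
      next
        case False
        then have "(norm v)\<^sup>2 \<ge> 1" by simp
        then show ?thesis by (simp add: W_def profile_eq_0[OF x y p p3])
      qed
    qed
  qed (use Wm in simp)
  have tint: "integrable lborel (t j)" for j
    unfolding t_def using p3 by (intro integrable_mult_right ball_kernel_integrable) auto
  have "(\<lambda>N. \<integral>v. (\<Sum>j<N. t j v) \<partial>lborel) \<longlonglongrightarrow> (\<integral>v. W v \<partial>lborel)"
  proof (rule integral_dominated_convergence[OF _ _ Wint])
    show "AE v in lborel. (\<lambda>N. \<Sum>j<N. t j v) \<longlonglongrightarrow> W v" using ts by (simp add: sums_def)
    show "AE v in lborel. norm (\<Sum>j<N. t j v) \<le> W v" for N
    proof (rule AE_I2)
      fix v
      have "(\<Sum>j<N. t j v) \<le> W v"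
        using sum_le_suminf[of "\<lambda>j. t j v" "{..<N}"] ts[of v] t0 by (simp add: sums_iff)
      then show "norm (\<Sum>j<N. t j v) \<le> W v" using t0 by (simp add: sum_nonneg)
    qed
  qed (use Wm tint in auto)
  then have A: "(\<lambda>j. \<integral>v. t j v \<partial>lborel) sums (\<integral>v. W v \<partial>lborel)"
    unfolding sums_def by (simp add: tint)
  have "(\<integral>v. t j v \<partial>lborel) = Gamma p / Gamma C * gauss_term x y C j * gauss_moment k \<xi>" for j
  proof -
    have "(\<integral>v. t j v \<partial>lborel) = gauss_term x y p j * (\<integral>v. ball_kernel (p - 1 + real j) k \<xi> v \<partial>lborel)"
      unfolding t_def by simp
    also have "(\<integral>v. ball_kernel (p - 1 + real j) k \<xi> v \<partial>lborel)
        = Gamma (p + real j) / Gamma (C + real j) * gauss_moment k \<xi>"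
    proof -
      have e: "p - 1 + real j + 1 = p + real j" "p - 1 + real j + real k + real DIM('a) / 2 + 1 = C + real j"
        by (simp_all add: C_def)
      show ?thesis using ball_moment[of "p - 1 + real j" k \<xi>] p3 unfolding e by simp
    qed
    also have "Gamma (p + real j) = Gamma p * pochhammer p j"
      using pos(1) by (rule Gamma_shift)
    also have "Gamma (C + real j) = Gamma C * pochhammer C j"
      using pos(2) by (rule Gamma_shift)
    finally show ?thesis
      using pochhammer_pos[OF pos(1), of j] by (simp add: gauss_term_def mult_ac)
  qed
  moreover have "(\<lambda>j. Gamma p / Gamma C * gauss_term x y C j * gauss_moment k \<xi>) sums
      (Gamma p / Gamma C * (\<Sum>j. gauss_term x y C j) * gauss_moment k \<xi>)"
    by (intro sums_mult sums_mult2 summable_sums summable_gauss_term[OF x y Cxy])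
  ultimately show ?thesis using A sums_unique2 unfolding W_def by simp
qed

text \<open>
  With \<open>C = x + y + \<alpha> + k\<close> the contiguous relation for the Gauss sums makes consecutive moments differ by the factor
  \<open>(\<alpha> + k) / ((\<alpha> + x + k) (\<alpha> + y + k))\<close>, so the Fourier transform is a multiple of \<open>1F2(\<alpha>; \<alpha> + x, \<alpha> + y)\<close>.
\<close>

lemma stationary_covariance_profile:
  fixes \<alpha> x y p :: real
  assumes alpha: "2 * \<alpha> > real DIM('a::euclidean_space) + 2" and x: "x > 0" and y: "y > 0"
    and line: "x + y \<ge> \<alpha> + 1/2" and hyp: "2 * x * y \<ge> \<alpha>" and p_eq: "p = x + y + \<alpha> - real DIM('a) / 2"
  shows "stationary_covariance (\<lambda>h::'a. profile x y p ((norm h)\<^sup>2))"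
proof -
  have d1: "real DIM('a) \<ge> 1" using DIM_positive[where 'a='a] by linarith
  have p: "p > x + y + 1" using alpha p_eq by simp
  have p3: "p > 3" using alpha p_eq line d1 by linarith
  have a12: "\<alpha> > 1/2" using alpha d1 by simp
  define \<Phi> where "\<Phi> h = profile x y p ((norm h)\<^sup>2)" for h :: 'a
  obtain B where B: "B \<ge> 0" "\<And>\<tau>. \<tau> \<ge> 0 \<Longrightarrow> 0 \<le> profile x y p \<tau> \<and> profile x y p \<tau> \<le> B"
    using profile_bound[OF x y p p3] by blast
  have cont: "continuous_on UNIV \<Phi>"
    unfolding \<Phi>_def by (intro continuous_intros continuous_on_compose2[OF profile_continuous[OF x y p p3]]) auto
  have meas [measurable]: "\<Phi> \<in> borel_measurable borel" by (rule borel_measurable_continuous_onI[OF cont])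
  have le: "norm (\<Phi> v) \<le> B * indicator (cball 0 1) v" for v
  proof (cases "norm v \<le> 1")
    case True
    then show ?thesis using B(2)[of "(norm v)\<^sup>2"] by (simp add: \<Phi>_def)
  next
    case False
    then have "(norm v)\<^sup>2 \<ge> 1" by simp
    then show ?thesis using False by (simp add: \<Phi>_def profile_eq_0[OF x y p p3])
  qed
  have ind: "integrable lborel (\<lambda>v::'a. indicator (cball 0 1) v :: real)"
    using emeasure_bounded_finite[OF bounded_cball[of "0::'a" 1]] by (intro integrable_real_indicator) auto
  have int: "integrable lborel \<Phi>"
    by (rule Bochner_Integration.integrable_bound[OF integrable_mult_right[OF ind, of B]])
       (use le B(1) in \<open>auto intro!: AE_I2 order.trans[OF le]\<close>)
  show ?thesis unfolding \<Phi>_def[symmetric]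
  proof (rule stationary_covariance_Fourier[OF cont _ int])
    show "\<Phi> (- v) = \<Phi> v" for v by (simp add: \<Phi>_def)
    show "\<bar>\<Phi> v\<bar> \<le> B" for v
      using le[of v] B(1) by (cases "norm v \<le> 1") auto
    fix \<xi> :: 'a
    define C where "C k = p + real k + real DIM('a) / 2" for k :: nat
    define m where "m k = Gamma p / Gamma (C k) * (\<Sum>j. gauss_term x y (C k) j)" for k
    have Cxy: "C k > x + y" and Cpos: "C k > 0" for k using p p3 x y by (auto simp: C_def)
    have m0: "m 0 \<ge> 0"
      unfolding m_def using Cpos[of 0] p3 gauss_term_pos[OF x y Cxy]
      by (intro mult_nonneg_nonneg divide_nonneg_nonneg suminf_nonneg summable_gauss_term[OF x y Cxy])
         (auto intro!: less_imp_le Gamma_real_pos)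
    have m_Suc: "m (Suc k) * ((\<alpha> + x + real k) * (\<alpha> + y + real k)) = m k * (\<alpha> + real k)" for k
    proof -
      have cs: "(\<alpha> + x + real k) * (\<alpha> + y + real k) * (\<Sum>j. gauss_term x y (C (Suc k)) j)
          = C k * (\<alpha> + real k) * (\<Sum>j. gauss_term x y (C k) j)"
      proof -
        have e: "C k + 1 = C (Suc k)" "C k - x = \<alpha> + y + real k" "C k - y = \<alpha> + x + real k" "\<alpha> + y + real k - y = \<alpha> + real k"
          by (simp_all add: C_def p_eq)
        show ?thesis using gauss_sum_contiguous[OF x y Cxy[of k]] unfolding e by (simp only: mult.commute)
      qed
      have "Gamma (C (Suc k)) = C k * Gamma (C k)"
        using Gamma_shift[OF Cpos[of k], of 1] by (simp add: C_def add_ac mult.commute)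
      then have "m (Suc k) * ((\<alpha> + x + real k) * (\<alpha> + y + real k))
          = Gamma p / (C k * Gamma (C k)) * (C k * (\<alpha> + real k) * (\<Sum>j. gauss_term x y (C k) j))"
        unfolding m_def cs[symmetric] by (simp add: mult_ac)
      then show ?thesis using Cpos[of k] by (simp add: m_def)
    qed
    have m_eq: "m k = m 0 * (pochhammer \<alpha> k / (pochhammer (\<alpha> + x) k * pochhammer (\<alpha> + y) k))" for k
    proof (induction k)
      case (Suc k)
      have pos: "\<alpha> + x + real k > 0" "\<alpha> + y + real k > 0" using a12 x y by auto
      have "m (Suc k) = m k * (\<alpha> + real k) / ((\<alpha> + x + real k) * (\<alpha> + y + real k))"
      proof -
        have "(\<alpha> + x + real k) * (\<alpha> + y + real k) \<noteq> 0" using pos by simp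
        from nonzero_eq_divide_eq[OF this] show ?thesis using m_Suc[of k] by blast
      qed
      then show ?case by (simp add: Suc.IH pochhammer_Suc mult_ac)
    qed simp
    have S1: "(\<lambda>k. (-1) ^ k / fact (2 * k) * (\<integral>v. \<Phi> v * (v \<bullet> \<xi>) ^ (2 * k) \<partial>lborel)) sums (\<integral>v. \<Phi> v * cos (v \<bullet> \<xi>) \<partial>lborel)"
    proof (rule even_series_integral)
      show "\<Phi> v \<ge> 0" for v using B(2)[of "(norm v)\<^sup>2"] by (simp add: \<Phi>_def)
      show "integrable lborel (\<lambda>v. \<Phi> v * cosh (v \<bullet> \<xi>))"
      proof (rule Bochner_Integration.integrable_bound[OF integrable_mult_right[OF ind, of "B * cosh (norm \<xi>)"]])
        show "AE v in lborel. norm (\<Phi> v * cosh (v \<bullet> \<xi>)) \<le> norm (B * cosh (norm \<xi>) * indicator (cball 0 1) v)"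
        proof (rule AE_I2)
          fix v :: 'a
          show "norm (\<Phi> v * cosh (v \<bullet> \<xi>)) \<le> norm (B * cosh (norm \<xi>) * indicator (cball 0 1) v)"
          proof (cases "norm v \<le> 1")
            case True
            have "\<bar>v \<bullet> \<xi>\<bar> \<le> norm v * norm \<xi>" by (rule Cauchy_Schwarz_ineq2)
            also have "\<dots> \<le> 1 * norm \<xi>" using True by (intro mult_right_mono) auto
            finally have "cosh \<bar>v \<bullet> \<xi>\<bar> \<le> cosh (norm \<xi>)" by (subst cosh_real_nonneg_le_iff) auto
            then have "norm (\<Phi> v) * cosh (v \<bullet> \<xi>) \<le> B * cosh (norm \<xi>)"
              using le[of v] True B(1) by (intro mult_mono) auto
            then show ?thesis using True B(1) by (simp add: abs_mult)
          next
            case False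
            then show ?thesis using le[of v] by simp
          qed
        qed
        show "(\<lambda>v. \<Phi> v * cosh (v \<bullet> \<xi>)) \<in> borel_measurable lborel"
          using cont by (auto intro!: borel_measurable_continuous_onI continuous_intros)
      qed
      show "(\<lambda>k. (-1) ^ k * (z ^ (2 * k) / fact (2 * k))) sums cos z" for z :: real
        using cos_paired[of z] by simp
    qed auto
    define T where "T = (norm \<xi>)\<^sup>2"
    define Z where "Z = gauss_total TYPE('a)"
    define f where "f N = pochhammer \<alpha> N / (pochhammer (\<alpha> + x) N * pochhammer (\<alpha> + y) N * fact N) * (- T / 4) ^ N" for N
    have "(-1) ^ k / fact (2 * k) * (\<integral>v. \<Phi> v * (v \<bullet> \<xi>) ^ (2 * k) \<partial>lborel) = m 0 * Z * f k" for k
    proof -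
      have T4: "(- T / 4) ^ k = (-1) ^ k * norm \<xi> ^ (2 * k) / 4 ^ k"
      proof -
        have "- T / 4 = (-1) * (T / 4)" by simp
        then show ?thesis by (simp only: power_mult_distrib power_divide power_mult T_def times_divide_eq_right)
      qed
      have "(\<integral>v. \<Phi> v * (v \<bullet> \<xi>) ^ (2 * k) \<partial>lborel) = m k * gauss_moment k \<xi>"
        unfolding \<Phi>_def m_def C_def by (rule profile_moment[OF x y p p3])
      then show ?thesis
        unfolding m_eq[of k] gauss_moment_eq f_def T4 Z_def by (simp add: mult_ac)
    qed
    then have S2: "(\<lambda>k. m 0 * Z * f k) sums (\<integral>v. \<Phi> v * cos (v \<bullet> \<xi>) \<partial>lborel)" using S1 by simp
    have "T \<ge> 0" by (simp add: T_def)
    then obtain s where s: "s \<ge> 0" "f sums s"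
      unfolding f_def using hyp1F2_nonneg[OF a12 x y line hyp] by blast
    have "(\<integral>v. \<Phi> v * cos (v \<bullet> \<xi>) \<partial>lborel) = m 0 * Z * s"
      by (rule sums_unique2[OF S2 sums_mult[OF s(2)]])
    also have "\<dots> \<ge> 0" using m0 s(1) gauss_total_pos[where 'a='a] by (simp add: Z_def)
    finally show "(\<integral>v. \<Phi> v * cos (v \<bullet> \<xi>) \<partial>lborel) \<ge> 0" .
  qed
qed

text \<open>The hyperbola condition forces \<open>x\<close> and \<open>y\<close> to have equal signs, and the line condition makes them positive.\<close>

theorem T3_gauss_hypergeometric:
  fixes u :: "'a::euclidean_space"
  assumes ab: "a1 > 0" "a2 > 0" "b1 \<ge> 0" "b2 \<ge> 0" "norm u = 1"
    and alpha: "2 * \<alpha> > real DIM('a) + 2" and hyp: "2 * (\<beta> - \<alpha>) * (\<gamma> - \<alpha>) \<ge> \<alpha>" and line: "2 * (\<beta> + \<gamma>) \<ge> 6 * \<alpha> + 1"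
  shows "stationary_covariance (T3 a1 a2 b1 b2 u (gauss_hypergeometric_model DIM('a) \<alpha> \<beta> \<gamma>))"
proof -
  define x where "x = \<beta> - \<alpha>"
  define y where "y = \<gamma> - \<alpha>"
  define p where "p = \<beta> - \<alpha> + \<gamma> - real DIM('a) / 2"
  have d1: "real DIM('a) \<ge> 1" using DIM_positive[where 'a='a] by linarith
  have xy: "x + y \<ge> \<alpha> + 1/2" "2 * x * y \<ge> \<alpha>" using line hyp by (auto simp: x_def y_def)
  have "x * y > 0" "x + y > 0" using xy alpha d1 by auto
  then have x: "x > 0" and y: "y > 0" by (auto simp: zero_less_mult_iff)
  have p_eq: "p = x + y + \<alpha> - real DIM('a) / 2" by (simp add: p_def x_def y_def)
  have p: "p > x + y + 1" using alpha p_eq by simp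
  have p3: "p > 3" using alpha p_eq xy(1) d1 by linarith
  show ?thesis
  proof (rule T3_stationary_covariance[OF ab, where g = "profile x y p" and ?g1.0 = "profile1 x y p" and ?g2.0 = "profile2 x y p"])
    show "stationary_covariance (\<lambda>h::'a. profile x y p ((norm h)\<^sup>2))"
      by (rule stationary_covariance_profile[OF alpha x y xy p_eq])
    show "gauss_hypergeometric_model DIM('a) \<alpha> \<beta> \<gamma> t = profile x y p (t\<^sup>2)" for t
      unfolding gauss_hypergeometric_model_def profile_def by (simp add: p_def x_def y_def)
  qed (use profile_derivative[OF x y p p3] profile1_derivative[OF x y p p3] profile1_continuous[OF x y p p3] in auto)
qed

section \<open>The three families\<close>

theorem corollary4p3:
  fixes u :: "real ^ 'd" and a1 a2 b1 b2 :: real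
  assumes "a1 > 0" and "a2 > 0" and "b1 \<ge> 0" and "b2 \<ge> 0" and "norm u = 1"
  shows "(\<forall>\<nu>::real. \<nu> > 1 \<longrightarrow> stationary_covariance (T3 a1 a2 b1 b2 u (matern \<nu>))) \<and>
    (\<forall>\<delta>::real. \<delta> > 0 \<longrightarrow> stationary_covariance (T3 a1 a2 b1 b2 u (cauchy_model \<delta>))) \<and>
    (\<forall>\<alpha> \<beta> \<gamma> :: real.
       2 * \<alpha> > real CARD('d) + 2 \<and> 2 * (\<beta> - \<alpha>) * (\<gamma> - \<alpha>) \<ge> \<alpha> \<and> 2 * (\<beta> + \<gamma>) \<ge> 6 * \<alpha> + 1 \<longrightarrow>
       stationary_covariance
         (T3 a1 a2 b1 b2 u (gauss_hypergeometric_model CARD('d) \<alpha> \<beta> \<gamma>)))"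
proof (intro conjI allI impI)
  show "stationary_covariance (T3 a1 a2 b1 b2 u (matern \<nu>))" if "\<nu> > 1" for \<nu> :: real
    by (rule T3_matern[OF assms that])
  show "stationary_covariance (T3 a1 a2 b1 b2 u (cauchy_model \<delta>))" if "\<delta> > 0" for \<delta> :: real
    by (rule T3_cauchy[OF assms that])
  fix \<alpha> \<beta> \<gamma> :: real
  assume *: "2 * \<alpha> > real CARD('d) + 2 \<and> 2 * (\<beta> - \<alpha>) * (\<gamma> - \<alpha>) \<ge> \<alpha> \<and> 2 * (\<beta> + \<gamma>) \<ge> 6 * \<alpha> + 1"
  have "DIM(real ^ 'd) = CARD('d)" by simp
  then show "stationary_covariance (T3 a1 a2 b1 b2 u (gauss_hypergeometric_model CARD('d) \<alpha> \<beta> \<gamma>))"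
    using T3_gauss_hypergeometric[OF assms, of \<alpha> \<beta> \<gamma>] * by simp
qed

end
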